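(* Let $C_1,C_2,\dots,C_m$ be closed convex semi-algebraic sets in $\mathbb{R}^n$ with non-empty intersection which can be described by polynomials on $\mathbb{R}^n$ having degree $d$, in the sense that each of them has a representation of the form $$\bigcap_{j=1}^{s}\bigcup_{i=1}^{l}\{x\in\mathbb{R}^n: f_{ij}(x)=0,\ h_{ij}(x)<0\}$$ with polynomials $f_{ij},h_{ij}$ of degree $d$. Let $\Omega_1,\dots,\Omega_p$ be a list of 2-tuples in $\{(i_1,i_2): i_1,i_2\in\{1,\dots,m\},\ i_1\ne i_2\}$ with $\bigcup_{j=1}^p\Omega_j=\{1,\dots,m\}$ (i.e. every index in $\{1,\dots,m\}$ occurs in some $\Omega_j$). Then: (a) For each $j\in\{1,\dots,p\}$, the operator $T_{\Omega_j}$ is bounded Hölder regular. Moreover, if $d=1$, then $T_{\Omega_j}$ is bounded Hölder regular with uniform exponent $1$. (b) The collection $\{\operatorname{Fix}T_{\Omega_j}\}_{j=1}^p$ has a bounded Hölder regular intersection. In particular, let $(x^t)_{t\in\mathbb{N}}$ be generated, from an arbitrary $x^0\in\mathbb{R}^n$, by the multiple-sets Douglas--Rachford algorithm: for each $t\in\mathbb{N}$, with $(i_1,i_2):=\Omega_{t'}$ where $t'\in\{1,\dots,p\}$ and $t'\equiv t+1 \pmod p$, $$y^{t+1}:=P_{C_{i_1}}(x^t),\qquad z^{t+1}:=P_{C_{i_2}}(2y^{t+1}-x^t),\qquad x^{t+1}:=x^t+(z^{t+1}-y^{t+1}).$$ Then there exists $\rho>0$ such that $x^t\to\bar x$ for some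 $\bar x\in\bigcap_{j=1}^p\operatorname{Fix}T_{\Omega_j}$ with at least a sublinear rate $O(t^{-\rho})$.
   Context: $\mathbb{N}=\{0,1,2,\dots\}$; $\operatorname{Fix}T=\{x: T(x)=x\}$; $d(x,A)=\inf_{a\in A}\|x-a\|$; $P_A$ is the nearest point projection onto the closed convex set $A$ and $R_A:=2P_A-I$. The Douglas--Rachford operator for closed convex sets $C,D$ is $T_{C,D}=\frac12(I+R_DR_C)$; for $\Omega_j=(i_1,i_2)$, $T_{\Omega_j}:=T_{C_{i_1},C_{i_2}}$, so that the algorithm reads $x^{t+1}=T_{\Omega_{t'}}(x^t)$. An operator $T:H\to H$ (here $H=\mathbb{R}^n$) is bounded Hölder regular if for each bounded set $K\subseteq H$ there exist $\gamma\in(0,1]$ and $\mu>0$ such that $d(x,\operatorname{Fix}T)\le\mu\|x-T(x)\|^\gamma$ for all $x\in K$. If the exponent $\gamma$ can be chosen independently of $K$, $T$ is bounded Hölder regular with uniform exponent $\gamma$. A collection $\{A_j\}_{j\in J}$ of closed convex sets with non-empty intersection has a bounded Hölder regular intersection if for each bounded set $K$ there exist $\gamma\in(0,1]$ and $\beta>0$ such that $d(x,\bigcap_{j\in J}A_j)\le\beta\left(\max_{j\in J}d(x,A_j)\right)^\gamma$ for all $x\in K$. Convergence with rate $O(t^{-\rho})$ means $\|x^t-\bar x\|\le Mt^{-\rho}$ for all $t\ge1$ and some constant $M$. *)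

theory Defs
  imports "HOL-Analysis.Analysis" "HOL-Number_Theory.Cong"
begin

section \<open>Polynomials of bounded degree and semi-algebraic sets\<close>

text \<open>
  A multi-index is a function from the coordinates to the naturals, and the coefficient
  function is read only on the multi-indices of total degree at most \<open>d\<close>. A polynomial
  ``of degree \<open>d\<close>'' is one of degree at most \<open>d\<close>: if the equations \<open>f = 0\<close> below needed
  exact degree \<open>d \<ge> 1\<close>, every described set would have empty interior or be the whole space.
\<close>

definition multi_indices :: "nat \<Rightarrow> ('n::finite \<Rightarrow> nat) set"
  where "multi_indices d = {\<alpha>. (\<Sum>i\<in>UNIV. \<alpha> i) \<le> d}"

definition polynomial_of_degree :: "nat \<Rightarrow> (real ^ 'n \<Rightarrow> real) \<Rightarrow> bool"
  where "polynomial_of_degree d f \<longleftrightarrow>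
    (\<exists>c. \<forall>x. f x = (\<Sum>\<alpha>\<in>multi_indices d. c \<alpha> * (\<Prod>i\<in>UNIV. (x $ i) ^ \<alpha> i)))"

text \<open>The sum above is a genuine finite sum.\<close>

lemma finite_multi_indices: "finite (multi_indices d :: ('n::finite \<Rightarrow> nat) set)"
proof -
  have "multi_indices d \<subseteq> (UNIV :: 'n set) \<rightarrow>\<^sub>E {..d}"
  proof
    fix \<alpha> :: "'n \<Rightarrow> nat" assume "\<alpha> \<in> multi_indices d"
    then have "\<alpha> i \<le> d" for i
      using member_le_sum[of i UNIV \<alpha>] by (simp add: multi_indices_def)
    then show "\<alpha> \<in> UNIV \<rightarrow>\<^sub>E {..d}" by auto
  qed
  then show ?thesis
    by (rule finite_subset) (simp add: finite_PiE)
qed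

definition semialgebraic_of_degree :: "nat \<Rightarrow> (real ^ 'n) set \<Rightarrow> bool"
  where "semialgebraic_of_degree d S \<longleftrightarrow>
    (\<exists>(s::nat) (l::nat) f h.
      (\<forall>i\<in>{1..l}. \<forall>j\<in>{1..s}.
        polynomial_of_degree d (f i j) \<and> polynomial_of_degree d (h i j)) \<and>
      S = (\<Inter>j\<in>{1..s}. \<Union>i\<in>{1..l}. {x. f i j x = 0 \<and> h i j x < 0}))"


section \<open>Hoelder regularity\<close>

definition Fix :: "('a \<Rightarrow> 'a) \<Rightarrow> 'a set"
  where "Fix T = {x. T x = x}"

text \<open>
  The library sets \<open>infdist x {} = 0\<close>, whereas the infimum over the empty set is \<open>\<infinity>\<close>. With the
  latter convention the regularity inequalities force the sets in question to be non-empty,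
  so non-emptiness is required explicitly.
\<close>

definition bounded_Hoelder_regular :: "('a::euclidean_space \<Rightarrow> 'a) \<Rightarrow> bool"
  where "bounded_Hoelder_regular T \<longleftrightarrow>
    Fix T \<noteq> {} \<and>
    (\<forall>K. bounded K \<longrightarrow>
      (\<exists>\<gamma> \<mu>. 0 < \<gamma> \<and> \<gamma> \<le> 1 \<and> 0 < \<mu> \<and>
        (\<forall>x\<in>K. infdist x (Fix T) \<le> \<mu> * norm (x - T x) powr \<gamma>)))"

definition bounded_Hoelder_regular_with_uniform_exponent ::
    "real \<Rightarrow> ('a::euclidean_space \<Rightarrow> 'a) \<Rightarrow> bool"
  where "bounded_Hoelder_regular_with_uniform_exponent \<gamma> T \<longleftrightarrow>
    Fix T \<noteq> {} \<and> 0 < \<gamma> \<and> \<gamma> \<le> 1 \<and>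
    (\<forall>K. bounded K \<longrightarrow>
      (\<exists>\<mu>. 0 < \<mu> \<and> (\<forall>x\<in>K. infdist x (Fix T) \<le> \<mu> * norm (x - T x) powr \<gamma>)))"

text \<open>
  The notion is meant for finite non-empty index sets \<open>J\<close>, for which \<open>Max\<close> is the maximum;
  it includes that the \<open>A j\<close> are closed convex sets with non-empty intersection.
\<close>

definition bounded_Hoelder_regular_intersection ::
    "'i set \<Rightarrow> ('i \<Rightarrow> 'a::euclidean_space set) \<Rightarrow> bool"
  where "bounded_Hoelder_regular_intersection J A \<longleftrightarrow>
    (\<forall>j\<in>J. closed (A j) \<and> convex (A j)) \<and> (\<Inter>j\<in>J. A j) \<noteq> {} \<and>
    (\<forall>K. bounded K \<longrightarrow>
      (\<exists>\<gamma> \<beta>. 0 < \<gamma> \<and> \<gamma> \<le> 1 \<and> 0 < \<beta> \<and>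
        (\<forall>x\<in>K. infdist x (\<Inter>j\<in>J. A j)
                 \<le> \<beta> * (Max ((\<lambda>j. infdist x (A j)) ` J)) powr \<gamma>)))"


section \<open>Douglas--Rachford operators and the multiple-sets algorithm\<close>

definition reflection :: "'a::euclidean_space set \<Rightarrow> 'a \<Rightarrow> 'a"
  where "reflection A x = 2 *\<^sub>R closest_point A x - x"

definition DR :: "'a::euclidean_space set \<Rightarrow> 'a set \<Rightarrow> 'a \<Rightarrow> 'a"
  where "DR C D x = (1/2) *\<^sub>R (x + reflection D (reflection C x))"

definition DR_pair :: "(nat \<Rightarrow> 'a::euclidean_space set) \<Rightarrow> nat \<times> nat \<Rightarrow> 'a \<Rightarrow> 'a"
  where "DR_pair C \<omega> = DR (C (fst \<omega>)) (C (snd \<omega>))"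

definition multiple_sets_DR ::
    "(nat \<Rightarrow> 'a::euclidean_space set) \<Rightarrow> nat \<Rightarrow> (nat \<Rightarrow> nat \<times> nat)
      \<Rightarrow> (nat \<Rightarrow> 'a) \<Rightarrow> (nat \<Rightarrow> 'a) \<Rightarrow> (nat \<Rightarrow> 'a) \<Rightarrow> bool"
  where "multiple_sets_DR C p \<Omega> x y z \<longleftrightarrow>
    (\<forall>t. \<forall>t'\<in>{1..p}. [t' = t + 1] (mod p) \<longrightarrow>
      (let (i1, i2) = \<Omega> t' in
        y (t + 1) = closest_point (C i1) (x t) \<and>
        z (t + 1) = closest_point (C i2) (2 *\<^sub>R y (t + 1) - x t) \<and>
        x (t + 1) = x t + (z (t + 1) - y (t + 1))))"

end

theory Submission
  imports Defs
begin

text \<open>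
  Everything rests on a Lojasiewicz inequality \<open>c * f x ^ N \<le> g x\<close> on compact sets for continuous
  functions that are definable over the reals, with \<open>N = 1\<close> if only affine functions enter the
  definitions. Quantifier elimination is obtained in a semantic form: a predicate is definable if
  it depends only on the signs of finitely many polynomials, and by the argument of Cohen and
  Hoermander the signs of finitely many coefficient functions determine the order pattern of the
  signs of a family of univariate polynomials. For the inequality, let \<open>y\<close> be the minimum of \<open>g\<close>
  over \<open>{x. t \<le> f x}\<close>. One of the polynomials in the definition has to vanish at \<open>(t, y)\<close>, and this
  alone bounds \<open>y\<close> from below by a power of \<open>t\<close>.

  A projection onto a convex definable set is definable. In the affine case this holds because the
  normal cone is constant on sign classes and is cut out by the vertices of a polytope. The
  regularity statements are instances of the inequality, and so is the error bound that relates
  the distance to the common fixed points to the residuals. Together with Fejer monotonicity it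
  turns into \<open>c * e t ^ N \<le> e t - e (t + p)\<close> for the squared distances \<open>e t\<close>, and summation gives
  the rate.
\<close>

section \<open>Sign patterns of univariate polynomials\<close>

text \<open>The claim for \<open>d = 1\<close> shapes the development: the exponent is exactly 1
  only if every auxiliary set and function stays semilinear. The Euclidean norm, Euclidean balls and
  the inner product of two variable vectors are not. Distances and residuals are therefore measured
  in the maximum norm and compared with the Euclidean ones only afterwards, and projections need a
  separate argument in the affine case. In the general case exponents are not tracked: degrees grow
  during elimination, but only the existence of some \<open>N\<close> is claimed, and the Hoelder
  exponent is then \<open>1 / N\<close>. For the same reason the convergence rate does not combine
  the exponents of the two regularity statements; the inequality is applied once more, directly to
  the distance to the common fixed points and the largest residual.\<close>

definition gap :: "real set \<Rightarrow> real set \<Rightarrow> real set"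
  where "gap L U = {w. (\<forall>z\<in>L. z < w) \<and> (\<forall>z\<in>U. w < z)}"

lemma gap_between: "u \<in> gap L U \<Longrightarrow> w \<in> gap L U \<Longrightarrow> u \<le> v \<Longrightarrow> v \<le> w \<Longrightarrow> v \<in> gap L U"
  by (force simp: gap_def)

text \<open>For finite \<open>Z\<close> and \<open>L \<union> U = Z\<close>, the non-empty sets
  \<open>gap L U\<close> are the components of the complement of \<open>Z\<close>; sets of bounds
  instead of endpoints treat the unbounded components alike. Two points either have a point of
  \<open>Z\<close> weakly between them, whose image then separates their images, or lie in one gap,
  where a single monotone piece is used.\<close>

lemma strict_mono_glue:
  fixes Z Z' :: "real set" and h :: "real \<Rightarrow> real" and R :: "real \<Rightarrow> real \<Rightarrow> bool"
  assumes h: "strict_mono_on Z h" "h ` Z = Z'" and RZ: "\<And>z. z \<in> Z \<Longrightarrow> R z (h z)"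
    and gaps: "\<And>L U. L \<union> U = Z \<Longrightarrow> gap L U \<noteq> {} \<Longrightarrow>
      \<exists>g. strict_mono_on (gap L U) g \<and> (\<forall>w\<in>gap L U. g w \<in> gap (h ` L) (h ` U) \<and> R w (g w))"
  shows "\<exists>H. strict_mono H \<and> (\<forall>v. R v (H v))"
proof -
  define L where "L v = {z\<in>Z. z < v}" for v
  define U where "U v = {z\<in>Z. v < z}" for v
  have in_gap: "v \<in> gap (L v) (U v)" for v
    by (auto simp: gap_def L_def U_def)
  have LU: "L v \<union> U v = Z" if "v \<notin> Z" for v
    using that by (auto simp: L_def U_def) (metis linorder_neqE_linordered_idom)
  \<comment> \<open>The piece is chosen per pair \<open>(L, U)\<close> and not per point, so that
    all points of one gap share it.\<close>
  obtain G where G: "\<And>L U. L \<union> U = Z \<Longrightarrow> gap L U \<noteq> {} \<Longrightarrow>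
      strict_mono_on (gap L U) (G L U) \<and>
      (\<forall>w\<in>gap L U. G L U w \<in> gap (h ` L) (h ` U) \<and> R w (G L U w))"
    using gaps by metis
  define H where "H v = (if v \<in> Z then h v else G (L v) (U v) v)" for v
  have Hgap: "H v \<in> gap (h ` L v) (h ` U v)" "R v (H v)" if "v \<notin> Z" for v
    using G[OF LU[OF that]] in_gap[of v] that by (auto simp: H_def)
  have "H v < H w" if "v < w" for v w
  proof (cases "\<exists>z\<in>Z. v \<le> z \<and> z \<le> w")
    case True
    then obtain z where z: "z \<in> Z" "v \<le> z" "z \<le> w" by blast
    have "v \<noteq> z \<Longrightarrow> H v < H z"
      using Hgap(1)[of v] z h(1) by (auto simp: H_def strict_mono_on_def gap_def U_def)
    moreover have "z \<noteq> w \<Longrightarrow> H z < H w"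
      using Hgap(1)[of w] z h(1) by (auto simp: H_def strict_mono_on_def gap_def L_def)
    ultimately show ?thesis using that by force
  next
    case False
    then have nZ: "v \<notin> Z" "w \<notin> Z" using that by auto
    have eq: "L v = L w" "U v = U w" using False that by (auto simp: L_def U_def not_le)
    have "strict_mono_on (gap (L v) (U v)) (G (L v) (U v))"
      using G[OF LU[OF nZ(1)]] in_gap[of v] by blast
    then show ?thesis
      using in_gap[of v] in_gap[of w] that nZ eq by (auto simp: H_def strict_mono_on_def)
  qed
  moreover have "R v (H v)" for v
    using Hgap(2) RZ by (cases "v \<in> Z") (auto simp: H_def)
  ultimately show ?thesis by (auto simp: strict_mono_def)
qed

lemma strict_mono_into_interval:
  fixes u w :: real
  assumes "u < w"
  shows "\<exists>g::real \<Rightarrow> real. strict_mono g \<and> (\<forall>v. u < g v \<and> g v < w)"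
proof (intro exI conjI allI)
  define c where "c = (w - u) / pi"
  have c: "c > 0" using assms by (simp add: c_def)
  let ?g = "\<lambda>v. (u + w) / 2 + c * arctan v"
  show "strict_mono ?g" using c by (auto simp: strict_mono_def arctan_less_iff)
  fix v
  have cpi: "c * (pi / 2) = (w - u) / 2" by (simp add: c_def)
  have "c * (- (pi / 2)) < c * arctan v" "c * arctan v < c * (pi / 2)"
    by (intro mult_strict_left_mono arctan_lbound arctan_ubound c)+
  then show "u < ?g v" "?g v < w" using cpi by (simp_all add: field_simps)
qed

lemma poly_strict_increasing:
  fixes q :: "real poly"
  assumes "a < b" "\<And>x. a < x \<Longrightarrow> x < b \<Longrightarrow> poly (pderiv q) x > 0"
  shows "poly q a < poly q b"
  by (rule DERIV_pos_imp_increasing_open[OF assms(1)])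
     (use assms(2) in \<open>auto intro!: poly_DERIV continuous_intros\<close>)

lemma poly_unbounded:
  fixes q :: "real poly"
  assumes "degree q > 0"
  obtains K where "\<And>x. \<bar>x\<bar> \<ge> K \<Longrightarrow> \<bar>poly q x\<bar> > B"
proof -
  have "filterlim (poly q) at_infinity at_infinity"
    using assms by (intro filterlim_poly_at_infinity) auto
  then have "eventually (\<lambda>x. \<bar>B\<bar> + 1 \<le> norm (poly q x)) at_infinity"
    by (auto simp: filterlim_at_infinity[of 0])
  then obtain K where "\<And>x. norm x \<ge> K \<Longrightarrow> \<bar>B\<bar> + 1 \<le> norm (poly q x)"
    by (auto simp: eventually_at_infinity)
  then show ?thesis by (intro that[of K]) (force simp: real_norm_def)
qed

text \<open>Negativity is transported through the left end of the gap. If \<open>L\<close> is empty,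
  the image gap reaches down to minus infinity, and \<open>p'\<close>, increasing and unbounded
  there, becomes negative. Otherwise \<open>p\<close> is already negative at \<open>Max L\<close>,
  the sign carries over to \<open>p'\<close> at the image of that point, and continuity keeps
  \<open>p'\<close> negative a little to its right.\<close>

lemma gap_negative_value:
  fixes p p' :: "real poly"
  assumes fin: "finite L" and h: "strict_mono h"
    and v: "v \<in> gap L U" "poly p v < 0" and w: "w \<in> gap (h ` L) (h ` U)"
    and inc: "\<And>x. x \<in> gap L U \<Longrightarrow> poly (pderiv p) x > 0"
    and inc': "\<And>x. x \<in> gap (h ` L) (h ` U) \<Longrightarrow> poly (pderiv p') x > 0"
    and sgnL: "\<And>z. z \<in> L \<Longrightarrow> sgn (poly p z) = sgn (poly p' (h z))"
  shows "\<exists>u\<in>gap (h ` L) (h ` U). u \<le> w \<and> poly p' u < 0"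
proof (cases "L = {}")
  case True
  have lower: "u \<in> gap (h ` L) (h ` U)" if "u \<le> w" for u
    using w that True by (auto simp: gap_def)
  have "degree p' > 0"
    using inc'[OF w] by (metis pderiv_eq_0_iff gr0I poly_0 less_irrefl)
  then obtain K where K: "\<And>x. \<bar>x\<bar> \<ge> K \<Longrightarrow> \<bar>poly p' x\<bar> > \<bar>poly p' w\<bar>"
    by (rule poly_unbounded) blast
  define u where "u = min (w - 1) (- \<bar>K\<bar>)"
  have "poly p' u < poly p' w"
    by (rule poly_strict_increasing) (auto simp: u_def intro!: inc' lower)
  moreover have "\<bar>poly p' u\<bar> > \<bar>poly p' w\<bar>" by (rule K) (auto simp: u_def)
  ultimately show ?thesis
    by (intro bexI[of _ u]) (auto simp: u_def intro!: lower)
next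
  case False
  define a where "a = Max L"
  have a: "a \<in> L" "\<And>z. z \<in> L \<Longrightarrow> z \<le> a" using fin False by (auto simp: a_def)
  have above: "x \<in> gap L U" if "a < x" "x \<le> v" for x
    using that v(1) a by (force simp: gap_def)
  have above': "x \<in> gap (h ` L) (h ` U)" if "h a < x" "x \<le> w" for x
  proof -
    have "h z \<le> h a" if "z \<in> L" for z using strict_mono_less_eq[OF h] a(2)[OF that] by simp
    then show ?thesis using that w by (fastforce simp: gap_def)
  qed
  have "poly p a < poly p v"
    by (rule poly_strict_increasing) (use a v in \<open>auto simp: gap_def intro!: inc above\<close>)
  then have "poly p' (h a) < 0"
    using sgnL[OF a(1)] v(2) by (auto simp: sgn_if split: if_splits)
  have "h a < w" using w a(1) by (auto simp: gap_def)
  have "(poly p' \<longlongrightarrow> poly p' (h a)) (at_right (h a))"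
    by (intro tendsto_poly tendsto_ident_at)
  then have "eventually (\<lambda>x. poly p' x < 0) (at_right (h a))"
    using \<open>poly p' (h a) < 0\<close> by (rule order_tendstoD(2))
  moreover have "eventually (\<lambda>x. h a < x \<and> x < w) (at_right (h a))"
    using eventually_at_right_real[OF \<open>h a < w\<close>] by (auto elim: eventually_mono)
  ultimately have "eventually (\<lambda>x. poly p' x < 0 \<and> h a < x \<and> x < w) (at_right (h a))"
    by (rule eventually_conj)
  then obtain u where "poly p' u < 0 \<and> h a < u \<and> u < w"
    using eventually_happens'[OF trivial_limit_at_right_real] by blast
  then show ?thesis using above'[of u] by (intro bexI[of _ u]) auto
qed

text \<open>Mirror image at the right end: plus infinity, or \<open>Min U\<close> and the values a
  little to the left of its image.\<close>

lemma gap_positive_value: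
  fixes p p' :: "real poly"
  assumes fin: "finite U" and h: "strict_mono h"
    and v: "v \<in> gap L U" "poly p v > 0" and w: "w \<in> gap (h ` L) (h ` U)"
    and inc: "\<And>x. x \<in> gap L U \<Longrightarrow> poly (pderiv p) x > 0"
    and inc': "\<And>x. x \<in> gap (h ` L) (h ` U) \<Longrightarrow> poly (pderiv p') x > 0"
    and sgnU: "\<And>z. z \<in> U \<Longrightarrow> sgn (poly p z) = sgn (poly p' (h z))"
  shows "\<exists>u\<in>gap (h ` L) (h ` U). w \<le> u \<and> poly p' u > 0"
proof (cases "U = {}")
  case True
  have upper: "u \<in> gap (h ` L) (h ` U)" if "w \<le> u" for u
    using w that True by (auto simp: gap_def)
  have "degree p' > 0"
    using inc'[OF w] by (metis pderiv_eq_0_iff gr0I poly_0 less_irrefl)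
  then obtain K where K: "\<And>x. \<bar>x\<bar> \<ge> K \<Longrightarrow> \<bar>poly p' x\<bar> > \<bar>poly p' w\<bar>"
    by (rule poly_unbounded) blast
  define u where "u = max (w + 1) \<bar>K\<bar>"
  have "poly p' w < poly p' u"
    by (rule poly_strict_increasing) (auto simp: u_def intro!: inc' upper)
  moreover have "\<bar>poly p' u\<bar> > \<bar>poly p' w\<bar>" by (rule K) (auto simp: u_def)
  ultimately show ?thesis
    by (intro bexI[of _ u]) (auto simp: u_def intro!: upper)
next
  case False
  define a where "a = Min U"
  have a: "a \<in> U" "\<And>z. z \<in> U \<Longrightarrow> a \<le> z" using fin False by (auto simp: a_def)
  have below: "x \<in> gap L U" if "x < a" "v \<le> x" for x
    using that v(1) a by (force simp: gap_def)
  have below': "x \<in> gap (h ` L) (h ` U)" if "x < h a" "w \<le> x" for x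
  proof -
    have "h a \<le> h z" if "z \<in> U" for z using strict_mono_less_eq[OF h] a(2)[OF that] by simp
    then show ?thesis using that w by (fastforce simp: gap_def)
  qed
  have "poly p v < poly p a"
    by (rule poly_strict_increasing) (use a v in \<open>auto simp: gap_def intro!: inc below\<close>)
  then have "poly p' (h a) > 0"
    using sgnU[OF a(1)] v(2) by (auto simp: sgn_if split: if_splits)
  have "w < h a" using w a(1) by (auto simp: gap_def)
  have "(poly p' \<longlongrightarrow> poly p' (h a)) (at_left (h a))"
    by (intro tendsto_poly tendsto_ident_at)
  then have "eventually (\<lambda>x. poly p' x > 0) (at_left (h a))"
    using \<open>poly p' (h a) > 0\<close> by (rule order_tendstoD(1))
  moreover have "eventually (\<lambda>x. w < x \<and> x < h a) (at_left (h a))"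
    using eventually_at_left_real[OF \<open>w < h a\<close>] by (auto elim: eventually_mono)
  ultimately have "eventually (\<lambda>x. poly p' x > 0 \<and> w < x \<and> x < h a) (at_left (h a))"
    by (rule eventually_conj)
  then obtain u where "poly p' u > 0 \<and> w < u \<and> u < h a"
    using eventually_happens'[OF trivial_limit_at_left_real] by blast
  then show ?thesis using below'[of u] by (intro bexI[of _ u]) auto
qed

text \<open>An increasing \<open>p\<close> has at most one zero in the gap, so its signs are
  constant or run through minus, zero, plus. Since \<open>g\<close> does not have to be onto, any
  strictly monotone map that lands where \<open>p'\<close> has the required signs will do.\<close>

lemma gap_sign_transfer_increasing:
  fixes p p' :: "real poly"
  assumes fin: "finite L" "finite U" and h: "strict_mono h"
    and w: "w \<in> gap (h ` L) (h ` U)"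
    and inc: "\<And>x. x \<in> gap L U \<Longrightarrow> poly (pderiv p) x > 0"
    and inc': "\<And>x. x \<in> gap (h ` L) (h ` U) \<Longrightarrow> poly (pderiv p') x > 0"
    and sgn: "\<And>z. z \<in> L \<union> U \<Longrightarrow> sgn (poly p z) = sgn (poly p' (h z))"
  shows "\<exists>g. strict_mono_on (gap L U) g \<and>
    (\<forall>v\<in>gap L U. g v \<in> gap (h ` L) (h ` U) \<and> sgn (poly p v) = sgn (poly p' (g v)))"
proof -
  let ?G = "gap L U" and ?G' = "gap (h ` L) (h ` U)"
  have mono: "poly p x < poly p y" if "x < y" "x \<in> ?G" "y \<in> ?G" for x y
    by (rule poly_strict_increasing[OF that(1)], rule inc, rule gap_between[OF that(2,3)]) auto
  have mono': "poly p' x < poly p' y" if "x < y" "x \<in> ?G'" "y \<in> ?G'" for x y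
    by (rule poly_strict_increasing[OF that(1)], rule inc', rule gap_between[OF that(2,3)]) auto
  have open_gap: "open (gap A B)" if "finite A" "finite B" for A B
  proof -
    have "gap A B = (\<Inter>z\<in>A. {z<..}) \<inter> (\<Inter>z\<in>B. {..<z})" by (auto simp: gap_def)
    then show ?thesis using that by (auto intro!: open_Int open_INT)
  qed
  have neg: "\<exists>u\<in>?G'. poly p' u < 0" if "v \<in> ?G" "poly p v < 0" for v
    using gap_negative_value[OF fin(1) h that w inc inc' sgn] by blast
  have pos: "\<exists>u\<in>?G'. poly p' u > 0" if "v \<in> ?G" "poly p v > 0" for v
    using gap_positive_value[OF fin(2) h that w inc inc' sgn] by blast
  \<comment> \<open>A whole neighbourhood of \<open>u\<close> has sign \<open>s\<close>, and the
    entire line can be mapped monotonically into it.\<close>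
  have const_sign: ?thesis if s: "\<And>v. v \<in> ?G \<Longrightarrow> sgn (poly p v) = s"
    and u: "u \<in> ?G'" "sgn (poly p' u) = s" "s \<noteq> 0" for s u
  proof -
    have "open {x. sgn (poly p' x) = s}"
    proof -
      consider "s = 1" | "s = -1" using u by (auto simp: sgn_if split: if_splits)
      then show ?thesis
      proof cases
        case 1
        have "open {x. poly p' x > 0}" by (intro open_Collect_less continuous_intros)
        then show ?thesis using 1 by (simp add: sgn_1_pos)
      next
        case 2
        have "open {x. poly p' x < 0}" by (intro open_Collect_less continuous_intros)
        then show ?thesis using 2 by (simp add: sgn_1_neg)
      qed
    qed
    then have "open (?G' \<inter> {x. sgn (poly p' x) = s})"
      using open_gap[of "h ` L" "h ` U"] fin by auto
    then obtain e where e: "e > 0" "ball u e \<subseteq> ?G' \<inter> {x. sgn (poly p' x) = s}"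
      using u open_contains_ball by blast
    have ue: "u - e < u + e" using e(1) by simp
    obtain g :: "real \<Rightarrow> real" where g: "strict_mono g" "\<forall>v. u - e < g v \<and> g v < u + e"
      using strict_mono_into_interval[OF ue] by blast
    have "g v \<in> ball u e" for v
      using g(2) by (auto simp: ball_eq_greaterThanLessThan)
    then have "g v \<in> ?G' \<and> sgn (poly p' (g v)) = s" for v using e(2) by blast
    moreover have "strict_mono_on ?G g" using g(1) by (rule monotone_on_subset) simp
    ultimately show ?thesis by (intro exI[of _ g]) (simp add: s)
  qed
  consider v where "v \<in> ?G" "poly p v < 0" "\<forall>x\<in>?G. poly p x < 0"
    | v where "v \<in> ?G" "poly p v > 0" "\<forall>x\<in>?G. poly p x > 0"
    | c where "c \<in> ?G" "poly p c = 0" | "?G = {}"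
  proof (cases "\<exists>c\<in>?G. poly p c = 0")
    case False
    have "False" if xy: "x \<in> ?G" "y \<in> ?G" "poly p x < 0" "poly p y > 0" for x y
    proof (rule linorder_cases[of x y])
      assume "x < y"
      then obtain c where "x < c" "c < y" "poly p c = 0" using poly_IVT_pos[of x y p] xy(3,4) by blast
      then show ?thesis using False gap_between[OF xy(1,2), of c] by auto
    next
      assume "x = y" then show ?thesis using xy by simp
    next
      assume "y < x"
      then obtain c where "y < c" "c < x" "poly p c = 0" using poly_IVT_neg[of y x p] xy(3,4) by blast
      then show ?thesis using False gap_between[OF xy(2,1), of c] by auto
    qed
    then have "(\<forall>x\<in>?G. poly p x < 0) \<or> (\<forall>x\<in>?G. poly p x > 0)"
      using False by (meson linorder_neqE_linordered_idom)
    then show ?thesis using that by blast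
  qed (use that in blast)
  then show ?thesis
  proof cases
    case 1
    then show ?thesis using neg[of v] const_sign[of "-1"] by (auto simp: sgn_1_neg)
  next
    case 2
    then show ?thesis using pos[of v] const_sign[of 1] by (auto simp: sgn_1_pos)
  next
    case 3
    obtain a b where ab: "a < c" "c < b" "a \<in> ?G" "b \<in> ?G"
    proof -
      obtain e where "e > 0" "ball c e \<subseteq> ?G"
        using open_gap[OF fin] 3 open_contains_ball by blast
      then show ?thesis
        by (intro that[of "c - e/2" "c + e/2"]) (auto simp: ball_eq_greaterThanLessThan subset_eq)
    qed
    \<comment> \<open>\<open>p\<close> is negative left of its zero and positive right of it, so
      \<open>p'\<close> takes both signs on the image gap and has a zero \<open>c'\<close>
      there.\<close>
    obtain a' b' where ab': "a' \<in> ?G'" "b' \<in> ?G'" "poly p' a' < 0" "poly p' b' > 0"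
      using neg[of a] pos[of b] mono[of a c] mono[of c b] ab 3 by auto
    have "a' < b'"
      using mono'[of b' a'] ab' by (cases a' b' rule: linorder_cases) auto
    then obtain c' where c': "a' < c'" "c' < b'" "poly p' c' = 0"
      using poly_IVT_pos ab' by blast
    have c'G: "c' \<in> ?G'" using c' ab' by (meson gap_between less_imp_le)
    obtain g1 :: "real \<Rightarrow> real" where "strict_mono g1 \<and> (\<forall>v. a' < g1 v \<and> g1 v < c')"
      using strict_mono_into_interval[OF c'(1)] by blast
    then have g1: "strict_mono g1" "\<And>v. a' < g1 v" "\<And>v. g1 v < c'" by auto
    obtain g2 :: "real \<Rightarrow> real" where "strict_mono g2 \<and> (\<forall>v. c' < g2 v \<and> g2 v < b')"
      using strict_mono_into_interval[OF c'(2)] by blast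
    then have g2: "strict_mono g2" "\<And>v. c' < g2 v" "\<And>v. g2 v < b'" by auto
    define g where "g v = (if v < c then g1 v else if v = c then c' else g2 v)" for v
    have gG: "g v \<in> ?G'" for v
      by (rule gap_between[OF ab'(1,2)])
         (use g1(2,3)[of v] g2(2,3)[of v] c' in \<open>auto simp: g_def\<close>)
    have smono: "strict_mono g"
      unfolding strict_mono_def
    proof (intro allI impI)
      fix x y :: real assume "x < y"
      then show "g x < g y"
        using g1 g2 less_trans[OF g1(3) g2(2), of x y] by (auto simp: g_def strict_mono_def)
    qed
    have "sgn (poly p v) = sgn (poly p' (g v))" if v: "v \<in> ?G" for v
    proof (rule linorder_cases[of v c])
      assume "v < c"
      then have "poly p v < 0" "poly p' (g v) < 0"
        using mono[of v c] 3 v mono'[of "g v" c'] gG[of v] c'G c'(3) g1(3)[of v] by (auto simp: g_def)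
      then show ?thesis by simp
    next
      assume "v = c" then show ?thesis using 3 c' by (simp add: g_def)
    next
      assume "c < v"
      then have "poly p v > 0" "poly p' (g v) > 0"
        using mono[of c v] 3 v mono'[of c' "g v"] gG[of v] c'G c'(3) g2(2)[of v] by (auto simp: g_def)
      then show ?thesis by simp
    qed
    moreover have "strict_mono_on ?G g" using smono by (rule monotone_on_subset) simp
    ultimately show ?thesis using gG by blast
  qed (auto simp: strict_mono_on_def)
qed

lemma poly_sgn_constant_on_gap:
  fixes q :: "real poly"
  assumes "\<And>z. z \<in> gap L U \<Longrightarrow> poly q z \<noteq> 0" "v \<in> gap L U" "w \<in> gap L U"
  shows "sgn (poly q v) = sgn (poly q w)"
proof -
  have "sgn (poly q x) = sgn (poly q y)" if xy: "x < y" "x \<in> gap L U" "y \<in> gap L U" for x y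
  proof (rule ccontr)
    assume "sgn (poly q x) \<noteq> sgn (poly q y)"
    then have "poly q x * poly q y < 0"
      using assms(1)[OF xy(2)] assms(1)[OF xy(3)]
      by (auto simp: sgn_if mult_less_0_iff split: if_splits)
    then obtain c where "x < c" "c < y" "poly q c = 0" using poly_IVT[OF xy(1)] by blast
    then show False using assms(1) gap_between[OF xy(2,3), of c] by auto
  qed
  then show ?thesis using assms(2,3) by (metis linorder_neqE_linordered_idom)
qed

text \<open>Neither derivative has a root in its gap, so each has constant sign there, and
  \<open>h\<close> carries a point of one gap into the other, so the two signs agree. The decreasing
  case becomes the increasing one by negating both polynomials.\<close>

lemma gap_sign_transfer:
  fixes p p' :: "real poly"
  assumes fin: "finite L" "finite U" and h: "strict_mono h"
    and hgap: "\<And>v. v \<in> gap L U \<Longrightarrow> h v \<in> gap (h ` L) (h ` U)"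
    and sgnd: "\<And>v. sgn (poly (pderiv p) v) = sgn (poly (pderiv p') (h v))"
    and nz: "\<And>v. v \<in> gap L U \<Longrightarrow> poly (pderiv p) v \<noteq> 0"
      "\<And>v. v \<in> gap (h ` L) (h ` U) \<Longrightarrow> poly (pderiv p') v \<noteq> 0"
    and sgn: "\<And>z. z \<in> L \<union> U \<Longrightarrow> sgn (poly p z) = sgn (poly p' (h z))"
  shows "\<exists>g. strict_mono_on (gap L U) g \<and>
    (\<forall>v\<in>gap L U. g v \<in> gap (h ` L) (h ` U) \<and> sgn (poly p v) = sgn (poly p' (g v)))"
proof (cases "gap L U = {}")
  case True
  then show ?thesis by (auto simp: strict_mono_on_def)
next
  case False
  then obtain v where v: "v \<in> gap L U" by blast
  have s: "sgn (poly (pderiv p) x) = sgn (poly (pderiv p) v)" if "x \<in> gap L U" for x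
    using poly_sgn_constant_on_gap[OF nz(1)] that v by blast
  have s': "sgn (poly (pderiv p') x) = sgn (poly (pderiv p) v)"
    if "x \<in> gap (h ` L) (h ` U)" for x
    using poly_sgn_constant_on_gap[OF nz(2) that hgap[OF v]] sgnd[of v] by simp
  show ?thesis
  proof (cases "poly (pderiv p) v > 0")
    case True
    show ?thesis
      by (rule gap_sign_transfer_increasing[OF fin h hgap[OF v] _ _ sgn])
         (use s s' True in \<open>auto simp: sgn_1_pos\<close>)
  next
    case False
    then have "poly (pderiv p) v < 0" using nz(1)[OF v] by simp
    then have "\<exists>g. strict_mono_on (gap L U) g \<and>
      (\<forall>v\<in>gap L U. g v \<in> gap (h ` L) (h ` U) \<and> sgn (poly (- p) v) = sgn (poly (- p') (g v)))"
      by (intro gap_sign_transfer_increasing[OF fin h hgap[OF v]])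
         (use s s' sgn in \<open>auto simp: sgn_1_neg pderiv_minus sgn_minus\<close>)
    then show ?thesis by (simp add: sgn_minus)
  qed
qed

text \<open>The inductive step of the argument of Cohen and Hoermander.\<close>
lemma sign_pattern_step:
  fixes b b' :: "'i \<Rightarrow> real poly" and p p' :: "real poly"
  assumes fin: "finite I"
    and h: "strict_mono h" "\<And>i v. i \<in> I \<Longrightarrow> sgn (poly (b i) v) = sgn (poly (b' i) (h v))"
    and k: "strict_mono k" "\<And>i v. i \<in> I \<Longrightarrow> sgn (poly (b' i) v) = sgn (poly (b i) (k v))"
    and d: "d \<in> I" "b d = pderiv p" "b' d = pderiv p'"
    and roots: "\<And>i v. i \<in> I \<Longrightarrow> b i \<noteq> 0 \<Longrightarrow> poly (b i) v = 0 \<Longrightarrow>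
      sgn (poly p v) = sgn (poly p' (h v))"
    and const: "\<And>v w. pderiv p = 0 \<Longrightarrow> sgn (poly p v) = sgn (poly p' w)"
  shows "\<exists>H. strict_mono H \<and> (\<forall>v. sgn (poly p v) = sgn (poly p' (H v)) \<and>
    (\<forall>i\<in>I. sgn (poly (b i) v) = sgn (poly (b' i) (H v))))"
proof (cases "pderiv p = 0")
  case True
  then show ?thesis using h const by blast
next
  case nonconst: False
  define Z where "Z = {v. \<exists>i\<in>I. b i \<noteq> 0 \<and> poly (b i) v = 0}"
  define Z' where "Z' = {v. \<exists>i\<in>I. b' i \<noteq> 0 \<and> poly (b' i) v = 0}"
  have finZ: "finite Z" "finite Z'"
  proof -
    have "Z = (\<Union>i\<in>{i\<in>I. b i \<noteq> 0}. {v. poly (b i) v = 0})"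
      "Z' = (\<Union>i\<in>{i\<in>I. b' i \<noteq> 0}. {v. poly (b' i) v = 0})" by (auto simp: Z_def Z'_def)
    then show "finite Z" "finite Z'" using fin by (auto intro!: finite_UN_I poly_roots_finite)
  qed
  have zero_iff: "b i = 0 \<longleftrightarrow> b' i = 0" if "i \<in> I" for i
    using h(2)[OF that] k(2)[OF that] by (metis poly_0 poly_all_0_iff_0 sgn_zero_iff)
  have hZ: "h v \<in> Z'" if v: "v \<in> Z" for v
  proof -
    obtain i where i: "i \<in> I" "b i \<noteq> 0" "poly (b i) v = 0" using v by (auto simp: Z_def)
    then have "poly (b' i) (h v) = 0" using h(2)[of i v] by (simp add: sgn_zero_iff)
    then show ?thesis using i zero_iff by (auto simp: Z'_def)
  qed
  have kZ: "k v \<in> Z" if v: "v \<in> Z'" for v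
  proof -
    obtain i where i: "i \<in> I" "b' i \<noteq> 0" "poly (b' i) v = 0" using v by (auto simp: Z'_def)
    then have "poly (b i) (k v) = 0" using k(2)[of i v] by (simp add: sgn_zero_iff)
    then show ?thesis using i zero_iff by (auto simp: Z_def)
  qed
  \<comment> \<open>Here the map \<open>k\<close> in the opposite direction serves to count: the two
    finite root sets inject into each other, so \<open>h\<close> maps \<open>Z\<close> onto
    \<open>Z'\<close> and no further root of some \<open>b' i\<close> can split an image
    gap.\<close>
  have inj: "inj h" "inj k" using h(1) k(1) strict_mono_imp_inj_on by blast+
  have "card Z' \<le> card Z"
    by (rule card_inj_on_le[of k]) (use kZ finZ inj in \<open>auto intro: inj_on_subset\<close>)
  moreover have "card (h ` Z) = card Z"
    using inj by (auto intro!: card_image inj_on_subset[of _ UNIV])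
  ultimately have hZZ: "h ` Z = Z'"
    using hZ finZ by (intro card_seteq) auto
  show ?thesis
  proof (rule strict_mono_glue[of Z h Z'])
    show "strict_mono_on Z h" using h(1) by (rule monotone_on_subset) simp
    show "h ` Z = Z'" by (rule hZZ)
    show "sgn (poly p z) = sgn (poly p' (h z)) \<and>
      (\<forall>i\<in>I. sgn (poly (b i) z) = sgn (poly (b' i) (h z)))" if "z \<in> Z" for z
      using that roots h(2) unfolding Z_def by blast
    fix L U assume LU: "L \<union> U = Z" and ne: "gap L U \<noteq> {}"
    have fLU: "finite L" "finite U" using finZ LU by (metis finite_Un)+
    have nZ: "v \<notin> Z" if "v \<in> gap L U" for v
      using that LU by (auto simp: gap_def)
    have nZ': "v \<notin> Z'" if "v \<in> gap (h ` L) (h ` U)" for v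
      using that LU hZZ by (auto simp: gap_def)
    have hgap: "h v \<in> gap (h ` L) (h ` U)" if "v \<in> gap L U" for v
      using that h(1) by (auto simp: gap_def strict_mono_def)
    have "\<exists>g. strict_mono_on (gap L U) g \<and>
      (\<forall>v\<in>gap L U. g v \<in> gap (h ` L) (h ` U) \<and> sgn (poly p v) = sgn (poly p' (g v)))"
    proof (rule gap_sign_transfer[OF fLU h(1) hgap])
      show "sgn (poly (pderiv p) v) = sgn (poly (pderiv p') (h v))" for v
        using h(2)[OF d(1)] d(2,3) by simp
      show "poly (pderiv p) v \<noteq> 0" if "v \<in> gap L U" for v
        using nZ[OF that] d nonconst by (auto simp: Z_def)
      show "poly (pderiv p') v \<noteq> 0" if "v \<in> gap (h ` L) (h ` U)" for v
        using nZ'[OF that] d nonconst zero_iff[OF d(1)] by (auto simp: Z'_def)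
      show "sgn (poly p z) = sgn (poly p' (h z))" if "z \<in> L \<union> U" for z
        using that LU roots unfolding Z_def by blast
    qed
    then obtain g where g: "strict_mono_on (gap L U) g"
      "\<And>v. v \<in> gap L U \<Longrightarrow> g v \<in> gap (h ` L) (h ` U) \<and> sgn (poly p v) = sgn (poly p' (g v))"
      by blast
    \<comment> \<open>Inside a gap the nonzero members of the family have no roots, so their signs
      do not notice that \<open>h w\<close> is replaced by \<open>g w\<close>.\<close>
    have "sgn (poly (b i) w) = sgn (poly (b' i) (g w))" if i: "i \<in> I" and w: "w \<in> gap L U" for i w
    proof (cases "b i = 0")
      case True
      then show ?thesis using zero_iff[OF i] by simp
    next
      case False
      have "sgn (poly (b i) w) = sgn (poly (b' i) (h w))" by (rule h(2)[OF i])
      also have "\<dots> = sgn (poly (b' i) (g w))"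
        by (rule poly_sgn_constant_on_gap[of "h ` L" "h ` U"])
           (use nZ' i False zero_iff[OF i] hgap[OF w] g(2)[OF w] in \<open>auto simp: Z'_def\<close>)
      finally show ?thesis .
    qed
    then show "\<exists>g. strict_mono_on (gap L U) g \<and> (\<forall>w\<in>gap L U. g w \<in> gap (h ` L) (h ` U) \<and>
        sgn (poly p w) = sgn (poly p' (g w)) \<and>
        (\<forall>i\<in>I. sgn (poly (b i) w) = sgn (poly (b' i) (g w))))"
      using g by blast
  qed
qed

section \<open>Parametrised polynomials and pseudo-remainders\<close>

definition param_poly :: "nat \<Rightarrow> ('e::euclidean_space \<Rightarrow> real poly) \<Rightarrow> bool"
  where "param_poly n P \<longleftrightarrow> (\<forall>x. degree (P x) \<le> n) \<and>
    (\<forall>i. real_polynomial_function (\<lambda>x. coeff (P x) i))"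

lemma param_poly_mono: "param_poly n P \<Longrightarrow> n \<le> m \<Longrightarrow> param_poly m P"
  by (auto simp: param_poly_def intro: order_trans)

lemma param_poly_pderiv:
  assumes "param_poly (Suc n) P"
  shows "param_poly n (\<lambda>x. pderiv (P x))"
  unfolding param_poly_def
proof (intro conjI allI)
  fix x
  have "degree (P x) \<le> Suc n" using assms by (simp add: param_poly_def)
  then show "degree (pderiv (P x)) \<le> n" by (simp add: degree_pderiv)
next
  fix i
  show "real_polynomial_function (\<lambda>x. coeff (pderiv (P x)) i)"
    unfolding coeff_pderiv using assms
    by (intro real_polynomial_function.intros(4) real_polynomial_function.intros(2))
       (simp add: param_poly_def)
qed

text \<open>The \<open>n\<close> of \<open>param_poly\<close> is a formal degree: leading
  coefficients may vanish at some parameters. Where the true degree is \<open>j\<close>, the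
  truncation to degree \<open>j\<close> is the polynomial itself, so the truncations supply every
  possible leading term.\<close>

lemma param_poly_cutoff:
  assumes "param_poly n P"
  shows "param_poly j (\<lambda>x. poly_cutoff (Suc j) (P x))"
  unfolding param_poly_def
proof (intro conjI allI)
  show "degree (poly_cutoff (Suc j) (P x)) \<le> j" for x
    by (auto intro!: degree_le simp: coeff_poly_cutoff)
  show "real_polynomial_function (\<lambda>x. coeff (poly_cutoff (Suc j) (P x)) i)" for i
    using assms by (cases "i < Suc j") (auto simp: param_poly_def coeff_poly_cutoff)
qed

text \<open>Division would leave the ring of polynomials in the parameter, so \<open>P\<close> is
  multiplied by powers of the top coefficient of \<open>Q\<close> instead. An even power preserves
  the sign of \<open>P\<close> wherever that coefficient is nonzero, and at a root of
  \<open>Q\<close> the subtracted multiples of \<open>Q\<close> vanish.\<close>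

lemma pseudo_remainder_at_roots:
  assumes Q: "param_poly m Q" and m: "1 \<le> m" and P: "param_poly n P"
  shows "\<exists>R k. param_poly (m - 1) R \<and> (\<forall>x v. poly (Q x) v = 0 \<longrightarrow>
    coeff (Q x) m ^ (2 * k) * poly (P x) v = poly (R x) v)"
  using P
proof (induction n arbitrary: P)
  case 0
  then show ?case using m
    by (intro exI[of _ P] exI[of _ 0]) (auto intro: param_poly_mono)
next
  case (Suc n)
  show ?case
  proof (cases "Suc n < m")
    case True
    then show ?thesis using Suc.prems
      by (intro exI[of _ P] exI[of _ 0]) (auto intro: param_poly_mono)
  next
    case False
    \<comment> \<open>The terms of degree \<open>Suc n\<close> cancel. The multiplier is the square
      of the top coefficient, to keep its sign under control, and the second factor reappears in the
      monomial.\<close>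
    define P1 where "P1 x = smult (coeff (Q x) m ^ 2) (P x)
      - monom (coeff (P x) (Suc n) * coeff (Q x) m) (Suc n - m) * Q x" for x
    have coeffP1: "coeff (P1 x) i = coeff (Q x) m ^ 2 * coeff (P x) i
      - (if i < Suc n - m then 0 else coeff (P x) (Suc n) * coeff (Q x) m * coeff (Q x) (i - (Suc n - m)))" for x i
      by (simp add: P1_def coeff_monom_mult)
    have "param_poly n P1"
      unfolding param_poly_def
    proof (intro conjI allI)
      fix x
      have degs: "degree (P x) \<le> Suc n" "degree (Q x) \<le> m"
        using Suc.prems Q by (auto simp: param_poly_def)
      show "degree (P1 x) \<le> n"
      proof (rule degree_le, intro allI impI)
        fix i assume "n < i"
        show "coeff (P1 x) i = 0"
        proof (cases "i = Suc n")
          case True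
          then show ?thesis using False by (simp add: coeffP1 power2_eq_square)
        next
          case neq: False
          then have "coeff (P x) i = 0" "coeff (Q x) (i - (Suc n - m)) = 0"
            using \<open>n < i\<close> degs False by (auto intro!: coeff_eq_0)
          then show ?thesis by (simp add: coeffP1)
        qed
      qed
    next
      fix i
      show "real_polynomial_function (\<lambda>x. coeff (P1 x) i)"
        unfolding coeffP1 using Suc.prems Q
        by (cases "i < Suc n - m")
           (simp_all add: param_poly_def real_polynomial_function_diff
              real_polynomial_function_power real_polynomial_function.intros(4))
    qed
    then obtain R k where R: "param_poly (m - 1) R"
      "\<And>x v. poly (Q x) v = 0 \<Longrightarrow> coeff (Q x) m ^ (2 * k) * poly (P1 x) v = poly (R x) v"
      using Suc.IH by blast
    have "coeff (Q x) m ^ (2 * Suc k) * poly (P x) v = poly (R x) v" if "poly (Q x) v = 0" for x v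
      using R(2)[OF that] that by (simp add: P1_def power2_eq_square mult_ac)
    then show ?thesis using R(1) by blast
  qed
qed

section \<open>Quantifier elimination\<close>

definition same_signs :: "('e \<Rightarrow> real) set \<Rightarrow> 'e \<Rightarrow> 'e \<Rightarrow> bool"
  where "same_signs F x y \<longleftrightarrow> (\<forall>f\<in>F. sgn (f x) = sgn (f y))"

lemma same_signs_sym: "same_signs F x y \<Longrightarrow> same_signs F y x"
  by (auto simp: same_signs_def)

lemma same_signs_Un: "same_signs (F \<union> G) x y \<longleftrightarrow> same_signs F x y \<and> same_signs G x y"
  by (auto simp: same_signs_def)

text \<open>A monotone map and not a bijection: one map from \<open>x\<close> to \<open>y\<close>
  and one from \<open>y\<close> to \<open>x\<close> together force the roots to match.\<close>

definition sign_pattern_map ::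
    "('e \<Rightarrow> real poly) set \<Rightarrow> 'e \<Rightarrow> 'e \<Rightarrow> (real \<Rightarrow> real) \<Rightarrow> bool"
  where "sign_pattern_map Q x y h \<longleftrightarrow>
    strict_mono h \<and> (\<forall>q\<in>Q. \<forall>v. sgn (poly (q x) v) = sgn (poly (q y) (h v)))"

text \<open>Adding \<open>p\<close> of degree \<open>Suc n\<close> costs its derivative and its
  pseudo-remainders, which all have degree at most \<open>n\<close>. They go into \<open>U\<close>,
  which may grow freely, while \<open>V\<close> does not have to contain \<open>p\<close>; this is
  why \<open>IH\<close> is quantified over all \<open>U\<close>.\<close>

lemma sign_pattern_map_step:
  fixes V U :: "('e::euclidean_space \<Rightarrow> real poly) set"
  assumes p: "param_poly (Suc n) p"
    and V: "finite V" "\<And>q. q \<in> V \<Longrightarrow> param_poly (Suc n) q"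
    and U: "finite U" "\<And>q. q \<in> U \<Longrightarrow> param_poly n q"
    and IH: "\<And>U. finite U \<Longrightarrow> (\<And>q. q \<in> U \<Longrightarrow> param_poly n q) \<Longrightarrow>
      \<exists>F. finite F \<and> (\<forall>f\<in>F. real_polynomial_function f) \<and>
        (\<forall>x y. same_signs F x y \<longrightarrow> (\<exists>h. sign_pattern_map (U \<union> V) x y h))"
  shows "\<exists>F. finite F \<and> (\<forall>f\<in>F. real_polynomial_function f) \<and>
    (\<forall>x y. same_signs F x y \<longrightarrow> (\<exists>h. sign_pattern_map (U \<union> insert p V) x y h))"
proof -
  define p' where "p' = (\<lambda>x. pderiv (p x))"
  have p': "param_poly n p'" using param_poly_pderiv[OF p] by (simp add: p'_def)
  define B where "B = insert p' (U \<union> V)"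
  have B: "finite B" "\<And>q. q \<in> B \<Longrightarrow> param_poly (Suc n) q"
    using U V p' by (auto simp: B_def intro: param_poly_mono[of n _ "Suc n"])
  define J where "J = {1..Suc n}"
  \<comment> \<open>One pseudo-remainder for each possible true degree \<open>j\<close> of
    \<open>q\<close> at a parameter. \<open>J\<close> starts at 1 because a nonzero constant has no
    roots.\<close>
  have "\<exists>R k. param_poly n R \<and> (\<forall>x v. poly (poly_cutoff (Suc j) (q x)) v = 0 \<longrightarrow>
      coeff (q x) j ^ (2 * k) * poly (p x) v = poly (R x) v)" if q: "q \<in> B" and j: "j \<in> J" for q j
  proof -
    have "param_poly j (\<lambda>x. poly_cutoff (Suc j) (q x))" "1 \<le> j"
      using B(2)[OF q] j by (auto intro: param_poly_cutoff simp: J_def)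
    from pseudo_remainder_at_roots[OF this p] obtain R k where
      Rk: "param_poly (j - 1) R" "\<forall>x v. poly (poly_cutoff (Suc j) (q x)) v = 0 \<longrightarrow>
        coeff (poly_cutoff (Suc j) (q x)) j ^ (2 * k) * poly (p x) v = poly (R x) v"
      by blast
    have "param_poly n R" using Rk(1) j by (auto simp: J_def intro: param_poly_mono[of "j - 1"])
    then show ?thesis using Rk(2) by (auto simp: coeff_poly_cutoff)
  qed
  then obtain R k where Rk: "\<And>q j. q \<in> B \<Longrightarrow> j \<in> J \<Longrightarrow> param_poly n (R q j) \<and>
      (\<forall>x v. poly (poly_cutoff (Suc j) (q x)) v = 0 \<longrightarrow>
        coeff (q x) j ^ (2 * k q j) * poly (p x) v = poly (R q j x) v)"
    by metis
  define U' where "U' = insert p' U \<union> (\<lambda>(q, j). R q j) ` (B \<times> J)"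
  have U': "finite U'" "\<And>q. q \<in> U' \<Longrightarrow> param_poly n q"
    using U p' B(1) Rk by (auto simp: U'_def J_def)
  obtain F where F: "finite F" "\<forall>f\<in>F. real_polynomial_function f"
    "\<And>x y. same_signs F x y \<Longrightarrow> \<exists>h. sign_pattern_map (U' \<union> V) x y h"
    using IH[OF U'] by blast
  \<comment> \<open>The signs of all coefficients determine the true degrees, which therefore agree
    at \<open>x\<close> and \<open>y\<close>.\<close>
  define C where "C = (\<lambda>(q, j). \<lambda>x. coeff (q x) j) ` (insert p B \<times> {..Suc n})"
  have C: "finite C" "\<forall>f\<in>C. real_polynomial_function f"
    using B p by (auto simp: C_def param_poly_def)
  have "\<exists>H. sign_pattern_map (U \<union> insert p V) x y H" if xy: "same_signs (F \<union> C) x y" for x y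
  proof -
    obtain h where h: "sign_pattern_map (U' \<union> V) x y h"
      using F(3) xy by (auto simp: same_signs_Un)
    obtain k' where k': "sign_pattern_map (U' \<union> V) y x k'"
      using F(3) same_signs_sym[OF xy] by (auto simp: same_signs_Un)
    have coeffs: "sgn (coeff (q x) j) = sgn (coeff (q y) j)" if "q \<in> insert p B" for q j
    proof (cases "j \<le> Suc n")
      case True
      then have "(\<lambda>x. coeff (q x) j) \<in> F \<union> C"
        using that unfolding C_def by (intro UnI2 image_eqI[of _ _ "(q, j)"]) auto
      from xy[unfolded same_signs_def, rule_format, OF this] show ?thesis .
    next
      case False
      have "param_poly (Suc n) q" using that B(2) p by blast
      then have "degree (q z) < j" for z
        using False by (metis param_poly_def le_less_trans not_le)
      then show ?thesis by (simp add: coeff_eq_0)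
    qed
    have BU: "B \<subseteq> U' \<union> V" by (auto simp: B_def U'_def)
    have hB: "strict_mono h" "\<And>q v. q \<in> B \<Longrightarrow> sgn (poly (q x) v) = sgn (poly (q y) (h v))"
      using h BU unfolding sign_pattern_map_def by blast+
    have kB: "strict_mono k'" "\<And>q v. q \<in> B \<Longrightarrow> sgn (poly (q y) v) = sgn (poly (q x) (k' v))"
      using k' BU unfolding sign_pattern_map_def by blast+
    have "\<exists>H. strict_mono H \<and> (\<forall>v. sgn (poly (p x) v) = sgn (poly (p y) (H v)) \<and>
      (\<forall>q\<in>B. sgn (poly (q x) v) = sgn (poly (q y) (H v))))"
    proof (rule sign_pattern_step[of B h "\<lambda>q. q x" "\<lambda>q. q y" k' p', OF B(1) hB kB])
      show "p' \<in> B" "p' x = pderiv (p x)" "p' y = pderiv (p y)"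
        by (simp_all add: B_def p'_def)
    next
      fix q v assume q: "q \<in> B" and nz: "q x \<noteq> 0" and root: "poly (q x) v = 0"
      define j where "j = degree (q x)"
      have "j \<noteq> 0"
      proof
        assume "j = 0"
        then obtain c where "q x = [:c:]" unfolding j_def by (metis degree_eq_zeroE)
        then show False using nz root by simp
      qed
      then have j: "j \<in> J" using B(2)[OF q] by (auto simp: param_poly_def J_def j_def)
      have cx: "coeff (q x) j \<noteq> 0" using nz by (simp add: j_def)
      have cy: "coeff (q y) j \<noteq> 0" using cx coeffs[of q j] q by (metis insertCI sgn_zero_iff)
      have "coeff (q y) i = 0" if "j < i" for i
        using coeffs[of q i] q that by (simp add: j_def coeff_eq_0) (metis sgn_0_0)
      then have cutoff: "poly_cutoff (Suc j) (q x) = q x" "poly_cutoff (Suc j) (q y) = q y"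
        by (auto simp: poly_eq_iff coeff_poly_cutoff j_def coeff_eq_0)
      have Rmem: "R q j \<in> U' \<union> V" using q j by (auto simp: U'_def)
      have "sgn (poly (q x) v) = sgn (poly (q y) (h v))"
        by (rule hB(2)[OF q])
      then have root': "poly (q y) (h v) = 0" using root by (simp add: sgn_zero_iff)
      have pos: "sgn (c ^ (2 * m) * a) = sgn a" if "c \<noteq> 0" for c a :: real and m
      proof -
        have "0 < c ^ (2 * m)" using that by (simp add: power_mult)
        then show ?thesis by (simp only: sgn_mult sgn_pos mult_1)
      qed
      have eqs: "coeff (q x) j ^ (2 * k q j) * poly (p x) v = poly (R q j x) v"
        "coeff (q y) j ^ (2 * k q j) * poly (p y) (h v) = poly (R q j y) (h v)"
        using Rk[OF q j] root root' cutoff by simp_all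
      have "sgn (poly (p x) v) = sgn (poly (R q j x) v)"
        using pos[OF cx] unfolding eqs(1)[symmetric] by simp
      also have "\<dots> = sgn (poly (R q j y) (h v))"
        using h Rmem by (auto simp: sign_pattern_map_def)
      also have "\<dots> = sgn (poly (p y) (h v))"
        using pos[OF cy] unfolding eqs(2)[symmetric] by simp
      finally show "sgn (poly (p x) v) = sgn (poly (p y) (h v))" .
    next
      \<comment> \<open>The higher coefficients of the constant \<open>p x\<close> vanish, hence by
        their signs those of \<open>p y\<close> do as well.\<close>
      fix v w assume "pderiv (p x) = 0"
      then obtain c where c: "p x = [:c:]" by (metis pderiv_eq_0_iff degree_eq_zeroE)
      have "coeff (p y) i = 0" if "0 < i" for i
        using coeffs[of p i] that by (simp add: c coeff_pCons split: nat.splits) (metis sgn_0_0)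
      then have "p y = [:coeff (p y) 0:]"
        by (auto simp: poly_eq_iff coeff_pCons split: nat.splits)
      then have "poly (p y) w = poly [:coeff (p y) 0:] w" by (rule arg_cong)
      then show "sgn (poly (p x) v) = sgn (poly (p y) w)"
        using coeffs[of p 0] by (simp add: c del: poly_pCons) simp
    qed
    then obtain H where "strict_mono H" "\<And>v. sgn (poly (p x) v) = sgn (poly (p y) (H v))"
      "\<And>q v. q \<in> B \<Longrightarrow> sgn (poly (q x) v) = sgn (poly (q y) (H v))" by blast
    then have "sign_pattern_map (U \<union> insert p V) x y H"
      unfolding sign_pattern_map_def B_def by blast
    then show ?thesis by blast
  qed
  then show ?thesis using F C by (intro exI[of _ "F \<union> C"]) auto
qed

text \<open>Double induction, on the formal degree and, inside, on the number of polynomials of top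
  degree. In degree 0 the sign is that of the constant coefficient, and the identity serves as the
  map.\<close>

theorem sign_pattern_map_exists:
  fixes Q :: "('e::euclidean_space \<Rightarrow> real poly) set"
  assumes "finite Q" "\<And>q. q \<in> Q \<Longrightarrow> param_poly n q"
  shows "\<exists>F. finite F \<and> (\<forall>f\<in>F. real_polynomial_function f) \<and>
    (\<forall>x y. same_signs F x y \<longrightarrow> (\<exists>h. sign_pattern_map Q x y h))"
  using assms
proof (induction n arbitrary: Q)
  case 0
  let ?F = "(\<lambda>q x. coeff (q x) 0) ` Q"
  have "\<exists>h. sign_pattern_map Q x y h" if "same_signs ?F x y" for x y
  proof -
    have "poly (q z) v = coeff (q z) 0" if "q \<in> Q" for q z v
    proof -
      have "degree (q z) = 0" using 0(2)[OF that] by (simp add: param_poly_def)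
      then show ?thesis by (cases "q z") (auto split: if_splits)
    qed
    then have "sign_pattern_map Q x y (\<lambda>v. v)"
      using that by (auto simp: sign_pattern_map_def same_signs_def strict_mono_def)
    then show ?thesis by blast
  qed
  then show ?case using 0 by (intro exI[of _ ?F]) (auto simp: param_poly_def)
next
  case (Suc n)
  have "\<exists>F. finite F \<and> (\<forall>f\<in>F. real_polynomial_function f) \<and>
      (\<forall>x y. same_signs F x y \<longrightarrow> (\<exists>h. sign_pattern_map (U \<union> V) x y h))"
    if "finite V" "\<And>q. q \<in> V \<Longrightarrow> param_poly (Suc n) q"
      "finite U" "\<And>q. q \<in> U \<Longrightarrow> param_poly n q" for U V :: "('e \<Rightarrow> real poly) set"
    using that
  proof (induction V arbitrary: U rule: finite_induct)
    case empty
    then show ?case using Suc.IH by simp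
  next
    case (insert p V)
    show ?case
      by (rule sign_pattern_map_step[where n = n]) (use insert in \<open>auto simp del: Un_insert_right\<close>)
  qed
  from this[of Q "{}"] show ?case using Suc.prems by simp
qed

definition affine_function :: "('e::euclidean_space \<Rightarrow> real) \<Rightarrow> bool"
  where "affine_function f \<longleftrightarrow> (\<exists>a c. f = (\<lambda>x. a \<bullet> x + c))"

text \<open>
  The flag \<open>L\<close> selects the semilinear theory; without it the functions are arbitrary
  polynomials. A set is definable if membership depends only on the signs of finitely many
  such functions, which spares all normal forms.
\<close>
definition tame :: "bool \<Rightarrow> ('e::euclidean_space \<Rightarrow> real) \<Rightarrow> bool"
  where "tame L f \<longleftrightarrow> real_polynomial_function f \<and> (L \<longrightarrow> affine_function f)"

definition definable :: "bool \<Rightarrow> ('e::euclidean_space \<Rightarrow> bool) \<Rightarrow> bool"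
  where "definable L P \<longleftrightarrow> (\<exists>F. finite F \<and> (\<forall>f\<in>F. tame L f) \<and>
    (\<forall>x y. same_signs F x y \<longrightarrow> P x = P y))"

section \<open>Elimination of one real quantifier\<close>

lemma polynomial_along_line:
  fixes f :: "'e::euclidean_space \<Rightarrow> real"
  assumes "real_polynomial_function f"
  shows "\<exists>n P. param_poly n P \<and> (\<forall>x t. f (x + t *\<^sub>R b) = poly (P x) t)"
  using assms
proof (induction rule: real_polynomial_function.induct)
  case (linear f)
  note lin = \<open>bounded_linear f\<close>
  interpret bounded_linear f by (rule lin)
  have "real_polynomial_function (\<lambda>x. coeff [:f x, f b:] i)" for i
    using real_polynomial_function.intros(1)[OF lin] real_polynomial_function.intros(2)[of 0]
      real_polynomial_function.intros(2)[of "f b"]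
    by (cases i; cases "i - 1") (simp_all add: coeff_pCons)
  then have "param_poly 1 (\<lambda>x. [:f x, f b:])" by (simp add: param_poly_def)
  then show ?case by (intro exI[of _ 1] exI[of _ "\<lambda>x. [:f x, f b:]"]) (simp add: add scaleR)
next
  case (const c)
  have "param_poly 0 (\<lambda>x. [:c:])"
    by (auto simp: param_poly_def coeff_pCons real_polynomial_function.intros split: nat.splits)
  then show ?case by (intro exI[of _ 0] exI[of _ "\<lambda>x. [:c:]"]) simp
next
  case (add f g)
  then obtain n m P Q where PQ: "param_poly n P" "param_poly m Q"
    "\<forall>x t. f (x + t *\<^sub>R b) = poly (P x) t" "\<forall>x t. g (x + t *\<^sub>R b) = poly (Q x) t" by blast
  have "param_poly (max n m) (\<lambda>x. P x + Q x)"
    unfolding param_poly_def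
  proof (intro conjI allI)
    show "degree (P x + Q x) \<le> max n m" for x
      using PQ(1,2) by (intro degree_add_le) (auto simp: param_poly_def intro: le_max_iff_disj[THEN iffD2])
    show "real_polynomial_function (\<lambda>x. coeff (P x + Q x) i)" for i
      using PQ(1,2) by (simp add: param_poly_def real_polynomial_function.intros(3))
  qed
  then show ?case using PQ by (intro exI[of _ "max n m"] exI[of _ "\<lambda>x. P x + Q x"]) simp
next
  case (mult f g)
  then obtain n m P Q where PQ: "param_poly n P" "param_poly m Q"
    "\<forall>x t. f (x + t *\<^sub>R b) = poly (P x) t" "\<forall>x t. g (x + t *\<^sub>R b) = poly (Q x) t" by blast
  have "param_poly (n + m) (\<lambda>x. P x * Q x)"
    unfolding param_poly_def
  proof (intro conjI allI)
    show "degree (P x * Q x) \<le> n + m" for x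
      by (meson PQ(1,2) param_poly_def add_mono degree_mult_le order_trans)
    show "real_polynomial_function (\<lambda>x. coeff (P x * Q x) i)" for i
      using PQ(1,2) unfolding coeff_mult
      by (intro real_polynomial_function_sum real_polynomial_function.intros(4)) (auto simp: param_poly_def)
  qed
  then show ?case using PQ by (intro exI[of _ "n + m"] exI[of _ "\<lambda>x. P x * Q x"]) simp
qed

text \<open>Along the line the functions of \<open>F\<close> are polynomials in \<open>t\<close>
  whose coefficients are polynomials in the base point. A sign pattern map \<open>h\<close> then
  sends a witness \<open>t\<close> at \<open>x\<close> to the witness \<open>h t\<close> at
  \<open>y\<close>.\<close>

lemma definable_ex_line_polynomial:
  assumes "definable False P"
  shows "definable False (\<lambda>x. \<exists>t. P (x + t *\<^sub>R b))"
proof -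
  obtain F where F: "finite F" "\<And>f. f \<in> F \<Longrightarrow> real_polynomial_function f"
    "\<And>x y. same_signs F x y \<Longrightarrow> P x = P y"
    using assms unfolding definable_def tame_def by metis
  obtain n Q where Q: "\<And>f. f \<in> F \<Longrightarrow> param_poly (n f) (Q f)"
    "\<And>f x t. f \<in> F \<Longrightarrow> f (x + t *\<^sub>R b) = poly (Q f x) t"
    using polynomial_along_line[OF F(2), of _ b] by metis
  have "param_poly (sum n F) q" if "q \<in> Q ` F" for q
    using that Q(1) F(1) by (auto intro: param_poly_mono member_le_sum)
  then obtain G where G: "finite G" "\<forall>f\<in>G. real_polynomial_function f"
    "\<And>x y. same_signs G x y \<Longrightarrow> \<exists>h. sign_pattern_map (Q ` F) x y h"
    using sign_pattern_map_exists[of "Q ` F" "sum n F"] F(1) by auto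
  have "\<exists>s. P (y + s *\<^sub>R b)" if xy: "same_signs G x y" and t: "P (x + t *\<^sub>R b)" for x y t
  proof -
    obtain h where "sign_pattern_map (Q ` F) x y h" using G(3)[OF xy] by blast
    then have "same_signs F (x + t *\<^sub>R b) (y + h t *\<^sub>R b)"
      using Q(2) by (simp add: same_signs_def sign_pattern_map_def)
    then show ?thesis using F(3) t by blast
  qed
  then have "(\<exists>t. P (x + t *\<^sub>R b)) = (\<exists>t. P (y + t *\<^sub>R b))" if "same_signs G x y" for x y
    using that same_signs_sym[OF that] by metis
  then show ?thesis
    unfolding definable_def tame_def using G(1,2) by (intro exI[of _ G] conjI) simp_all
qed

lemma between_finite_sets:
  fixes A B :: "real set"
  assumes "finite A" "finite B" "\<And>a b. a \<in> A \<Longrightarrow> b \<in> B \<Longrightarrow> a < b"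
  shows "\<exists>t. (\<forall>a\<in>A. a < t) \<and> (\<forall>b\<in>B. t < b)"
proof (cases "A = {} \<or> B = {}")
  case True
  then show ?thesis
  proof
    assume "A = {}"
    moreover have "Min (insert 0 B) - 1 < b" if "b \<in> B" for b
    proof -
      have "Min (insert 0 B) \<le> b" by (rule Min_le) (use that assms(2) in auto)
      then show ?thesis by linarith
    qed
    ultimately show ?thesis by blast
  next
    assume "B = {}"
    moreover have "a < Max (insert 0 A) + 1" if "a \<in> A" for a
    proof -
      have "a \<le> Max (insert 0 A)" by (rule Max_ge) (use that assms(1) in auto)
      then show ?thesis by linarith
    qed
    ultimately show ?thesis by blast
  qed
next
  case False
  then have "Max A < Min B" using assms by simp
  then obtain t where "Max A < t" "t < Min B" using dense by blast
  then show ?thesis using assms(1,2) False by (intro exI[of _ t]) auto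
qed

lemma real_polynomial_affine: "real_polynomial_function (\<lambda>x::'e::euclidean_space. a \<bullet> x + c)"
  by (intro real_polynomial_function.intros(3) real_polynomial_function.intros(2)
      real_polynomial_function.intros(1) bounded_linear_inner_right)

lemma tame_True_iff: "tame True f \<longleftrightarrow> (\<exists>a c. f = (\<lambda>x. a \<bullet> x + c))"
  using real_polynomial_affine by (auto simp: tame_def affine_function_def)

text \<open>One step of Fourier--Motzkin elimination.\<close>
lemma definable_ex_line_affine:
  fixes P :: "'e::euclidean_space \<Rightarrow> bool"
  assumes "definable True P"
  shows "definable True (\<lambda>x. \<exists>t. P (x + t *\<^sub>R b))"
proof -
  obtain F where F: "finite F" "\<And>f. f \<in> F \<Longrightarrow> tame True f"
    "\<And>x y. same_signs F x y \<Longrightarrow> P x = P y"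
    using assms unfolding definable_def by metis
  obtain a c where ac: "\<And>f. f \<in> F \<Longrightarrow> f = (\<lambda>x. a f \<bullet> x + c f)"
    using F(2) unfolding tame_True_iff by metis
  define F1 where "F1 = {f\<in>F. a f \<bullet> b \<noteq> 0}"
  have F1: "finite F1" "F1 \<subseteq> F" using F(1) by (auto simp: F1_def)
  \<comment> \<open>\<open>\<rho> f x\<close> is the parameter at which \<open>f\<close> vanishes on
    the line through \<open>x\<close> in direction \<open>b\<close>. Differences of such roots are
    again affine in \<open>x\<close>, since the denominators are constants.\<close>
  define \<rho> where "\<rho> f x = - f x / (a f \<bullet> b)" for f x
  define G where "G = F \<union> (\<lambda>(f, g). \<lambda>x. \<rho> f x - \<rho> g x) ` (F1 \<times> F1)"
  have "tame True (\<lambda>x. \<rho> f x - \<rho> g x)" if "f \<in> F1" "g \<in> F1" for f g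
  proof -
    have "(\<lambda>x. \<rho> f x - \<rho> g x) = (\<lambda>x. ((1 / (a g \<bullet> b)) *\<^sub>R a g - (1 / (a f \<bullet> b)) *\<^sub>R a f) \<bullet> x
        + (c g / (a g \<bullet> b) - c f / (a f \<bullet> b)))"
    proof
      fix x
      have "f x = a f \<bullet> x + c f" "g x = a g \<bullet> x + c g" using ac that F1(2) by (metis subsetD)+
      then show "\<rho> f x - \<rho> g x = ((1 / (a g \<bullet> b)) *\<^sub>R a g - (1 / (a f \<bullet> b)) *\<^sub>R a f) \<bullet> x
        + (c g / (a g \<bullet> b) - c f / (a f \<bullet> b))"
        by (simp add: \<rho>_def inner_diff_left add_divide_distrib diff_divide_distrib)
    qed
    then show ?thesis unfolding tame_True_iff by blast
  qed
  then have G: "finite G" "\<forall>g\<in>G. tame True g"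
    using F(1,2) F1(1) by (auto simp: G_def)
  have along: "sgn (f (x + t *\<^sub>R b)) = (if f \<in> F1 then sgn (a f \<bullet> b) * sgn (t - \<rho> f x) else sgn (f x))"
    if "f \<in> F" for f x t
  proof -
    have "f (x + t *\<^sub>R b) = f x + t * (a f \<bullet> b)"
      using fun_cong[OF ac[OF that], of x] fun_cong[OF ac[OF that], of "x + t *\<^sub>R b"]
      by (simp add: inner_add_right)
    moreover have "f x + t * (a f \<bullet> b) = (a f \<bullet> b) * (t - \<rho> f x)" if "f \<in> F1"
      using that by (simp add: F1_def \<rho>_def field_simps)
    ultimately show ?thesis using that by (auto simp: sgn_mult F1_def)
  qed
  have "\<exists>s. P (y + s *\<^sub>R b)" if xy: "same_signs G x y" and t: "P (x + t *\<^sub>R b)" for x y t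
  proof -
    have \<rho>_order: "sgn (\<rho> f x - \<rho> g x) = sgn (\<rho> f y - \<rho> g y)" if "f \<in> F1" "g \<in> F1" for f g
    proof -
      have "(\<lambda>x. \<rho> f x - \<rho> g x) \<in> G"
        using that unfolding G_def by (intro UnI2 image_eqI[of _ _ "(f, g)"]) auto
      from xy[unfolded same_signs_def, rule_format, OF this] show ?thesis .
    qed
    \<comment> \<open>Only the position of \<open>t\<close> among the roots has to be copied: it is
      one of them, or it lies strictly between the lower and the upper ones.\<close>
    have "\<exists>s. \<forall>f\<in>F1. sgn (t - \<rho> f x) = sgn (s - \<rho> f y)"
    proof (cases "\<exists>g\<in>F1. t = \<rho> g x")
      case True
      then show ?thesis using \<rho>_order by blast
    next
      case False
      have "\<exists>s. (\<forall>r\<in>(\<lambda>f. \<rho> f y) ` {f\<in>F1. \<rho> f x < t}. r < s) \<and>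
          (\<forall>r\<in>(\<lambda>f. \<rho> f y) ` {f\<in>F1. \<rho> f x > t}. s < r)"
      proof (rule between_finite_sets)
        fix r r' assume "r \<in> (\<lambda>f. \<rho> f y) ` {f\<in>F1. \<rho> f x < t}" "r' \<in> (\<lambda>f. \<rho> f y) ` {f\<in>F1. \<rho> f x > t}"
        then obtain f g where "f \<in> F1" "g \<in> F1" "\<rho> f x < \<rho> g x" "r = \<rho> f y" "r' = \<rho> g y" by auto
        then show "r < r'" using \<rho>_order[of f g] by (auto simp: sgn_if split: if_splits)
      qed (use F1(1) in auto)
      then obtain s where s: "\<And>f. f \<in> F1 \<Longrightarrow> \<rho> f x < t \<Longrightarrow> \<rho> f y < s"
        "\<And>f. f \<in> F1 \<Longrightarrow> t < \<rho> f x \<Longrightarrow> s < \<rho> f y" by auto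
      have "sgn (t - \<rho> f x) = sgn (s - \<rho> f y)" if "f \<in> F1" for f
        using s[OF that] False that by (cases t "\<rho> f x" rule: linorder_cases) auto
      then show ?thesis by blast
    qed
    then obtain s where s: "\<And>f. f \<in> F1 \<Longrightarrow> sgn (t - \<rho> f x) = sgn (s - \<rho> f y)" by blast
    have "sgn (f (x + t *\<^sub>R b)) = sgn (f (y + s *\<^sub>R b))" if "f \<in> F" for f
      using along[OF that] s[of f] xy that by (simp add: same_signs_def G_def)
    then have "same_signs F (x + t *\<^sub>R b) (y + s *\<^sub>R b)" by (simp add: same_signs_def)
    then show ?thesis using F(3) t by blast
  qed
  then have "(\<exists>t. P (x + t *\<^sub>R b)) = (\<exists>t. P (y + t *\<^sub>R b))" if "same_signs G x y" for x y
    using that same_signs_sym[OF that] by metis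
  then show ?thesis
    unfolding definable_def using G by (intro exI[of _ G] conjI) simp_all
qed

lemma definable_ex_line: "definable L P \<Longrightarrow> definable L (\<lambda>x. \<exists>t. P (x + t *\<^sub>R b))"
  using definable_ex_line_affine definable_ex_line_polynomial by (cases L) simp_all

section \<open>Closure properties of definability\<close>

lemma tame_linear: "linear f \<Longrightarrow> tame L f"
proof -
  assume f: "linear f"
  then have "affine_function f"
    unfolding affine_function_def
    by (intro exI[of _ "adjoint f 1"] exI[of _ 0]) (auto simp: adjoint_clauses)
  then show ?thesis
    using f by (auto simp: tame_def linear_conv_bounded_linear intro: real_polynomial_function.intros)
qed

lemma tame_const: "tame L (\<lambda>x::'a::euclidean_space. c)"
proof -
  have "affine_function (\<lambda>x::'a. c)"
    unfolding affine_function_def by (intro exI[of _ 0] exI[of _ c]) simp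
  then show ?thesis by (simp add: tame_def real_polynomial_function.intros(2))
qed

lemma tame_add:
  assumes "tame L f" "tame L g"
  shows "tame L (\<lambda>x. f x + g x)"
proof -
  have "affine_function (\<lambda>x. f x + g x)" if fg: "affine_function f" "affine_function g"
  proof -
    obtain a c b d where "f = (\<lambda>x. a \<bullet> x + c)" "g = (\<lambda>x. b \<bullet> x + d)"
      using fg by (auto simp: affine_function_def)
    then have "(\<lambda>x. f x + g x) = (\<lambda>x. (a + b) \<bullet> x + (c + d))" by (simp add: inner_add_left algebra_simps)
    then show ?thesis unfolding affine_function_def by blast
  qed
  then show ?thesis using assms by (simp add: tame_def real_polynomial_function.intros(3))
qed

lemma tame_scale:
  assumes "tame L f"
  shows "tame L (\<lambda>x. r * f x)"
proof -
  have "affine_function (\<lambda>x. r * f x)" if f: "affine_function f"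
  proof -
    obtain a c where "f = (\<lambda>x. a \<bullet> x + c)" using f by (auto simp: affine_function_def)
    then have "(\<lambda>x. r * f x) = (\<lambda>x. (r *\<^sub>R a) \<bullet> x + r * c)" by (simp add: algebra_simps)
    then show ?thesis unfolding affine_function_def by blast
  qed
  then show ?thesis
    using assms by (simp add: tame_def real_polynomial_function.intros(2,4))
qed

lemma tame_diff: "tame L f \<Longrightarrow> tame L g \<Longrightarrow> tame L (\<lambda>x. f x - g x)"
  using tame_add[OF _ tame_scale[of L g "-1"], of f] by simp

lemma tame_sum:
  assumes "finite I" "\<And>i. i \<in> I \<Longrightarrow> tame L (f i)"
  shows "tame L (\<lambda>x. \<Sum>i\<in>I. f i x)"
  using assms by (induction I rule: finite_induct) (simp_all add: tame_const tame_add)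

lemma tame_compose_linear:
  fixes g :: "'a::euclidean_space \<Rightarrow> 'b::euclidean_space"
  assumes "tame L f" "linear g"
  shows "tame L (\<lambda>x. f (g x))"
proof -
  have "real_polynomial_function (f \<circ> g)"
    using assms by (intro real_polynomial_function_compose polynomial_function_bounded_linear)
      (auto simp: tame_def linear_conv_bounded_linear)
  moreover have "affine_function (\<lambda>x. f (g x))" if f: "affine_function f"
  proof -
    obtain a c where "f = (\<lambda>x. a \<bullet> x + c)" using f by (auto simp: affine_function_def)
    then have "(\<lambda>x. f (g x)) = (\<lambda>x. adjoint g a \<bullet> x + c)"
      using assms(2) by (simp add: adjoint_clauses)
    then show ?thesis unfolding affine_function_def by blast
  qed
  ultimately show ?thesis using assms(1) by (simp add: tame_def o_def)
qed

lemma definable_of_tame: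
  assumes "tame L f" "\<And>x y. sgn (f x) = sgn (f y) \<Longrightarrow> P x = P y"
  shows "definable L P"
  unfolding definable_def
proof (intro exI conjI allI impI)
  show "finite {f}" "\<forall>g\<in>{f}. tame L g" using assms(1) by simp_all
  show "P x = P y" if "same_signs {f} x y" for x y
    using that by (intro assms(2)) (simp add: same_signs_def)
qed

lemma same_sgn_iff:
  assumes "sgn (a::real) = sgn b"
  shows "a < 0 \<longleftrightarrow> b < 0" "a \<le> 0 \<longleftrightarrow> b \<le> 0" "a = 0 \<longleftrightarrow> b = 0"
  using assms by (auto simp: sgn_if split: if_splits)

lemma definable_less:
  assumes "tame L f" "tame L g"
  shows "definable L (\<lambda>x. f x < g x)"
proof (rule definable_of_tame[OF tame_diff[OF assms]])
  fix x y assume "sgn (f x - g x) = sgn (f y - g y)"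
  from same_sgn_iff(1)[OF this] show "(f x < g x) = (f y < g y)" by simp
qed

lemma definable_le:
  assumes "tame L f" "tame L g"
  shows "definable L (\<lambda>x. f x \<le> g x)"
proof (rule definable_of_tame[OF tame_diff[OF assms]])
  fix x y assume "sgn (f x - g x) = sgn (f y - g y)"
  from same_sgn_iff(2)[OF this] show "(f x \<le> g x) = (f y \<le> g y)" by simp
qed

lemma definable_eq:
  assumes "tame L f" "tame L g"
  shows "definable L (\<lambda>x. f x = g x)"
proof (rule definable_of_tame[OF tame_diff[OF assms]])
  fix x y assume "sgn (f x - g x) = sgn (f y - g y)"
  from same_sgn_iff(3)[OF this] show "(f x = g x) = (f y = g y)" by simp
qed

text \<open>Both truth values are fixed by the signs of \<open>F \<union> G\<close>, and with them
  the value of every binary connective \<open>c\<close>.\<close>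

lemma definable_combine:
  assumes "definable L P" "definable L Q"
  shows "definable L (\<lambda>x. c (P x) (Q x))"
proof -
  obtain F G where "finite F" "\<forall>f\<in>F. tame L f" "\<forall>x y. same_signs F x y \<longrightarrow> P x = P y"
    "finite G" "\<forall>f\<in>G. tame L f" "\<forall>x y. same_signs G x y \<longrightarrow> Q x = Q y"
    using assms unfolding definable_def by metis
  then show ?thesis unfolding definable_def
    by (intro exI[of _ "F \<union> G"]) (auto simp: same_signs_Un)
qed

lemma definable_const: "definable L (\<lambda>x. c)"
  unfolding definable_def by (intro exI[of _ "{}"]) auto

lemmas definable_conj = definable_combine[where c = "(\<and>)"]
lemmas definable_disj = definable_combine[where c = "(\<or>)"]
lemmas definable_imp = definable_combine[where c = "(\<longrightarrow>)"]

lemma definable_not: "definable L P \<Longrightarrow> definable L (\<lambda>x. \<not> P x)"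
  by (auto simp: definable_def)

lemma definable_ball:
  assumes "finite I" "\<And>i. i \<in> I \<Longrightarrow> definable L (P i)"
  shows "definable L (\<lambda>x. \<forall>i\<in>I. P i x)"
  using assms
  by (induction I rule: finite_induct) (simp_all add: definable_const definable_conj)

lemma definable_bex:
  assumes "finite I" "\<And>i. i \<in> I \<Longrightarrow> definable L (P i)"
  shows "definable L (\<lambda>x. \<exists>i\<in>I. P i x)"
  using assms
  by (induction I rule: finite_induct) (simp_all add: definable_const definable_disj)

lemma definable_compose_linear:
  fixes g :: "'a::euclidean_space \<Rightarrow> 'b::euclidean_space"
  assumes "definable L P" "linear g"
  shows "definable L (\<lambda>x. P (g x))"
proof -
  obtain F where F: "finite F" "\<forall>f\<in>F. tame L f" "\<forall>x y. same_signs F x y \<longrightarrow> P x = P y"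
    using assms unfolding definable_def by metis
  show ?thesis
    unfolding definable_def
    by (rule exI[of _ "(\<lambda>f x. f (g x)) ` F"])
       (use F assms(2) in \<open>auto simp: same_signs_def intro: tame_compose_linear\<close>)
qed

text \<open>A vector is eliminated direction by direction: the displacement \<open>w\<close> ranges
  over the span of a growing finite set until that set is \<open>Basis\<close>, and each new
  direction is one quantifier along a line.\<close>

lemma definable_ex:
  fixes P :: "'a::euclidean_space \<Rightarrow> 'b::euclidean_space \<Rightarrow> bool"
  assumes "definable L (\<lambda>z. P (fst z) (snd z))"
  shows "definable L (\<lambda>x. \<exists>y. P x y)"
proof -
  have "definable L (\<lambda>z. \<exists>w\<in>span D. P (fst z) (snd z + w))" if "finite D" for D
    using that
  proof (induction D rule: finite_induct)
    case empty
    then show ?case using assms by simp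
  next
    case (insert b D)
    have "(\<exists>w\<in>span (insert b D). P x (y + w)) \<longleftrightarrow> (\<exists>t. \<exists>w\<in>span D. P x (y + t *\<^sub>R b + w))" for x y
    proof
      assume "\<exists>w\<in>span (insert b D). P x (y + w)"
      then obtain w t where "P x (y + w)" "w - t *\<^sub>R b \<in> span D"
        by (auto simp: span_breakdown_eq)
      then show "\<exists>t. \<exists>w\<in>span D. P x (y + t *\<^sub>R b + w)"
        by (intro exI[of _ t] bexI[of _ "w - t *\<^sub>R b"]) auto
    next
      assume "\<exists>t. \<exists>w\<in>span D. P x (y + t *\<^sub>R b + w)"
      then obtain w t where "P x (y + t *\<^sub>R b + w)" "w \<in> span D" by blast
      then show "\<exists>w\<in>span (insert b D). P x (y + w)"
        by (intro bexI[of _ "t *\<^sub>R b + w"]) (auto simp: span_breakdown_eq add.assoc intro!: exI[of _ t])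
    qed
    then show ?case
      using definable_ex_line[OF insert.IH, of "(0, b)"] by simp
  qed
  from this[of Basis] have "definable L (\<lambda>z. \<exists>w. P (fst z) (snd z + w))"
    by (simp add: finite_Basis)
  from definable_compose_linear[OF this, of "\<lambda>x. (x, 0)"] show ?thesis
    by (simp add: linear_iff)
qed

lemma definable_all:
  fixes P :: "'a::euclidean_space \<Rightarrow> 'b::euclidean_space \<Rightarrow> bool"
  assumes "definable L (\<lambda>z. P (fst z) (snd z))"
  shows "definable L (\<lambda>x. \<forall>y. P x y)"
  using definable_not[OF definable_ex[of L "\<lambda>x y. \<not> P x y", OF definable_not[OF assms]]] by simp

section \<open>The Lojasiewicz inequality\<close>

text \<open>With \<open>N\<close> the order of the zero at 0, the cofactor does not vanish at 0 and
  by continuity stays above half of its absolute value there.\<close>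

lemma poly_lower_bound_near_0:
  fixes A :: "real poly"
  assumes "A \<noteq> 0"
  shows "\<exists>c N \<epsilon>. 0 < c \<and> 0 < \<epsilon> \<and> (\<forall>t. 0 < t \<longrightarrow> t < \<epsilon> \<longrightarrow> c * t ^ N \<le> \<bar>poly A t\<bar>)"
proof -
  define N where "N = order 0 A"
  obtain B where B: "A = [:- 0, 1:] ^ N * B" "\<not> [:- 0, 1:] dvd B"
    using order_decomp[OF assms, of 0] unfolding N_def by blast
  then have B0: "poly B 0 \<noteq> 0" using poly_eq_0_iff_dvd[of B 0] by simp
  have "(poly B \<longlongrightarrow> poly B 0) (at_right 0)" by (intro tendsto_poly tendsto_ident_at)
  then have "((\<lambda>t. \<bar>poly B t\<bar>) \<longlongrightarrow> \<bar>poly B 0\<bar>) (at_right 0)" by (rule tendsto_rabs)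
  then have "eventually (\<lambda>t. \<bar>poly B 0\<bar> / 2 < \<bar>poly B t\<bar>) (at_right 0)"
    by (rule order_tendstoD(1)) (use B0 in simp)
  then obtain \<epsilon> where \<epsilon>: "\<epsilon> > 0" "\<And>t. 0 < t \<Longrightarrow> t < \<epsilon> \<Longrightarrow> \<bar>poly B 0\<bar> / 2 < \<bar>poly B t\<bar>"
    unfolding eventually_at_right_field by auto
  have "\<bar>poly B 0\<bar> / 2 * t ^ N \<le> \<bar>poly A t\<bar>" if "0 < t" "t < \<epsilon>" for t
  proof -
    have "\<bar>poly A t\<bar> = \<bar>poly B t\<bar> * t ^ N" using that B(1) by (simp add: abs_mult)
    then show ?thesis using \<epsilon>(2)[OF that] that(1) by (simp add: mult_right_mono)
  qed
  then show ?thesis using B0 \<epsilon>(1) by (intro exI[of _ "\<bar>poly B 0\<bar> / 2"] exI[of _ N] exI[of _ \<epsilon>]) auto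
qed

text \<open>The clause \<open>\<exists>y'. f (t, y') \<noteq> 0\<close> excludes those
  \<open>t\<close> at which \<open>f\<close> vanishes on the whole vertical line, where every
  \<open>y\<close> is a root and no lower bound is possible.\<close>

definition root_bound :: "bool \<Rightarrow> (real \<times> real \<Rightarrow> real) \<Rightarrow> real \<Rightarrow> nat \<Rightarrow> real \<Rightarrow> bool"
  where "root_bound L f c N \<epsilon> \<longleftrightarrow> 0 < c \<and> 1 \<le> N \<and> (L \<longrightarrow> N = 1) \<and> 0 < \<epsilon> \<and> \<epsilon> \<le> 1 \<and>
    (\<forall>t y. 0 < t \<and> t < \<epsilon> \<and> 0 < y \<and> y \<le> 1 \<and> f (t, y) = 0 \<and> (\<exists>y'. f (t, y') \<noteq> 0) \<longrightarrow> c * t ^ N \<le> y)"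

lemma real_polynomial_as_poly:
  assumes "real_polynomial_function (f :: real \<Rightarrow> real)"
  shows "\<exists>A. \<forall>t. f t = poly A t"
proof -
  obtain a n where "f = (\<lambda>x. \<Sum>i\<le>n. a i * x ^ i)"
    using assms real_polynomial_function_iff_sum by blast
  then have "f t = poly (\<Sum>i\<le>n. monom (a i) i) t" for t by (simp add: poly_sum poly_monom)
  then show ?thesis by blast
qed

text \<open>
  If \<open>y\<close> is a root of \<open>\<Sum>\<^sub>i A i t * y ^ i\<close> and \<open>A k\<close> is the first coefficient that is not
  the zero polynomial, then \<open>\<bar>A k t\<bar> = O(y)\<close>, while \<open>\<bar>A k t\<bar>\<close> is at least a multiple of a
  power of \<open>t\<close>.
\<close>
lemma root_bound_polynomial:
  assumes "real_polynomial_function f"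
  shows "\<exists>c N \<epsilon>. root_bound False f c N \<epsilon>"
proof -
  obtain n P where P: "param_poly n P" "\<And>x t. f (x + t *\<^sub>R (0, 1)) = poly (P x) t"
    using polynomial_along_line[OF assms] by blast
  have "real_polynomial_function (\<lambda>t. coeff (P (t, 0)) i)" for i
  proof -
    have "polynomial_function (\<lambda>t::real. (t, 0::real))"
      by (intro polynomial_function_bounded_linear) (auto simp: linear_conv_bounded_linear[symmetric] linear_iff)
    from real_polynomial_function_compose[OF this] P(1) show ?thesis
      by (auto simp: param_poly_def o_def)
  qed
  then have "\<exists>A. \<forall>t. coeff (P (t, 0)) i = poly A t" for i
    by (rule real_polynomial_as_poly)
  then obtain A where A: "\<And>i t. coeff (P (t, 0)) i = poly (A i) t" by metis
  have f: "f (t, y) = (\<Sum>i\<le>n. poly (A i) t * y ^ i)" for t y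
  proof -
    have "f (t, y) = poly (P (t, 0)) y" using P(2)[of "(t, 0)" y] by simp
    also have "\<dots> = (\<Sum>i\<le>n. coeff (P (t, 0)) i * y ^ i)"
      unfolding poly_altdef using P(1) by (intro sum.mono_neutral_left) (auto simp: param_poly_def coeff_eq_0)
    finally show ?thesis by (simp add: A)
  qed
  show ?thesis
  proof (cases "\<forall>i\<le>n. A i = 0")
    case True
    then have "root_bound False f 1 1 1" by (simp add: root_bound_def f)
    then show ?thesis by blast
  next
    case False
    define k where "k = (LEAST i. A i \<noteq> 0)"
    have "\<exists>i. A i \<noteq> 0" using False by blast
    then have k: "A k \<noteq> 0" "\<And>i. i < k \<Longrightarrow> A i = 0"
      unfolding k_def by (rule LeastI_ex) (use not_less_Least in blast)
    have kn: "k \<le> n" using False k(2) by (metis le_less_trans not_le)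
    obtain c N \<epsilon> where c: "0 < c" "0 < \<epsilon>" "\<And>t. 0 < t \<Longrightarrow> t < \<epsilon> \<Longrightarrow> c * t ^ N \<le> \<bar>poly (A k) t\<bar>"
      using poly_lower_bound_near_0[OF k(1)] by blast
    have "\<exists>B. \<forall>t\<in>{0..1}. \<bar>poly (A i) t\<bar> \<le> B" for i
    proof -
      have "compact (poly (A i) ` {0..1})" by (intro compact_continuous_image continuous_intros) auto
      then show ?thesis using compact_imp_bounded bounded_real by (metis (no_types, lifting) imageI)
    qed
    then obtain B where B: "\<And>i t. t \<in> {0..1} \<Longrightarrow> \<bar>poly (A i) t\<bar> \<le> B i" by metis
    have B0: "0 \<le> B i" for i using B[of 0 i] by simp
    \<comment> \<open>The sum bounds the factor that multiplies \<open>y\<close> in the equation for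
      the root; the 1 makes \<open>M\<close> positive, so that it can be divided by.\<close>
    define M where "M = 1 + (\<Sum>i\<in>{k<..n}. B i)"
    have M: "1 \<le> M" using B0 by (simp add: M_def sum_nonneg)
    \<comment> \<open>The order \<open>N\<close> may be 0, whereas \<open>root_bound\<close> asks
      for an exponent of at least 1; as \<open>t < 1\<close>, raising it only weakens the
      bound.\<close>
    have "c / M * t ^ Suc N \<le> y"
      if t: "0 < t" "t < min \<epsilon> 1" and y: "0 < y" "y \<le> 1" and root: "f (t, y) = 0" for t y
    proof -
      define S where "S = (\<Sum>i\<in>{k<..n}. poly (A i) t * y ^ (i - Suc k))"
      have "0 = (\<Sum>i\<in>{k..n}. poly (A i) t * y ^ i)"
        unfolding root[symmetric] f using k(2) by (intro sum.mono_neutral_right) auto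
      also have "{k..n} = insert k {k<..n}" using kn by auto
      also have "(\<Sum>i\<in>insert k {k<..n}. poly (A i) t * y ^ i)
          = poly (A k) t * y ^ k + (\<Sum>i\<in>{k<..n}. poly (A i) t * y ^ i)" by simp
      also have "(\<Sum>i\<in>{k<..n}. poly (A i) t * y ^ i) = y ^ Suc k * S"
        unfolding S_def sum_distrib_left
      proof (intro sum.cong refl)
        fix i assume "i \<in> {k<..n}"
        then have "y ^ i = y ^ Suc k * y ^ (i - Suc k)" by (simp add: power_add[symmetric] del: power_Suc)
        then show "poly (A i) t * y ^ i = y ^ Suc k * (poly (A i) t * y ^ (i - Suc k))" by simp
      qed
      finally have "y ^ k * (poly (A k) t + y * S) = 0" by (simp add: algebra_simps)
      then have "poly (A k) t = - (y * S)" using y(1) by auto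
      then have "\<bar>poly (A k) t\<bar> = y * \<bar>S\<bar>" using y(1) by (simp add: abs_mult)
      moreover have "\<bar>S\<bar> \<le> (\<Sum>i\<in>{k<..n}. B i)"
        unfolding S_def
      proof (rule order_trans[OF sum_abs], intro sum_mono)
        fix i
        have "\<bar>poly (A i) t\<bar> * y ^ (i - Suc k) \<le> B i * 1"
          using B[of t i] t y B0 by (intro mult_mono power_le_one) auto
        then show "\<bar>poly (A i) t * y ^ (i - Suc k)\<bar> \<le> B i" using y by (simp add: abs_mult)
      qed
      ultimately have "\<bar>poly (A k) t\<bar> \<le> y * M"
        using y(1) unfolding M_def by (simp add: mult_left_mono)
      moreover have "c * t ^ Suc N \<le> c * t ^ N"
        using c(1) t by (intro mult_left_mono power_decreasing) auto
      ultimately have "c * t ^ Suc N \<le> y * M" using c(3)[of t] t by linarith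
      then show ?thesis using M by (simp add: field_simps)
    qed
    moreover have "0 < c / M" using c(1) M by simp
    ultimately have "root_bound False f (c / M) (Suc N) (min \<epsilon> 1)"
      using c(2) unfolding root_bound_def by auto
    then show ?thesis by blast
  qed
qed

text \<open>Roots lie on a line \<open>y = \<alpha> + \<beta> * t\<close>, which for small
  \<open>t\<close> stays away from 0, grows linearly, or is not positive at all. If
  \<open>b = 0\<close>, a root makes \<open>f\<close> vanish on the entire vertical line, which
  \<open>root_bound\<close> excludes.\<close>

lemma root_bound_affine:
  assumes "tame True f"
  shows "\<exists>c N \<epsilon>. root_bound True f c N \<epsilon>"
proof -
  obtain a b d where f: "\<And>t y. f (t, y) = a * t + b * y + d"
    using assms unfolding tame_True_iff by (auto simp: inner_prod_def)
  show ?thesis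
  proof (cases "b = 0")
    case True
    then have "root_bound True f 1 1 1" by (auto simp: root_bound_def f)
    then show ?thesis by blast
  next
    case False
    define \<alpha> \<beta> where "\<alpha> = - d / b" and "\<beta> = - a / b"
    have root: "y = \<alpha> + \<beta> * t" if "f (t, y) = 0" for t y
      using that False by (simp add: f \<alpha>_def \<beta>_def field_simps)
    consider "\<alpha> > 0" | "\<alpha> = 0" "\<beta> > 0" | "\<alpha> = 0" "\<beta> \<le> 0" | "\<alpha> < 0" by linarith
    then show ?thesis
    proof cases
      case 1
      define \<epsilon> where "\<epsilon> = min 1 (\<alpha> / (2 * (\<bar>\<beta>\<bar> + 1)))"
      have "\<alpha> / 2 * t ^ 1 \<le> y" if "0 < t" "t < \<epsilon>" "f (t, y) = 0" for t y
      proof -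
        have "t * (\<bar>\<beta>\<bar> + 1) \<le> \<alpha> / 2" using that(2) by (simp add: \<epsilon>_def field_simps)
        moreover have "- (t * (\<bar>\<beta>\<bar> + 1)) \<le> \<beta> * t"
          using that(1) mult_right_mono[of "- \<bar>\<beta>\<bar>" \<beta> t] abs_ge_minus_self[of \<beta>]
          by (simp add: algebra_simps)
        moreover have "\<alpha> * t \<le> \<alpha> * 1" using that 1 by (intro mult_left_mono) (auto simp: \<epsilon>_def)
        ultimately show ?thesis using root[OF that(3)] by simp
      qed
      then have "root_bound True f (\<alpha> / 2) 1 \<epsilon>" using 1 by (auto simp: root_bound_def \<epsilon>_def)
      then show ?thesis by blast
    next
      case 2
      then have "root_bound True f \<beta> 1 1" by (auto simp: root_bound_def dest: root)
      then show ?thesis by blast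
    next
      case 3
      have False if "0 < t" "0 < y" "f (t, y) = 0" for t y
        using root[OF that(3)] that(1,2) 3 mult_nonpos_nonneg[of \<beta> t] by linarith
      then have "root_bound True f 1 1 1" by (auto simp: root_bound_def)
      then show ?thesis by blast
    next
      case 4
      define \<epsilon> where "\<epsilon> = min 1 (- \<alpha> / (\<bar>\<beta>\<bar> + 1))"
      have False if "0 < t" "t < \<epsilon>" "0 < y" "f (t, y) = 0" for t y
      proof -
        have "t * (\<bar>\<beta>\<bar> + 1) \<le> - \<alpha>" using that(2) by (simp add: \<epsilon>_def field_simps)
        moreover have "\<beta> * t \<le> t * (\<bar>\<beta>\<bar> + 1)"
        proof -
          have "\<beta> * t \<le> \<bar>\<beta>\<bar> * t" using that(1) by (intro mult_right_mono) auto
          moreover have "t * (\<bar>\<beta>\<bar> + 1) = \<bar>\<beta>\<bar> * t + t" by (simp add: algebra_simps)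
          ultimately show ?thesis using that(1) by linarith
        qed
        ultimately show False using root[OF that(4)] that(3) by linarith
      qed
      moreover have "0 < - \<alpha> / (\<bar>\<beta>\<bar> + 1)" using 4 by (intro divide_pos_pos) auto
      then have "0 < \<epsilon>" by (simp add: \<epsilon>_def)
      ultimately have "root_bound True f 1 1 \<epsilon>" by (auto simp: root_bound_def \<epsilon>_def)
      then show ?thesis by blast
    qed
  qed
qed

lemma root_bound_mono:
  assumes "root_bound L f c N \<epsilon>" "0 < c'" "c' \<le> c" "N \<le> N'" "L \<longrightarrow> N' = 1" "0 < \<epsilon>'" "\<epsilon>' \<le> \<epsilon>"
  shows "root_bound L f c' N' \<epsilon>'"
  unfolding root_bound_def
proof (intro conjI allI impI)
  fix t y assume ty: "0 < t \<and> t < \<epsilon>' \<and> 0 < y \<and> y \<le> 1 \<and> f (t, y) = 0 \<and> (\<exists>y'. f (t, y') \<noteq> 0)"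
  have "t < 1" using ty assms(1,7) by (auto simp: root_bound_def)
  then have "c' * t ^ N' \<le> c * t ^ N"
    using ty assms by (intro mult_mono power_decreasing) auto
  also have "\<dots> \<le> y" using assms(1,7) ty unfolding root_bound_def by (meson less_le_trans)
  finally show "c' * t ^ N' \<le> y" .
qed (use assms in \<open>auto simp: root_bound_def\<close>)

lemma root_bound_finite:
  assumes "finite F" "\<And>f. f \<in> F \<Longrightarrow> tame L f"
  shows "\<exists>c N \<epsilon>. 0 < c \<and> 1 \<le> N \<and> (L \<longrightarrow> N = 1) \<and> 0 < \<epsilon> \<and> \<epsilon> \<le> 1 \<and> (\<forall>f\<in>F. root_bound L f c N \<epsilon>)"
  using assms
proof (induction F rule: finite_induct)
  case empty
  show ?case by (intro exI[of _ 1]) simp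
next
  case (insert f F)
  obtain c N \<epsilon> where 1: "0 < c" "1 \<le> N" "L \<longrightarrow> N = 1" "0 < \<epsilon>" "\<epsilon> \<le> 1"
    "\<forall>f\<in>F. root_bound L f c N \<epsilon>" using insert by blast
  have "\<exists>c N \<epsilon>. root_bound L f c N \<epsilon>"
    using insert.prems[of f] root_bound_affine[of f] root_bound_polynomial[of f]
    by (cases L) (simp_all add: tame_def)
  then obtain c' N' \<epsilon>' where 2: "root_bound L f c' N' \<epsilon>'" by blast
  have 3: "0 < c'" "1 \<le> N'" "L \<longrightarrow> N' = 1" "0 < \<epsilon>'" using 2 by (auto simp: root_bound_def)
  show ?case
  proof (intro exI conjI ballI)
    fix g assume "g \<in> insert f F"
    then show "root_bound L g (min c c') (max N N') (min \<epsilon> \<epsilon>')"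
    proof
      assume "g = f"
      show ?thesis unfolding \<open>g = f\<close> by (rule root_bound_mono[OF 2]) (use 1 3 in auto)
    next
      assume "g \<in> F"
      then have g: "root_bound L g c N \<epsilon>" using 1(6) by blast
      show ?thesis by (rule root_bound_mono[OF g]) (use 1 3 in auto)
    qed
  qed (use 1 3 in auto)
qed

text \<open>At the least element \<open>y\<close> of a section of a definable set one of the functions must vanish.\<close>
lemma definable_section_growth:
  fixes E :: "real \<times> real \<Rightarrow> bool"
  assumes "definable L E"
  shows "\<exists>c N \<epsilon>. 0 < c \<and> 1 \<le> N \<and> (L \<longrightarrow> N = 1) \<and> 0 < \<epsilon> \<and> (\<forall>t y. 0 < t \<and> t < \<epsilon> \<and> 0 < y \<and>
    E (t, y) \<and> (\<forall>s. 0 < s \<and> s < y \<longrightarrow> \<not> E (t, s)) \<longrightarrow> c * t ^ N \<le> y)"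
proof -
  obtain F where F: "finite F" "\<And>f. f \<in> F \<Longrightarrow> tame L f"
    "\<And>x y. same_signs F x y \<Longrightarrow> E x = E y"
    using assms unfolding definable_def by metis
  obtain c N \<epsilon> where c: "0 < c" "1 \<le> N" "L \<longrightarrow> N = 1" "0 < \<epsilon>" "\<epsilon> \<le> 1"
    "\<And>f. f \<in> F \<Longrightarrow> root_bound L f c N \<epsilon>"
    using root_bound_finite[OF F(1,2)] by metis
  have "min c 1 * t ^ N \<le> y" if t: "0 < t" "t < \<epsilon>" and y: "0 < y" "E (t, y)"
    "\<And>s. 0 < s \<Longrightarrow> s < y \<Longrightarrow> \<not> E (t, s)" for t y
  proof (cases "y \<le> 1")
    \<comment> \<open>The 1 in \<open>min c 1\<close> is for this case: powers of
      \<open>t < 1\<close> do not exceed 1.\<close>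
    case False
    have "min c 1 * t ^ N \<le> 1 * 1" using t c by (intro mult_mono power_le_one) auto
    then show ?thesis using False by linarith
  next
    case True
    \<comment> \<open>If every function of \<open>F\<close> that vanishes at \<open>(t, y)\<close>
      vanished on the whole vertical line, no sign would change just below \<open>y\<close>, and
      \<open>E\<close> would already hold there.\<close>
    have "\<exists>f\<in>F. f (t, y) = 0 \<and> (\<exists>y'. f (t, y') \<noteq> 0)"
    proof (rule ccontr)
      assume contra: "\<not> (\<exists>f\<in>F. f (t, y) = 0 \<and> (\<exists>y'. f (t, y') \<noteq> 0))"
      have "eventually (\<lambda>s. sgn (f (t, s)) = sgn (f (t, y))) (at_left y)" if f: "f \<in> F" for f
      proof (cases "f (t, y) = 0")
        case True
        then have "\<forall>y'. f (t, y') = 0" using contra f by blast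
        then show ?thesis by simp
      next
        case False
        have "continuous_on UNIV f"
          using F(2)[OF f] continuous_on_polymonial_function real_polynomial_function_eq
          by (auto simp: tame_def)
        then have "isCont f (t, y)" by (simp add: continuous_on_eq_continuous_at)
        then have "(f \<longlongrightarrow> f (t, y)) (nhds (t, y))" by (simp add: continuous_at_imp_continuous_at_within tendsto_nhds_iff isCont_def)
        moreover have "filterlim (\<lambda>s. (t, s)) (nhds (t, y)) (at_left y)"
          by (intro tendsto_intros)
        ultimately have lim: "((\<lambda>s. f (t, s)) \<longlongrightarrow> f (t, y)) (at_left y)"
          by (rule filterlim_compose)
        consider "f (t, y) > 0" | "f (t, y) < 0" using False by linarith
        then show ?thesis
        proof cases
          case 1
          from order_tendstoD(1)[OF lim 1] show ?thesis by eventually_elim (use 1 in simp)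
        next
          case 2
          from order_tendstoD(2)[OF lim 2] show ?thesis by eventually_elim (use 2 in simp)
        qed
      qed
      then have "eventually (\<lambda>s. \<forall>f\<in>F. sgn (f (t, s)) = sgn (f (t, y))) (at_left y)"
        using F(1) by (simp add: eventually_ball_finite)
      moreover have "eventually (\<lambda>s. 0 < s \<and> s < y) (at_left y)"
        using eventually_at_left_real[OF y(1)] by (auto elim: eventually_mono)
      ultimately have "eventually (\<lambda>s. (\<forall>f\<in>F. sgn (f (t, s)) = sgn (f (t, y))) \<and> 0 < s \<and> s < y) (at_left y)"
        by (rule eventually_conj)
      then obtain s where "(\<forall>f\<in>F. sgn (f (t, s)) = sgn (f (t, y))) \<and> 0 < s \<and> s < y"
        using eventually_happens'[OF trivial_limit_at_left_real] by blast
      then show False using F(3)[of "(t, s)" "(t, y)"] y by (auto simp: same_signs_def)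
    qed
    then obtain f where "f \<in> F" "f (t, y) = 0" "\<exists>y'. f (t, y') \<noteq> 0" by blast
    then have "c * t ^ N \<le> y" using c(6)[of f] t y(1) True unfolding root_bound_def by blast
    moreover have "min c 1 * t ^ N \<le> c * t ^ N" using t by (intro mult_right_mono) auto
    ultimately show ?thesis by linarith
  qed
  then show ?thesis using c by (intro exI[of _ "min c 1"] exI[of _ N] exI[of _ \<epsilon>]) auto
qed

text \<open>The two definability hypotheses have the forms in which instances arise: an infimum is
  strictly below \<open>t\<close> iff some element is, and a maximum is at most \<open>t\<close> iff
  all of its terms are.\<close>

theorem lojasiewicz_inequality:
  fixes f g :: "'e::euclidean_space \<Rightarrow> real"
  assumes K: "compact K" "definable L (\<lambda>x. x \<in> K)"
    and f: "continuous_on K f" "definable L (\<lambda>z. f (fst z) < snd z)" "\<And>x. x \<in> K \<Longrightarrow> 0 \<le> f x"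
    and g: "continuous_on K g" "definable L (\<lambda>z. g (fst z) \<le> snd z)" "\<And>x. x \<in> K \<Longrightarrow> 0 \<le> g x"
    and zero: "\<And>x. x \<in> K \<Longrightarrow> g x = 0 \<Longrightarrow> f x = 0"
  shows "\<exists>c N. 0 < c \<and> 1 \<le> N \<and> (L \<longrightarrow> N = 1) \<and> (\<forall>x\<in>K. c * f x ^ N \<le> g x)"
proof -
  \<comment> \<open>A non-empty section of \<open>E\<close> at \<open>t\<close> consists of all
    numbers from the minimum of \<open>g\<close> over \<open>{x\<in>K. t \<le> f x}\<close> upwards.
    Compactness provides the minimum, and the hypothesis \<open>zero\<close> makes it positive for
    \<open>t > 0\<close>.\<close>
  define E where "E z \<longleftrightarrow> (\<exists>x. x \<in> K \<and> \<not> f x < fst z \<and> g x \<le> snd z)" for z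
  have "definable L E"
    unfolding E_def
  proof (intro definable_ex definable_conj definable_not)
    show "definable L (\<lambda>z::(real \<times> real) \<times> 'e. snd z \<in> K)"
      by (rule definable_compose_linear[OF K(2)]) (rule linear_snd)
    show "definable L (\<lambda>z::(real \<times> real) \<times> 'e. f (snd z) < fst (fst z))"
      using definable_compose_linear[OF f(2), of "\<lambda>z::(real \<times> real) \<times> 'e. (snd z, fst (fst z))"]
      by (simp add: linear_iff)
    show "definable L (\<lambda>z::(real \<times> real) \<times> 'e. g (snd z) \<le> snd (fst z))"
      using definable_compose_linear[OF g(2), of "\<lambda>z::(real \<times> real) \<times> 'e. (snd z, snd (fst z))"]
      by (simp add: linear_iff)
  qed
  then obtain c N \<epsilon> where c: "0 < c" "1 \<le> N" "L \<longrightarrow> N = 1" "0 < \<epsilon>"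
    "\<And>t y. 0 < t \<Longrightarrow> t < \<epsilon> \<Longrightarrow> 0 < y \<Longrightarrow> E (t, y) \<Longrightarrow> (\<And>s. 0 < s \<Longrightarrow> s < y \<Longrightarrow> \<not> E (t, s)) \<Longrightarrow> c * t ^ N \<le> y"
    using definable_section_growth by metis
  have attained: "\<exists>x\<in>K. t \<le> f x \<and> 0 < g x \<and> (\<forall>x'\<in>K. t \<le> f x' \<longrightarrow> g x \<le> g x')"
    if t: "0 < t" and ne: "x0 \<in> K" "t \<le> f x0" for t x0
  proof -
    have "closed {x\<in>K. t \<le> f x}"
      using continuous_closed_preimage[OF f(1) compact_imp_closed[OF K(1)] closed_atLeast[of t]]
      by (simp add: vimage_def Int_def)
    with K(1) have "compact (K \<inter> {x\<in>K. t \<le> f x})" by (rule compact_Int_closed)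
    moreover have "K \<inter> {x\<in>K. t \<le> f x} = {x\<in>K. t \<le> f x}" by auto
    ultimately have "compact {x\<in>K. t \<le> f x}" by simp
    moreover have "continuous_on {x\<in>K. t \<le> f x} g" by (rule continuous_on_subset[OF g(1)]) auto
    ultimately obtain x where x: "x \<in> K" "t \<le> f x" "\<And>x'. x' \<in> K \<Longrightarrow> t \<le> f x' \<Longrightarrow> g x \<le> g x'"
      using continuous_attains_inf[of "{x\<in>K. t \<le> f x}" g] ne by blast
    have "g x \<noteq> 0" using zero[OF x(1)] x(2) t by auto
    then have "0 < g x" using g(3)[OF x(1)] by simp
    then show ?thesis using x by blast
  qed
  have small: "c * f x ^ N \<le> g x" if x: "x \<in> K" "0 < f x" "f x < \<epsilon>" for x
  proof -
    obtain x' where x': "x' \<in> K" "f x \<le> f x'" "0 < g x'" "\<And>u. u \<in> K \<Longrightarrow> f x \<le> f u \<Longrightarrow> g x' \<le> g u"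
      using attained[OF x(2,1)] by blast
    have "c * f x ^ N \<le> g x'"
    proof (rule c(5)[OF x(2,3) x'(3)])
      show "E (f x, g x')" using x'(1,2) by (auto simp: E_def)
      show "\<not> E (f x, s)" if "s < g x'" for s
        using that x'(4) by (force simp: E_def not_less)
    qed
    then show ?thesis using x'(4)[OF x(1)] by simp
  qed
  show ?thesis
  proof (cases "\<exists>x0\<in>K. \<epsilon> \<le> f x0")
    case False
    have "c * f x ^ N \<le> g x" if "x \<in> K" for x
      using small[OF that] f(3)[OF that] g(3)[OF that] False that c(2)
      by (cases "f x = 0") (auto simp: power_0_left)
    then show ?thesis using c by blast
  next
    case True
    then obtain x0 where x0: "x0 \<in> K" "\<epsilon> \<le> f x0" by blast
    obtain x1 where x1: "x1 \<in> K" "0 < g x1" "\<And>u. u \<in> K \<Longrightarrow> \<epsilon> \<le> f u \<Longrightarrow> g x1 \<le> g u"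
      using attained[OF c(4) x0] by blast
    obtain x2 where x2: "x2 \<in> K" "\<And>u. u \<in> K \<Longrightarrow> f u \<le> f x2"
      using continuous_attains_sup[OF K(1) _ f(1)] x0(1) by blast
    have M: "0 < f x2" using x2(2)[OF x0(1)] x0(2) c(4) by linarith
    \<comment> \<open>Where \<open>f\<close> is at least \<open>\<epsilon>\<close>, \<open>g\<close>
      is at least \<open>g x1 > 0\<close> and \<open>f\<close> at most \<open>f x2\<close>, so
      shrinking the constant covers this part.\<close>
    define c' where "c' = min c (g x1 / f x2 ^ N)"
    have c': "0 < c'" using c(1) x1(2) M by (simp add: c'_def)
    have "c' * f x ^ N \<le> g x" if x: "x \<in> K" for x
    proof -
      consider "f x = 0" | "0 < f x" "f x < \<epsilon>" | "\<epsilon> \<le> f x" using f(3)[OF x] by linarith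
      then show ?thesis
      proof cases
        case 1
        then show ?thesis using g(3)[OF x] c(2) by (simp add: power_0_left)
      next
        case 2
        have "c' * f x ^ N \<le> c * f x ^ N" using 2 by (intro mult_right_mono) (auto simp: c'_def)
        then show ?thesis using small[OF x 2] by linarith
      next
        case 3
        have "c' * f x ^ N \<le> g x1 / f x2 ^ N * f x2 ^ N"
          using x2(2)[OF x] f(3)[OF x] x1(2) M by (intro mult_mono power_mono) (auto simp: c'_def)
        also have "\<dots> = g x1" using M by simp
        also have "\<dots> \<le> g x" by (rule x1(3)[OF x 3])
        finally show ?thesis .
      qed
    qed
    then show ?thesis using c c' by blast
  qed
qed

section \<open>Projections onto definable convex sets\<close>

lemma tame_inner:
  assumes "linear p"
  shows "tame L (\<lambda>x. p x \<bullet> b)"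
  using linear_compose[OF assms bounded_linear.linear[OF bounded_linear_inner_left[of b]]]
  by (intro tame_linear) (simp add: o_def)

lemma definable_infnorm_less:
  fixes p :: "'a::euclidean_space \<Rightarrow> 'b::euclidean_space"
  assumes "linear p" "linear q"
  shows "definable L (\<lambda>x. infnorm (p x) < q x)"
proof -
  have "infnorm (p x) < q x \<longleftrightarrow> (\<forall>b\<in>Basis. p x \<bullet> b < q x \<and> 0 < p x \<bullet> b + q x)" for x
    by (auto simp: infnorm_Max abs_less_iff)
  then show ?thesis
    using assms by (simp add: definable_ball definable_conj definable_less tame_inner tame_linear
        tame_add tame_const)
qed

lemma definable_infnorm_le:
  fixes p :: "'a::euclidean_space \<Rightarrow> 'b::euclidean_space"
  assumes "linear p" "tame L q"
  shows "definable L (\<lambda>x. infnorm (p x) \<le> q x)"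
proof -
  have "infnorm (p x) \<le> q x \<longleftrightarrow> (\<forall>b\<in>Basis. p x \<bullet> b \<le> q x \<and> 0 \<le> p x \<bullet> b + q x)" for x
    by (auto simp: infnorm_Max abs_le_iff)
  then show ?thesis
    using assms by (simp add: definable_ball definable_conj definable_le tame_inner
        tame_add tame_const)
qed

text \<open>Distances are measured in the maximum norm because it is semilinear.\<close>
definition infnorm_dist :: "'a::euclidean_space set \<Rightarrow> 'a \<Rightarrow> real"
  where "infnorm_dist S x = (INF u\<in>S. infnorm (x - u))"

lemma infnorm_dist_bdd: "bdd_below ((\<lambda>u. infnorm (x - u)) ` S)"
  by (rule bdd_belowI2[of _ 0]) (rule infnorm_pos_le)

lemma infnorm_dist_nonneg: "S \<noteq> {} \<Longrightarrow> 0 \<le> infnorm_dist S x"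
  unfolding infnorm_dist_def by (rule cINF_greatest) (auto simp: infnorm_pos_le)

lemma infnorm_dist_less_iff:
  "S \<noteq> {} \<Longrightarrow> infnorm_dist S x < t \<longleftrightarrow> (\<exists>u\<in>S. infnorm (x - u) < t)"
  unfolding infnorm_dist_def by (rule cINF_less_iff[OF _ infnorm_dist_bdd])

lemma infnorm_dist_le_infdist:
  assumes "S \<noteq> {}"
  shows "infnorm_dist S x \<le> infdist x S"
  unfolding infdist_notempty[OF assms]
proof (rule cINF_greatest[OF assms])
  fix u assume "u \<in> S"
  then have "infnorm_dist S x \<le> infnorm (x - u)"
    unfolding infnorm_dist_def by (rule cINF_lower[OF infnorm_dist_bdd])
  then show "infnorm_dist S x \<le> dist x u" using infnorm_le_norm[of "x - u"] by (simp add: dist_norm)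
qed

lemma infdist_le_infnorm_dist:
  fixes S :: "'a::euclidean_space set"
  assumes "S \<noteq> {}"
  shows "infdist x S \<le> sqrt DIM('a) * infnorm_dist S x"
proof -
  have "infdist x S / sqrt DIM('a) \<le> infnorm_dist S x"
    unfolding infnorm_dist_def
  proof (rule cINF_greatest[OF assms])
    fix u assume "u \<in> S"
    then have "infdist x S \<le> norm (x - u)" by (metis infdist_le dist_norm)
    also have "\<dots> \<le> sqrt DIM('a) * infnorm (x - u)" by (rule norm_le_infnorm)
    finally show "infdist x S / sqrt DIM('a) \<le> infnorm (x - u)" by (simp add: field_simps)
  qed
  then show ?thesis by (simp add: field_simps)
qed

lemma continuous_on_infnorm_dist:
  fixes S :: "'a::euclidean_space set"
  assumes "S \<noteq> {}"
  shows "continuous_on A (infnorm_dist S)"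
proof -
  have *: "infnorm_dist S x - norm (x - y) \<le> infnorm_dist S y" for x y
    unfolding infnorm_dist_def[of S y]
  proof (rule cINF_greatest[OF assms])
    fix u assume "u \<in> S"
    then have "infnorm_dist S x \<le> infnorm (x - u)"
      unfolding infnorm_dist_def by (rule cINF_lower[OF infnorm_dist_bdd])
    also have "\<dots> \<le> infnorm (x - y) + infnorm (y - u)"
      using infnorm_triangle[of "x - y" "y - u"] by simp
    finally show "infnorm_dist S x - norm (x - y) \<le> infnorm (y - u)"
      using infnorm_le_norm[of "x - y"] by linarith
  qed
  have "1-lipschitz_on A (infnorm_dist S)"
  proof (rule lipschitz_onI)
    show "dist (infnorm_dist S x) (infnorm_dist S y) \<le> 1 * dist x y" for x y
      using *[of x y] *[of y x] by (simp add: dist_real_def dist_norm abs_le_iff norm_minus_commute)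
  qed simp
  then show ?thesis by (rule lipschitz_on_continuous_on)
qed

lemma definable_infnorm_dist_less:
  fixes S :: "'a::euclidean_space set"
  assumes "S \<noteq> {}" "definable L (\<lambda>x. x \<in> S)"
  shows "definable L (\<lambda>z. infnorm_dist S (fst z) < snd z)"
proof -
  have "definable L (\<lambda>z::'a \<times> real. \<exists>u. u \<in> S \<and> infnorm (fst z - u) < snd z)"
  proof (intro definable_ex definable_conj)
    show "definable L (\<lambda>z::('a \<times> real) \<times> 'a. snd z \<in> S)"
      by (rule definable_compose_linear[OF assms(2) linear_snd])
    show "definable L (\<lambda>z::('a \<times> real) \<times> 'a. infnorm (fst (fst z) - snd z) < snd (fst z))"
      by (rule definable_infnorm_less) (auto simp: linear_iff algebra_simps)
  qed
  then show ?thesis by (simp add: infnorm_dist_less_iff[OF assms(1)] Bex_def)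
qed

text \<open>Distances come out definable in strict form; one more quantifier yields the form that
  the error bound demands of the functions \<open>g j\<close>.\<close>

lemma definable_le_of_less:
  fixes f :: "'a::euclidean_space \<Rightarrow> real"
  assumes "definable L (\<lambda>z. f (fst z) < snd z)"
  shows "definable L (\<lambda>z. f (fst z) \<le> snd z)"
proof -
  have "definable L (\<lambda>z::'a \<times> real. \<forall>s. snd z < s \<longrightarrow> f (fst z) < s)"
  proof (intro definable_all definable_imp)
    show "definable L (\<lambda>z::('a \<times> real) \<times> real. snd (fst z) < snd z)"
      by (intro definable_less tame_linear) (auto simp: linear_iff)
    show "definable L (\<lambda>z::('a \<times> real) \<times> real. f (fst (fst z)) < snd z)"
      using definable_compose_linear[OF assms, of "\<lambda>z::('a \<times> real) \<times> real. (fst (fst z), snd z)"]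
      by (simp add: linear_iff)
  qed
  moreover have "f x \<le> t \<longleftrightarrow> (\<forall>s. t < s \<longrightarrow> f x < s)" for x t
    by (meson dual_order.strict_trans1 less_irrefl not_le)
  ultimately show ?thesis by simp
qed

section \<open>Error bounds on bounded sets\<close>

lemma continuous_on_Max_image:
  fixes g :: "'i \<Rightarrow> 'a::topological_space \<Rightarrow> real"
  assumes "finite J" "J \<noteq> {}" "\<And>j. j \<in> J \<Longrightarrow> continuous_on A (g j)"
  shows "continuous_on A (\<lambda>x. Max ((\<lambda>j. g j x) ` J))"
  using assms
  by (induction J rule: finite_ne_induct) (auto intro: continuous_on_max)

text \<open>Serves three times: the \<open>g j\<close> are the residual of one operator, the
  residuals of all operators, or the distances to their fixed point sets.\<close>

theorem definable_error_bound:
  fixes S :: "'a::euclidean_space set" and g :: "'i \<Rightarrow> 'a \<Rightarrow> real"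
  assumes S: "S \<noteq> {}" "definable L (\<lambda>x. x \<in> S)" and J: "finite J" "J \<noteq> {}"
    and g: "\<And>j. j \<in> J \<Longrightarrow> continuous_on UNIV (g j)"
      "\<And>j. j \<in> J \<Longrightarrow> definable L (\<lambda>z. g j (fst z) \<le> snd z)" "\<And>j x. j \<in> J \<Longrightarrow> 0 \<le> g j x"
    and zero: "\<And>x. (\<And>j. j \<in> J \<Longrightarrow> g j x = 0) \<Longrightarrow> x \<in> S"
    and K: "bounded K"
  shows "\<exists>c N. 0 < c \<and> 1 \<le> N \<and> (L \<longrightarrow> N = 1) \<and>
    (\<forall>x\<in>K. c * infdist x S ^ N \<le> Max ((\<lambda>j. g j x) ` J))"
proof -
  obtain r where r: "\<And>x. x \<in> K \<Longrightarrow> norm x \<le> r" using K bounded_iff by blast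
  \<comment> \<open>A cube and not a Euclidean ball: it is compact, contains \<open>K\<close>, and
    is semilinear.\<close>
  define B where "B = {x::'a. infnorm x \<le> r}"
  have KB: "K \<subseteq> B" using r infnorm_le_norm by (force simp: B_def intro: order_trans)
  have "closed B" unfolding B_def by (intro closed_Collect_le continuous_intros)
  moreover have "bounded B"
    unfolding bounded_iff
  proof (intro exI ballI)
    fix x assume "x \<in> B"
    then have "sqrt DIM('a) * infnorm x \<le> sqrt DIM('a) * r"
      by (intro mult_left_mono) (auto simp: B_def)
    then show "norm x \<le> sqrt DIM('a) * r" using norm_le_infnorm[of x] by linarith
  qed
  ultimately have "compact B" by (simp add: compact_eq_bounded_closed)
  have "\<exists>c N. 0 < c \<and> 1 \<le> N \<and> (L \<longrightarrow> N = 1) \<and>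
    (\<forall>x\<in>B. c * infnorm_dist S x ^ N \<le> Max ((\<lambda>j. g j x) ` J))"
  proof (rule lojasiewicz_inequality[OF \<open>compact B\<close>])
    show "definable L (\<lambda>x. x \<in> B)"
      unfolding B_def mem_Collect_eq by (intro definable_infnorm_le tame_const linear_id[unfolded id_def])
    show "definable L (\<lambda>z. infnorm_dist S (fst z) < snd z)"
      by (rule definable_infnorm_dist_less[OF S])
    show "continuous_on B (infnorm_dist S)" by (rule continuous_on_infnorm_dist[OF S(1)])
    show "0 \<le> infnorm_dist S x" for x by (rule infnorm_dist_nonneg[OF S(1)])
    show "continuous_on B (\<lambda>x. Max ((\<lambda>j. g j x) ` J))"
      by (rule continuous_on_Max_image[OF J]) (use g(1) continuous_on_subset in blast)
    show "definable L (\<lambda>z. Max ((\<lambda>j. g j (fst z)) ` J) \<le> snd z)"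
      using J by (simp add: definable_ball g(2))
    show "0 \<le> Max ((\<lambda>j. g j x) ` J)" for x
      using J g(3) by (auto simp: Max_ge_iff)
    show "infnorm_dist S x = 0" if "Max ((\<lambda>j. g j x) ` J) = 0" for x
    proof -
      have "g j x \<le> 0" if "j \<in> J" for j
        using Max_ge[of "(\<lambda>j. g j x) ` J" "g j x"] \<open>Max _ = 0\<close> J that by auto
      then have "x \<in> S" using zero g(3) by (metis order_antisym)
      then have "infdist x S = 0" by simp
      then show ?thesis using infnorm_dist_le_infdist[OF S(1), of x] infnorm_dist_nonneg[OF S(1), of x] by simp
    qed
  qed
  then obtain c N where c: "0 < c" "1 \<le> N" "L \<longrightarrow> N = 1"
    "\<And>x. x \<in> B \<Longrightarrow> c * infnorm_dist S x ^ N \<le> Max ((\<lambda>j. g j x) ` J)" by blast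
  let ?d = "sqrt DIM('a)"
  \<comment> \<open>The factor \<open>?d ^ N\<close> pays for the return from the maximum norm to
    the Euclidean distance.\<close>
  have "c / ?d ^ N * infdist x S ^ N \<le> Max ((\<lambda>j. g j x) ` J)" if "x \<in> K" for x
  proof -
    have "infdist x S ^ N \<le> (?d * infnorm_dist S x) ^ N"
      by (intro power_mono infdist_le_infnorm_dist[OF S(1)] infdist_nonneg)
    then have "c / ?d ^ N * infdist x S ^ N \<le> c / ?d ^ N * (?d * infnorm_dist S x) ^ N"
      using c(1) by (intro mult_left_mono) auto
    also have "\<dots> = c * infnorm_dist S x ^ N" by (simp add: power_mult_distrib)
    also have "\<dots> \<le> Max ((\<lambda>j. g j x) ` J)" using c(4) that KB by blast
    finally show ?thesis .
  qed
  moreover have "0 < c / ?d ^ N" using c(1) by simp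
  ultimately show ?thesis using c(2,3) by blast
qed

section \<open>Definability of the graph of a projection\<close>

lemma closest_point_iff:
  fixes C :: "'a::euclidean_space set"
  assumes "closed C" "convex C" "C \<noteq> {}"
  shows "y = closest_point C x \<longleftrightarrow> y \<in> C \<and> (\<forall>u\<in>C. (x - y) \<bullet> (u - y) \<le> 0)"
proof
  assume "y = closest_point C x"
  then show "y \<in> C \<and> (\<forall>u\<in>C. (x - y) \<bullet> (u - y) \<le> 0)"
    using closest_point_in_set[OF assms(1,3)] closest_point_dot[OF assms(2,1)] by simp
next
  assume y: "y \<in> C \<and> (\<forall>u\<in>C. (x - y) \<bullet> (u - y) \<le> 0)"
  show "y = closest_point C x"
  proof (rule closest_point_unique[OF assms(2,1)], use y in blast, intro ballI)
    fix u assume u: "u \<in> C"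
    have "(x - u) \<bullet> (x - u) = (x - y) \<bullet> (x - y) - 2 * ((x - y) \<bullet> (u - y)) + (u - y) \<bullet> (u - y)"
      by (simp add: algebra_simps inner_commute)
    moreover have "(x - y) \<bullet> (u - y) \<le> 0" using y u by blast
    ultimately have "(x - y) \<bullet> (x - y) \<le> (x - u) \<bullet> (x - u)"
      using inner_ge_zero[of "u - y"] by linarith
    then show "dist x y \<le> dist x u" by (simp add: dist_norm norm_le)
  qed
qed

text \<open>The variational inequality replaces the minimality of a norm by one quantifier over
  \<open>u\<close>. Its inner product is quadratic in the variables, so this formula serves only the
  theory without the flag.\<close>

lemma definable_closest_point_polynomial:
  fixes C :: "'a::euclidean_space set"
  assumes C: "closed C" "convex C" "C \<noteq> {}" "definable False (\<lambda>x. x \<in> C)"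
  shows "definable False (\<lambda>z. snd z = closest_point C (fst z))"
proof -
  have "definable False (\<lambda>z::'a \<times> 'a. \<forall>u. snd z \<in> C \<and> (u \<in> C \<longrightarrow> (fst z - snd z) \<bullet> (u - snd z) \<le> 0))"
  proof (intro definable_all definable_conj definable_imp)
    show "definable False (\<lambda>z::('a \<times> 'a) \<times> 'a. snd (fst z) \<in> C)"
      by (rule definable_compose_linear[OF C(4)]) (simp add: linear_iff)
    show "definable False (\<lambda>z::('a \<times> 'a) \<times> 'a. snd z \<in> C)"
      by (rule definable_compose_linear[OF C(4)]) (simp add: linear_iff)
    have "tame False (\<lambda>z::('a \<times> 'a) \<times> 'a. (fst (fst z) - snd (fst z)) \<bullet> (snd z - snd (fst z)))"
    proof (subst euclidean_inner, intro tame_sum finite_Basis)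
      fix b :: 'a
      have "tame False (\<lambda>z::('a \<times> 'a) \<times> 'a. (fst (fst z) - snd (fst z)) \<bullet> b)"
        "tame False (\<lambda>z::('a \<times> 'a) \<times> 'a. (snd z - snd (fst z)) \<bullet> b)"
        by (intro tame_inner; simp add: linear_iff algebra_simps)+
      then show "tame False (\<lambda>z::('a \<times> 'a) \<times> 'a. ((fst (fst z) - snd (fst z)) \<bullet> b) * ((snd z - snd (fst z)) \<bullet> b))"
        by (simp add: tame_def real_polynomial_function.intros(4))
    qed
    then show "definable False (\<lambda>z::('a \<times> 'a) \<times> 'a. (fst (fst z) - snd (fst z)) \<bullet> (snd z - snd (fst z)) \<le> 0)"
      by (intro definable_le tame_const)
  qed
  then show ?thesis by (simp add: closest_point_iff[OF C(1-3)] Ball_def)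
qed

text \<open>An affine function that vanishes at both points changes by the same amount
  \<open>s * (a \<bullet> d)\<close> at both; every other one keeps its sign for small
  \<open>s\<close>.\<close>

lemma same_signs_locally:
  fixes d :: "'a::euclidean_space"
  assumes F: "finite F" "\<And>f. f \<in> F \<Longrightarrow> tame True f" and y: "same_signs F y y0"
  shows "eventually (\<lambda>s. same_signs F (y + s *\<^sub>R d) (y0 + s *\<^sub>R d)) (at_right 0)"
proof -
  have "eventually (\<lambda>s. sgn (f (y + s *\<^sub>R d)) = sgn (f (y0 + s *\<^sub>R d))) (at_right 0)"
    if f: "f \<in> F" for f
  proof -
    obtain a c where "f = (\<lambda>x. a \<bullet> x + c)" using F(2)[OF f] unfolding tame_True_iff by blast
    then have line: "f (x + s *\<^sub>R d) = f x + s * (a \<bullet> d)" for x s by (simp add: inner_add_right)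
    have sgn: "sgn (f y) = sgn (f y0)" using y f by (simp add: same_signs_def)
    have lim: "((\<lambda>s. f (x + s *\<^sub>R d)) \<longlongrightarrow> f x) (at_right 0)" for x
      unfolding line by (rule tendsto_eq_intros refl | simp)+
    consider "f y = 0" "f y0 = 0" | "0 < f y" "0 < f y0" | "f y < 0" "f y0 < 0"
      using same_sgn_iff[OF sgn] by linarith
    then show ?thesis
    proof cases
      case 1
      then show ?thesis by (simp add: line)
    next
      case 2
      show ?thesis
        using order_tendstoD(1)[OF lim 2(1)] order_tendstoD(1)[OF lim 2(2)]
        by eventually_elim simp
    next
      case 3
      show ?thesis
        using order_tendstoD(2)[OF lim 3(1)] order_tendstoD(2)[OF lim 3(2)]
        by eventually_elim simp
    qed
  qed
  then show ?thesis using F(1) unfolding same_signs_def by (simp add: eventually_ball_finite)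
qed

lemma finite_sign_vectors:
  assumes "finite F"
  shows "finite (range (\<lambda>x. restrict (\<lambda>f. sgn (f x :: real)) F))"
proof (rule finite_subset)
  show "range (\<lambda>x. restrict (\<lambda>f. sgn (f x)) F) \<subseteq> F \<rightarrow>\<^sub>E {-1, 0, 1}"
    by (auto simp: sgn_if split: if_splits)
  show "finite (F \<rightarrow>\<^sub>E {-1, 0, 1::real})" using assms by (simp add: finite_PiE)
qed

lemma same_signs_iff_restrict:
  "same_signs F x y \<longleftrightarrow> restrict (\<lambda>f. sgn (f x)) F = restrict (\<lambda>f. sgn (f y)) F"
  by (auto simp: same_signs_def restrict_def fun_eq_iff)

lemma finite_sign_classes:
  assumes "finite F"
  shows "\<exists>Y\<subseteq>C. finite Y \<and> (\<forall>y\<in>C. \<exists>y0\<in>Y. same_signs F y y0)"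
proof -
  define sg where "sg = (\<lambda>x. restrict (\<lambda>f. sgn (f x :: real)) F)"
  have "finite (sg ` C)"
    using finite_sign_vectors[OF assms] by (rule finite_subset[rotated]) (auto simp: sg_def)
  moreover have "\<exists>Y\<subseteq>C. inj_on sg Y \<and> sg ` C = sg ` Y"
    using subset_image_inj[of "sg ` C" sg C] by blast
  then obtain Y where "Y \<subseteq> C" "sg ` Y = sg ` C" "inj_on sg Y" by metis
  ultimately have "finite Y" by (metis finite_imageD)
  moreover have "\<exists>y0\<in>Y. same_signs F y y0" if "y \<in> C" for y
    using \<open>sg ` Y = sg ` C\<close> that unfolding same_signs_iff_restrict sg_def[symmetric]
    by (metis imageE imageI sg_def)
  ultimately show ?thesis using \<open>Y \<subseteq> C\<close> by blast
qed

text \<open>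
  Two points with the same signs have the same minimal face, since the segment between them
  can be prolonged a little inside the set.
\<close>
lemma polyhedron_of_definable:
  fixes S :: "'a::euclidean_space set"
  assumes S: "closed S" "convex S" "definable True (\<lambda>x. x \<in> S)"
  shows "polyhedron S"
proof -
  obtain F where F: "finite F" "\<And>f. f \<in> F \<Longrightarrow> tame True f"
    "\<And>x y. same_signs F x y \<Longrightarrow> (x \<in> S) = (y \<in> S)"
    using S(3) unfolding definable_def by metis
  define \<F> where "\<F> = {G. G face_of S \<and> G \<noteq> {}}"
  have "\<exists>y. y \<in> rel_interior G" if "G \<in> \<F>" for G
    using that face_of_imp_convex rel_interior_eq_empty by (fastforce simp: \<F>_def)
  then obtain p where p: "\<And>G. G \<in> \<F> \<Longrightarrow> p G \<in> rel_interior G" by metis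
  have sub: "G \<subseteq> H" if G: "G \<in> \<F>" and H: "H \<in> \<F>" and eq: "same_signs F (p G) (p H)" for G H
  proof -
    have face: "H face_of S" "G \<subseteq> S" using G H face_of_imp_subset by (auto simp: \<F>_def)
    have "p G \<in> H"
    proof (cases "p G = p H")
      case True
      then show ?thesis using p[OF H] rel_interior_subset by auto
    next
      case False
      have pS: "p G \<in> S" "p H \<in> S" "p H \<in> H"
        using p[OF G] p[OF H] rel_interior_subset[of G] rel_interior_subset[of H]
          face_of_imp_subset[of G S] face_of_imp_subset[of H S] G H by (auto simp: \<F>_def)
      \<comment> \<open>A function of \<open>F\<close> that vanishes at \<open>p H\<close> also
        vanishes at \<open>p G\<close>, hence on the whole line through them; the others keep their
        signs near \<open>p H\<close>.\<close>
      define d where "d = p H - p G"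
      have "eventually (\<lambda>s. same_signs F (p H + s *\<^sub>R d) (p H)) (at_right 0)"
      proof -
        have "eventually (\<lambda>s. sgn (f (p H + s *\<^sub>R d)) = sgn (f (p H))) (at_right 0)" if f: "f \<in> F" for f
        proof -
          obtain a c where fac: "f = (\<lambda>x. a \<bullet> x + c)" using F(2)[OF f] unfolding tame_True_iff by blast
          then have line: "f (p H + s *\<^sub>R d) = f (p H) + s * (a \<bullet> d)" for s by (simp add: inner_add_right)
          have "a \<bullet> d = f (p H) - f (p G)" using fac by (simp add: d_def inner_diff_right)
          moreover have "sgn (f (p G)) = sgn (f (p H))" using eq f by (simp add: same_signs_def)
          ultimately have zero: "a \<bullet> d = 0" if "f (p H) = 0"
            using that by (simp add: sgn_zero_iff)
          have lim: "((\<lambda>s. f (p H + s *\<^sub>R d)) \<longlongrightarrow> f (p H)) (at_right 0)"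
            unfolding line by (rule tendsto_eq_intros refl | simp)+
          consider "f (p H) = 0" | "0 < f (p H)" | "f (p H) < 0" by linarith
          then show ?thesis
          proof cases
            case 1
            then show ?thesis using zero by (simp add: line)
          next
            case 2
            from order_tendstoD(1)[OF lim 2] show ?thesis by eventually_elim (use 2 in simp)
          next
            case 3
            from order_tendstoD(2)[OF lim 3] show ?thesis by eventually_elim (use 3 in simp)
          qed
        qed
        then show ?thesis using F(1) unfolding same_signs_def by (simp add: eventually_ball_finite)
      qed
      moreover have "eventually (\<lambda>s::real. 0 < s) (at_right 0)"
        by (simp add: eventually_at_right_less)
      ultimately have "eventually (\<lambda>s. same_signs F (p H + s *\<^sub>R d) (p H) \<and> 0 < s) (at_right 0)"
        by (rule eventually_conj)
      then obtain s where s: "same_signs F (p H + s *\<^sub>R d) (p H) \<and> 0 < s"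
        using eventually_happens'[OF trivial_limit_at_right_real] by blast
      then have q: "p H + s *\<^sub>R d \<in> S" using F(3) pS(2) by blast
      have "p H \<in> open_segment (p G) (p H + s *\<^sub>R d)"
      proof -
        have "p H = (1 - 1 / (1 + s)) *\<^sub>R p G + (1 / (1 + s)) *\<^sub>R (p H + s *\<^sub>R d)"
        proof -
          have "(1 / (1 + s)) *\<^sub>R (p H + s *\<^sub>R d) = p H - (s / (1 + s)) *\<^sub>R p G"
          proof -
            have "p H + s *\<^sub>R d = (1 + s) *\<^sub>R p H - s *\<^sub>R p G" by (simp add: d_def algebra_simps)
            then show ?thesis using s by (simp add: scaleR_diff_right)
          qed
          moreover have "1 - 1 / (1 + s) = s / (1 + s)" using s by (simp add: field_simps)
          ultimately show ?thesis by simp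
        qed
        moreover have "0 < 1 / (1 + s)" "1 / (1 + s) < 1" using s by auto
        moreover have "p G \<noteq> p H + s *\<^sub>R d"
        proof
          assume "p G = p H + s *\<^sub>R d"
          then have "(1 + s) *\<^sub>R d = 0" by (simp add: d_def algebra_simps)
          then show False using s False by (auto simp: d_def)
        qed
        ultimately show ?thesis unfolding in_segment by blast
      qed
      then show ?thesis
        using face_ofD[OF face(1), of "p H" "p G" "p H + s *\<^sub>R d"] pS q by blast
    qed
    \<comment> \<open>A face that meets the relative interior of a subset contains the subset, and
      \<open>p G\<close> is such a meeting point.\<close>
    then have "H \<inter> rel_interior G \<noteq> {}" using p[OF G] by blast
    with face show ?thesis by (rule subset_of_face_of)
  qed
  \<comment> \<open>Thus the non-empty faces inject into the finitely many sign vectors, and a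
    closed convex set with finitely many faces is a polyhedron.\<close>
  have "inj_on (\<lambda>G. restrict (\<lambda>f. sgn (f (p G))) F) \<F>"
  proof (rule inj_onI)
    fix G H assume "G \<in> \<F>" "H \<in> \<F>"
      and "restrict (\<lambda>f. sgn (f (p G))) F = restrict (\<lambda>f. sgn (f (p H))) F"
    then show "G = H"
      using sub[of G H] sub[of H G] same_signs_iff_restrict[of F "p G" "p H"]
        same_signs_sym[of F "p G" "p H"] by blast
  qed
  moreover have "finite ((\<lambda>G. restrict (\<lambda>f. sgn (f (p G))) F) ` \<F>)"
    using finite_sign_vectors[OF F(1)] by (rule finite_subset[rotated]) auto
  ultimately have "finite \<F>" by (rule finite_imageD[rotated])
  moreover have "{G. G face_of S} \<subseteq> insert {} \<F>" by (auto simp: \<F>_def)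
  ultimately show ?thesis using S(1,2) by (simp add: polyhedron_eq_finite_faces finite_subset)
qed

text \<open>
  The normal cone at \<open>y\<close> depends only on the sign class of \<open>y\<close>; at a representative \<open>y0\<close> it is
  cut out by the finitely many vertices of a polytope that agrees with the set near \<open>y0\<close>.
\<close>
lemma definable_closest_point_affine:
  fixes C :: "'a::euclidean_space set"
  assumes C: "closed C" "convex C" "C \<noteq> {}" "definable True (\<lambda>x. x \<in> C)"
  shows "definable True (\<lambda>z. snd z = closest_point C (fst z))"
proof -
  obtain F where F: "finite F" "\<And>f. f \<in> F \<Longrightarrow> tame True f"
    "\<And>x y. same_signs F x y \<Longrightarrow> (x \<in> C) = (y \<in> C)"
    using C(4) unfolding definable_def by metis
  obtain Y where Y: "Y \<subseteq> C" "finite Y" "\<And>y. y \<in> C \<Longrightarrow> \<exists>y0\<in>Y. same_signs F y y0"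
    using finite_sign_classes[OF F(1)] by metis
  define B where "B y0 = cbox (y0 - One) (y0 + One)" for y0 :: 'a
  have "\<exists>V. finite V \<and> C \<inter> B y0 = convex hull V" for y0
  proof -
    have "polytope (B y0)" unfolding B_def by (rule polytope_interval)
    then have "polytope (C \<inter> B y0)"
      using polyhedron_of_definable[OF C(1,2,4)] by (intro polyhedron_Int_polytope)
    then show ?thesis by (auto simp: polytope_def)
  qed
  then obtain V where V: "\<And>y0. finite (V y0)" "\<And>y0. C \<inter> B y0 = convex hull V y0" by metis
  have nearB: "eventually (\<lambda>s. y0 + s *\<^sub>R d \<in> B y0) (at_right 0)" for y0 d :: 'a
  proof -
    have "y0 \<in> box (y0 - One) (y0 + One)" by (simp add: mem_box inner_diff_left inner_add_left)
    moreover have "((\<lambda>s. y0 + s *\<^sub>R d) \<longlongrightarrow> y0) (at_right 0)"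
      by (rule tendsto_eq_intros refl | simp)+
    ultimately have "eventually (\<lambda>s. y0 + s *\<^sub>R d \<in> box (y0 - One) (y0 + One)) (at_right 0)"
      by (intro topological_tendstoD open_box)
    then show ?thesis
      by (rule eventually_mono) (auto simp: B_def mem_box less_imp_le)
  qed
  \<comment> \<open>A short displacement leads into \<open>C\<close> from \<open>y\<close> iff it
    does from \<open>y0\<close>, and shortening it by a factor \<open>s > 0\<close> does not affect
    the sign of its product with \<open>w\<close>.\<close>
  have normal: "(\<forall>u\<in>C. w \<bullet> (u - y) \<le> 0) \<longleftrightarrow> (\<forall>v\<in>V y0. w \<bullet> (v - y0) \<le> 0)"
    if y: "y \<in> C" and y0: "y0 \<in> C" and same: "same_signs F y y0" for w y y0
  proof -
    have into: "y + s *\<^sub>R (u - y) \<in> C" if "y \<in> C" "u \<in> C" "0 < s" "s < 1" for y u s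
    proof -
      have "(1 - s) *\<^sub>R y + s *\<^sub>R u \<in> C" using that by (intro convexD[OF C(2)]) auto
      then show ?thesis by (simp add: algebra_simps)
    qed
    have unit: "eventually (\<lambda>s::real. 0 < s \<and> s < 1) (at_right 0)"
      using eventually_at_right_real[of 0 1] by (auto elim: eventually_mono)
    show ?thesis
    proof
      assume L: "\<forall>u\<in>C. w \<bullet> (u - y) \<le> 0"
      show "\<forall>v\<in>V y0. w \<bullet> (v - y0) \<le> 0"
      proof
        fix v assume "v \<in> V y0"
        then have "v \<in> C" using V(2)[of y0] hull_subset[of "V y0" convex] by blast
        have "eventually (\<lambda>s. same_signs F (y + s *\<^sub>R (v - y0)) (y0 + s *\<^sub>R (v - y0)) \<and> 0 < s \<and> s < 1) (at_right 0)"
          by (rule eventually_conj[OF same_signs_locally[OF F(1,2) same] unit])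
        then obtain s where s: "same_signs F (y + s *\<^sub>R (v - y0)) (y0 + s *\<^sub>R (v - y0)) \<and> 0 < s \<and> s < 1"
          using eventually_happens'[OF trivial_limit_at_right_real] by blast
        then have "y + s *\<^sub>R (v - y0) \<in> C" using F(3) into[OF y0 \<open>v \<in> C\<close>] by blast
        then have "w \<bullet> (y + s *\<^sub>R (v - y0) - y) \<le> 0" using L by blast
        then show "w \<bullet> (v - y0) \<le> 0" using s by (simp add: mult_le_0_iff)
      qed
    next
      assume R: "\<forall>v\<in>V y0. w \<bullet> (v - y0) \<le> 0"
      have "convex hull V y0 \<subseteq> {v. w \<bullet> v \<le> w \<bullet> y0}"
        by (rule hull_minimal) (use R in \<open>auto simp: convex_halfspace_le inner_diff_right\<close>)
      then have hull: "w \<bullet> v \<le> w \<bullet> y0" if "v \<in> C" "v \<in> B y0" for v using V(2)[of y0] that by blast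
      show "\<forall>u\<in>C. w \<bullet> (u - y) \<le> 0"
      proof
        fix u assume "u \<in> C"
        have "eventually (\<lambda>s. same_signs F (y + s *\<^sub>R (u - y)) (y0 + s *\<^sub>R (u - y)) \<and>
            y0 + s *\<^sub>R (u - y) \<in> B y0 \<and> 0 < s \<and> s < 1) (at_right 0)"
          by (intro eventually_conj same_signs_locally[OF F(1,2) same] nearB unit)
        then obtain s where s: "same_signs F (y + s *\<^sub>R (u - y)) (y0 + s *\<^sub>R (u - y)) \<and>
            y0 + s *\<^sub>R (u - y) \<in> B y0 \<and> 0 < s \<and> s < 1"
          using eventually_happens'[OF trivial_limit_at_right_real] by blast
        then have "y0 + s *\<^sub>R (u - y) \<in> C" using F(3) into[OF y \<open>u \<in> C\<close>] by blast
        then have "w \<bullet> (y0 + s *\<^sub>R (u - y)) \<le> w \<bullet> y0" using hull s by blast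
        then show "w \<bullet> (u - y) \<le> 0" using s by (simp add: inner_add_right mult_le_0_iff)
      qed
    qed
  qed
  \<comment> \<open>All quantifiers are now finite, and in \<open>(x - y) \<bullet> (v - y0)\<close>
    the second factor is a constant, so the condition is affine in \<open>(x, y)\<close>.\<close>
  have graph: "y = closest_point C x \<longleftrightarrow>
      (\<exists>y0\<in>Y. same_signs F y y0 \<and> (\<forall>v\<in>V y0. (x - y) \<bullet> (v - y0) \<le> 0))" for x y
    unfolding closest_point_iff[OF C(1-3)]
  proof
    assume "y \<in> C \<and> (\<forall>u\<in>C. (x - y) \<bullet> (u - y) \<le> 0)"
    then show "\<exists>y0\<in>Y. same_signs F y y0 \<and> (\<forall>v\<in>V y0. (x - y) \<bullet> (v - y0) \<le> 0)"
      using Y(1,3) normal by (metis subsetD)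
  next
    assume "\<exists>y0\<in>Y. same_signs F y y0 \<and> (\<forall>v\<in>V y0. (x - y) \<bullet> (v - y0) \<le> 0)"
    then show "y \<in> C \<and> (\<forall>u\<in>C. (x - y) \<bullet> (u - y) \<le> 0)"
      using Y(1) F(3) normal by (metis subsetD)
  qed
  show ?thesis
    unfolding graph
  proof (intro definable_bex[OF Y(2)] definable_conj definable_ball[OF V(1)] definable_le tame_const)
    fix y0 v
    have "definable True (\<lambda>y. same_signs F y y0)"
      unfolding definable_def using F(1,2)
      by (intro exI[of _ F]) (auto simp: same_signs_def)
    then show "definable True (\<lambda>z::'a \<times> 'a. same_signs F (snd z) y0)"
      by (rule definable_compose_linear) (rule linear_snd)
    show "tame True (\<lambda>z::'a \<times> 'a. (fst z - snd z) \<bullet> (v - y0))"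
      by (rule tame_inner) (simp add: linear_iff algebra_simps)
  qed
qed

lemma definable_closest_point:
  fixes C :: "'a::euclidean_space set"
  assumes "closed C" "convex C" "C \<noteq> {}" "definable L (\<lambda>x. x \<in> C)"
  shows "definable L (\<lambda>z. snd z = closest_point C (fst z))"
  using assms definable_closest_point_affine definable_closest_point_polynomial
  by (cases L) simp_all

section \<open>Douglas--Rachford operators\<close>

lemma tame_polynomial_of_degree:
  fixes f :: "real ^ 'n \<Rightarrow> real"
  assumes "polynomial_of_degree d f"
  shows "tame (d = 1) f"
proof -
  obtain c where f: "f = (\<lambda>x. \<Sum>\<alpha>\<in>multi_indices d. c \<alpha> * (\<Prod>i\<in>UNIV. (x $ i) ^ \<alpha> i))"
    using assms by (auto simp: polynomial_of_degree_def)
  have coordinate: "tame L (\<lambda>x::real ^ 'n. x $ i)" for L i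
    by (intro tame_linear) (simp add: linear_iff)
  have "tame (d = 1) (\<lambda>x::real ^ 'n. \<Prod>i\<in>UNIV. (x $ i) ^ \<alpha> i)" if "\<alpha> \<in> multi_indices d" for \<alpha>
  proof (cases "d = 1")
    case False
    have "real_polynomial_function (\<lambda>x::real ^ 'n. \<Prod>i\<in>UNIV. (x $ i) ^ \<alpha> i)"
      using coordinate[of False]
      by (intro real_polynomial_function_prod real_polynomial_function_power) (auto simp: tame_def)
    then show ?thesis using False by (simp add: tame_def)
  next
    case True
    \<comment> \<open>Total degree at most 1 leaves only the constant monomial and the single
      coordinates.\<close>
    then have sum: "(\<Sum>i\<in>UNIV. \<alpha> i) \<le> 1" using that by (simp add: multi_indices_def)
    show ?thesis
    proof (cases "\<exists>k. \<alpha> k \<noteq> 0")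
      case False
      then show ?thesis by (simp add: tame_const)
    next
      case True
      then obtain k where k: "\<alpha> k \<noteq> 0" by blast
      have "\<alpha> k + (\<Sum>i\<in>UNIV - {k}. \<alpha> i) \<le> 1" using sum by (simp add: sum.remove[of UNIV k])
      then have "\<alpha> k = 1" "(\<Sum>i\<in>UNIV - {k}. \<alpha> i) = 0" using k by linarith+
      then have "\<alpha> k = 1" "\<And>i. i \<noteq> k \<Longrightarrow> \<alpha> i = 0" by simp_all
      then have "(x $ i) ^ \<alpha> i = (if i = k then x $ k else 1)" for x :: "real ^ 'n" and i by simp
      then show ?thesis by (simp add: coordinate)
    qed
  qed
  then show ?thesis unfolding f by (intro tame_sum finite_multi_indices tame_scale)
qed

lemma definable_semialgebraic:
  fixes S :: "(real ^ 'n) set"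
  assumes "semialgebraic_of_degree d S"
  shows "definable (d = 1) (\<lambda>x. x \<in> S)"
proof -
  obtain s l :: nat and f h where
    fh: "\<forall>i\<in>{1..l}. \<forall>j\<in>{1..s}. polynomial_of_degree d (f i j) \<and> polynomial_of_degree d (h i j)"
    and S: "S = (\<Inter>j\<in>{1..s}. \<Union>i\<in>{1..l}. {x. f i j x = 0 \<and> h i j x < 0})"
    using assms unfolding semialgebraic_of_degree_def by (elim exE conjE) (rule that)
  have "definable (d = 1) (\<lambda>x. \<forall>j\<in>{1..s}. \<exists>i\<in>{1..l}. f i j x = 0 \<and> h i j x < 0)"
  proof (rule definable_ball[OF finite_atLeastAtMost], rule definable_bex[OF finite_atLeastAtMost],
      rule definable_conj)
    fix i j assume "j \<in> {1..s}" "i \<in> {1..l}"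
    then have "tame (d = 1) (f i j)" "tame (d = 1) (h i j)"
      using fh by (blast intro: tame_polynomial_of_degree)+
    then show "definable (d = 1) (\<lambda>x. f i j x = 0)" "definable (d = 1) (\<lambda>x. h i j x < 0)"
      using definable_eq[OF _ tame_const] definable_less[OF _ tame_const] by blast+
  qed
  then show ?thesis by (simp add: S)
qed

section \<open>Firm nonexpansiveness and fixed point sets\<close>

lemma reflection_nonexpansive:
  assumes "closed A" "convex A" "A \<noteq> {}"
  shows "norm (reflection A x - reflection A y) \<le> norm (x - y)"
proof -
  let ?P = "closest_point A"
  have "(x - ?P x) \<bullet> (?P y - ?P x) \<le> 0" "(y - ?P y) \<bullet> (?P x - ?P y) \<le> 0"
    using closest_point_dot[OF assms(2,1)] closest_point_in_set[OF assms(1,3)] by blast+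
  \<comment> \<open>The sum of the two variational inequalities, each tested at the other
    projection. Its two sides are the terms with factor 4 in the expanded square.\<close>
  then have "(?P x - ?P y) \<bullet> (?P x - ?P y) \<le> (x - y) \<bullet> (?P x - ?P y)"
    by (simp add: algebra_simps inner_commute)
  moreover have "(reflection A x - reflection A y) \<bullet> (reflection A x - reflection A y)
    = 4 * ((?P x - ?P y) \<bullet> (?P x - ?P y)) - 4 * ((x - y) \<bullet> (?P x - ?P y)) + (x - y) \<bullet> (x - y)"
    by (simp add: reflection_def algebra_simps inner_commute)
  ultimately show ?thesis by (simp add: norm_le)
qed

lemma DR_eq:
  "DR C D x = x + (closest_point D (2 *\<^sub>R closest_point C x - x) - closest_point C x)"
  by (simp add: DR_def reflection_def scaleR_right_distrib scaleR_diff_right scaleR_2[symmetric] algebra_simps)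

lemma parallelogram_half:
  fixes a b :: "'a::real_inner"
  shows "(norm ((1/2) *\<^sub>R (a + b)))\<^sup>2 + (norm ((1/2) *\<^sub>R (a - b)))\<^sup>2 = ((norm a)\<^sup>2 + (norm b)\<^sup>2) / 2"
  unfolding power2_norm_eq_inner by (simp add: algebra_simps inner_commute)

text \<open>The operator averages the identity and a nonexpansive composition of reflections.
  Differences of values and of residuals are thus half the sum and half the difference of the same
  two vectors, and the parallelogram identity adds their squares.\<close>

lemma DR_firm_inequality:
  assumes C: "closed C" "convex C" "C \<noteq> {}" and D: "closed D" "convex D" "D \<noteq> {}"
  shows "(norm (DR C D x - DR C D y))\<^sup>2 + (norm ((x - DR C D x) - (y - DR C D y)))\<^sup>2 \<le> (norm (x - y))\<^sup>2"
proof -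
  let ?N = "\<lambda>x. reflection D (reflection C x)"
  have "norm (?N x - ?N y) \<le> norm (x - y)"
    using reflection_nonexpansive[OF C, of x y] reflection_nonexpansive[OF D, of "reflection C x" "reflection C y"]
    by linarith
  then have le: "(norm (?N x - ?N y))\<^sup>2 \<le> (norm (x - y))\<^sup>2" by (rule power_mono) simp
  have avg: "DR C D x - DR C D y = (1/2) *\<^sub>R ((x - y) + (?N x - ?N y))"
    by (simp add: DR_def algebra_simps)
  have res: "(x - DR C D x) - (y - DR C D y) = (1/2) *\<^sub>R ((x - y) - (?N x - ?N y))"
  proof -
    have half: "(1/2) *\<^sub>R v + (1/2) *\<^sub>R v = v" for v :: 'a by (simp add: scaleR_left_distrib[symmetric])
    have residual: "v - DR C D v = (1/2) *\<^sub>R (v - ?N v)" for v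
      using half[of v] by (simp add: DR_def scaleR_right_distrib scaleR_diff_right algebra_simps)
    show ?thesis unfolding residual by (simp add: algebra_simps)
  qed
  show ?thesis unfolding avg res parallelogram_half using le by simp
qed

definition firmly_nonexpansive :: "('a::real_inner \<Rightarrow> 'a) \<Rightarrow> bool"
  where "firmly_nonexpansive T \<longleftrightarrow>
    (\<forall>x y. (norm (T x - T y))\<^sup>2 + (norm ((x - T x) - (y - T y)))\<^sup>2 \<le> (norm (x - y))\<^sup>2)"

lemma firmly_nonexpansive_norm:
  assumes "firmly_nonexpansive T"
  shows "norm (T x - T y) \<le> norm (x - y)"
proof -
  have "(norm (T x - T y))\<^sup>2 + (norm ((x - T x) - (y - T y)))\<^sup>2 \<le> (norm (x - y))\<^sup>2"
    using assms by (simp add: firmly_nonexpansive_def)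
  then have "(norm (T x - T y))\<^sup>2 \<le> (norm (x - y))\<^sup>2"
    using zero_le_power2[of "norm ((x - T x) - (y - T y))"] by linarith
  then show ?thesis by (rule power2_le_imp_le) simp
qed

lemma firmly_nonexpansive_continuous:
  assumes "firmly_nonexpansive T"
  shows "continuous_on A T"
proof -
  have "1-lipschitz_on A T"
    by (rule lipschitz_onI) (use firmly_nonexpansive_norm[OF assms] in \<open>auto simp: dist_norm\<close>)
  then show ?thesis by (rule lipschitz_on_continuous_on)
qed

text \<open>A fixed point is never farther from \<open>T x\<close> than from \<open>x\<close>, and
  this comparison is a half-space condition on \<open>q\<close>. Conversely, the condition at
  \<open>x = q\<close> alone forces \<open>T q = q\<close>.\<close>

lemma Fix_closed_convex:
  fixes T :: "'a::real_inner \<Rightarrow> 'a"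
  assumes "firmly_nonexpansive T"
  shows "closed (Fix T)" "convex (Fix T)"
proof -
  have "norm (T x - q) \<le> norm (x - q) \<longleftrightarrow> (2 *\<^sub>R (x - T x)) \<bullet> q \<le> x \<bullet> x - T x \<bullet> T x" for x q
    by (simp add: norm_le algebra_simps inner_commute)
  moreover have "Fix T = (\<Inter>x. {q. norm (T x - q) \<le> norm (x - q)})"
  proof (intro equalityI subsetI)
    fix q assume "q \<in> Fix T"
    then show "q \<in> (\<Inter>x. {q. norm (T x - q) \<le> norm (x - q)})"
      using firmly_nonexpansive_norm[OF assms, of _ q] by (auto simp: Fix_def)
  next
    fix q assume "q \<in> (\<Inter>x. {q. norm (T x - q) \<le> norm (x - q)})"
    then have "norm (T q - q) \<le> norm (q - q)" by blast
    then show "q \<in> Fix T" by (simp add: Fix_def)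
  qed
  ultimately have eq: "Fix T = (\<Inter>x. {q. (2 *\<^sub>R (x - T x)) \<bullet> q \<le> x \<bullet> x - T x \<bullet> T x})" by simp
  show "closed (Fix T)" unfolding eq by (intro closed_INT ballI closed_halfspace_le)
  show "convex (Fix T)" unfolding eq by (intro convex_INT convex_halfspace_le)
qed

text \<open>The two projections become existentially quantified vectors tied to their graphs, and
  the residual is their difference \<open>y - w\<close>.\<close>

lemma definable_DR_residual:
  fixes C D :: "'a::euclidean_space set"
  assumes C: "closed C" "convex C" "C \<noteq> {}" "definable L (\<lambda>x. x \<in> C)"
    and D: "closed D" "convex D" "D \<noteq> {}" "definable L (\<lambda>x. x \<in> D)"
  shows "definable L (\<lambda>z. infnorm (fst z - DR C D (fst z)) \<le> snd z)"
proof -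
  have "definable L (\<lambda>z::'a \<times> real. \<exists>y. y = closest_point C (fst z) \<and>
      (\<exists>w. w = closest_point D (2 *\<^sub>R y - fst z) \<and> infnorm (y - w) \<le> snd z))"
  proof (intro definable_ex definable_conj)
    show "definable L (\<lambda>z::('a \<times> real) \<times> 'a. snd z = closest_point C (fst (fst z)))"
      using definable_compose_linear[OF definable_closest_point[OF C],
          of "\<lambda>z::('a \<times> real) \<times> 'a. (fst (fst z), snd z)"]
      by (simp add: linear_iff)
    show "definable L (\<lambda>z::(('a \<times> real) \<times> 'a) \<times> 'a.
        snd z = closest_point D (2 *\<^sub>R snd (fst z) - fst (fst (fst z))))"
      using definable_compose_linear[OF definable_closest_point[OF D],
          of "\<lambda>z::(('a \<times> real) \<times> 'a) \<times> 'a. (2 *\<^sub>R snd (fst z) - fst (fst (fst z)), snd z)"]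
      by (simp add: linear_iff algebra_simps)
    show "definable L (\<lambda>z::(('a \<times> real) \<times> 'a) \<times> 'a. infnorm (snd (fst z) - snd z) \<le> snd (fst (fst z)))"
      by (intro definable_infnorm_le tame_linear) (auto simp: linear_iff algebra_simps)
  qed
  then show ?thesis by (simp add: DR_eq)
qed

lemma definable_Fix:
  fixes T :: "'a::euclidean_space \<Rightarrow> 'a"
  assumes "definable L (\<lambda>z. infnorm (fst z - T (fst z)) \<le> snd z)"
  shows "definable L (\<lambda>x. x \<in> Fix T)"
proof -
  have "infnorm (x - T x) \<le> 0 \<longleftrightarrow> x \<in> Fix T" for x
    using infnorm_pos_lt[of "x - T x"] by (auto simp: Fix_def not_less[symmetric])
  then show ?thesis
    using definable_compose_linear[OF assms, of "\<lambda>x. (x, 0)"] by (simp add: linear_iff)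
qed

section \<open>From power inequalities to convergence rates\<close>

lemma le_root_of_power_le:
  fixes a y c :: real
  assumes "0 < c" "1 \<le> N" "0 \<le> a" "c * a ^ N \<le> y"
  shows "a \<le> (1 / c) powr (1 / real N) * y powr (1 / real N)"
proof (cases "a = 0")
  case False
  then have a: "0 < a" using assms(3) by simp
  have y: "0 \<le> y" using assms(1,3,4) by (meson mult_nonneg_nonneg less_imp_le order_trans zero_le_power)
  have "a = (a ^ N) powr (1 / real N)"
    using a assms(2) by (simp add: powr_realpow[symmetric] powr_powr)
  also have "\<dots> \<le> (1 / c * y) powr (1 / real N)"
    using assms a by (intro powr_mono2) (auto simp: field_simps)
  also have "\<dots> = (1 / c) powr (1 / real N) * y powr (1 / real N)"
    by (rule powr_mult)
  finally show ?thesis .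
qed simp

text \<open>The differences \<open>e s - e (s + p)\<close> telescope with stride \<open>p\<close>,
  so their sum is at most that of the first \<open>p\<close> values, each at most
  \<open>e 0\<close>. Since \<open>e\<close> decreases, each of the \<open>t\<close> summands is at
  least \<open>c * e t ^ N\<close>.\<close>

lemma cyclic_decrease_rate:
  fixes e :: "nat \<Rightarrow> real"
  assumes e: "\<And>t. 0 \<le> e t" "\<And>t. e (Suc t) \<le> e t" and c: "0 < c"
    and dec: "\<And>t. c * e t ^ N \<le> e t - e (t + p)"
  shows "real t * (c * e t ^ N) \<le> real p * e 0"
proof -
  have anti: "e s \<le> e t" if "t \<le> s" for s t
    using that e(2) by (rule lift_Suc_antimono_le[rotated])
  have telescope: "(\<Sum>s<t. e s - e (s + p)) + (\<Sum>i<p. e (t + i)) = (\<Sum>i<p. e i)" for t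
  proof (induction t)
    case (Suc t)
    have "(\<Sum>i<p. e (Suc t + i)) + e t = (\<Sum>i<Suc p. e (t + i))"
      by (simp add: sum.lessThan_Suc_shift del: sum.lessThan_Suc)
    then show ?case using Suc by simp
  qed simp
  have "real t * (c * e t ^ N) = (\<Sum>s<t. c * e t ^ N)" by simp
  also have "\<dots> \<le> (\<Sum>s<t. e s - e (s + p))"
  proof (rule sum_mono)
    fix s assume "s \<in> {..<t}"
    then have "c * e t ^ N \<le> c * e s ^ N"
      using c e(1) by (intro mult_left_mono power_mono anti) auto
    then show "c * e t ^ N \<le> e s - e (s + p)" using dec[of s] by linarith
  qed
  also have "\<dots> \<le> (\<Sum>i<p. e i)"
    using telescope[of t] sum_nonneg[of "{..<p}" "\<lambda>i. e (t + i)"] e(1) by simp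
  also have "\<dots> \<le> (\<Sum>i<p. e 0)" by (intro sum_mono anti) simp
  finally show ?thesis by simp
qed

text \<open>
  Over one cycle the squared distance to the common fixed point set drops by the sum of the
  squared step lengths, which in turn controls the residuals of all the operators.
\<close>
theorem cyclic_iteration_rate:
  fixes T :: "nat \<Rightarrow> 'a::euclidean_space \<Rightarrow> 'a" and x :: "nat \<Rightarrow> 'a"
  assumes J: "finite J" "J \<noteq> {}" and T: "\<And>j. j \<in> J \<Longrightarrow> firmly_nonexpansive (T j)"
    and ne: "(\<Inter>j\<in>J. Fix (T j)) \<noteq> {}"
    and step: "\<And>t. s t \<in> J" "\<And>t. x (Suc t) = T (s t) (x t)"
    and cyc: "\<And>t j. j \<in> J \<Longrightarrow> \<exists>i<p. s (t + i) = j"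
    and bound: "\<And>K. bounded K \<Longrightarrow> \<exists>c N. 0 < c \<and> 1 \<le> N \<and>
      (\<forall>x\<in>K. c * infdist x (\<Inter>j\<in>J. Fix (T j)) ^ N \<le> Max ((\<lambda>j. norm (x - T j x)) ` J))"
  shows "\<exists>\<rho>>0. \<exists>xbar\<in>(\<Inter>j\<in>J. Fix (T j)). x \<longlonglongrightarrow> xbar \<and>
    (\<exists>M. \<forall>t\<ge>1. norm (x t - xbar) \<le> M * real t powr (- \<rho>))"
proof -
  define S where "S = (\<Inter>j\<in>J. Fix (T j))"
  have S: "closed S" "S \<noteq> {}"
    unfolding S_def by (intro closed_INT ballI Fix_closed_convex(1) T, assumption) (rule ne)
  define D where "D t = infdist (x t) S" for t
  have D0: "0 \<le> D t" for t by (simp add: D_def infdist_nonneg)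
  have one: "(norm (x (Suc t) - q))\<^sup>2 + (norm (x t - x (Suc t)))\<^sup>2 \<le> (norm (x t - q))\<^sup>2"
    if "q \<in> S" for q t
  proof -
    have "T (s t) q = q" using that step(1)[of t] by (auto simp: S_def Fix_def)
    moreover have "(norm (T (s t) (x t) - T (s t) q))\<^sup>2 + (norm ((x t - T (s t) (x t)) - (q - T (s t) q)))\<^sup>2
        \<le> (norm (x t - q))\<^sup>2"
      using T[OF step(1)] by (simp add: firmly_nonexpansive_def)
    ultimately show ?thesis by (simp add: step(2))
  qed
  have window: "(norm (x (t + n) - q))\<^sup>2 + (\<Sum>i<n. (norm (x (t + i) - x (Suc (t + i))))\<^sup>2) \<le> (norm (x t - q))\<^sup>2"
    if "q \<in> S" for q t n
  proof (induction n)
    case (Suc n)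
    then show ?case using one[OF that, of "t + n"] by simp
  qed simp
  have fejer: "norm (x (t + n) - q) \<le> norm (x t - q)" if "q \<in> S" for q t n
  proof -
    have "0 \<le> (\<Sum>i<n. (norm (x (t + i) - x (Suc (t + i))))\<^sup>2)" by (intro sum_nonneg) simp
    then have "(norm (x (t + n) - q))\<^sup>2 \<le> (norm (x t - q))\<^sup>2" using window[OF that, of t n] by linarith
    then show ?thesis by (rule power2_le_imp_le) simp
  qed
  have proj: "\<exists>q\<in>S. D t = norm (x t - q)" for t
  proof -
    obtain q where "q \<in> S" "infdist (x t) S = dist (x t) q" by (rule infdist_attains_inf[OF S])
    then show ?thesis by (auto simp: D_def dist_norm)
  qed
  have D_le: "D t \<le> norm (x t - q)" if "q \<in> S" for q t
    using infdist_le[OF that, of "x t"] by (simp add: D_def dist_norm)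
  have p: "0 < p" using cyc[of _ 0] J(2) by force
  obtain q0 where q0: "q0 \<in> S" using S(2) by blast
  have "bounded (range x)"
  proof (rule boundedI)
    fix y assume "y \<in> range x"
    then obtain t where "y = x t" by blast
    then show "norm y \<le> norm (x 0 - q0) + norm q0"
      using fejer[OF q0, of 0 t] norm_triangle_sub[of "x t" q0] by simp
  qed
  from bound[OF this, folded S_def] obtain c N where c: "0 < c" "1 \<le> N"
    "\<And>y. y \<in> range x \<Longrightarrow> c * infdist y S ^ N \<le> Max ((\<lambda>j. norm (y - T j y)) ` J)" by blast
  have cD: "c * D t ^ N \<le> Max ((\<lambda>j. norm (x t - T j (x t))) ` J)" for t
    using c(3)[of "x t"] by (simp add: D_def)
  \<comment> \<open>The 9 is the square of the 3 in the residual bound below, and \<open>p\<close>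
    comes from the Cauchy-Schwarz inequality for the sum \<open>A\<close> of \<open>p\<close> step
    lengths.\<close>
  have dec: "c\<^sup>2 / (9 * real p) * (D t)\<^sup>2 ^ N \<le> (D t)\<^sup>2 - (D (t + p))\<^sup>2" for t
  proof -
    define \<delta> where "\<delta> i = norm (x (t + i) - x (Suc (t + i)))" for i
    define A where "A = (\<Sum>i<p. \<delta> i)"
    have \<delta>0: "0 \<le> \<delta> i" for i by (simp add: \<delta>_def)
    have partial: "norm (x t - x (t + i)) \<le> (\<Sum>k<i. \<delta> k)" for i
    proof (induction i)
      case (Suc i)
      then show ?case
        using norm_triangle_ineq[of "x t - x (t + i)" "x (t + i) - x (Suc (t + i))"] by (simp add: \<delta>_def)
    qed simp
    \<comment> \<open>The residual is compared with a step in the window at which \<open>T j\<close>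
      acts: the path to that step, the step itself, and the change of \<open>T j\<close> along the
      path are each at most \<open>A\<close>.\<close>
    have "norm (x t - T j (x t)) \<le> 3 * A" if j: "j \<in> J" for j
    proof -
      obtain i where i: "i < p" "s (t + i) = j" using cyc[OF j] by blast
      have "(\<Sum>k<i. \<delta> k) \<le> A" unfolding A_def using i \<delta>0 by (intro sum_mono2) auto
      then have 1: "norm (x t - x (t + i)) \<le> A" using partial[of i] by linarith
      have 2: "\<delta> i \<le> A" unfolding A_def using i \<delta>0 by (intro member_le_sum) auto
      have 3: "norm (T j (x (t + i)) - T j (x t)) \<le> A"
        using firmly_nonexpansive_norm[OF T[OF j], of "x (t + i)" "x t"] 1 by (simp add: norm_minus_commute)
      have "x t - T j (x t) = (x t - x (t + i)) + (x (t + i) - x (Suc (t + i)))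
          + (T j (x (t + i)) - T j (x t))"
        using step(2)[of "t + i"] i(2) by simp
      then show ?thesis
        using 1 2 3 norm_triangle_ineq[of "(x t - x (t + i)) + (x (t + i) - x (Suc (t + i)))" "T j (x (t + i)) - T j (x t)"]
          norm_triangle_ineq[of "x t - x (t + i)" "x (t + i) - x (Suc (t + i))"]
        by (simp add: \<delta>_def)
    qed
    then have "Max ((\<lambda>j. norm (x t - T j (x t))) ` J) \<le> 3 * A" using J by simp
    then have "c * D t ^ N \<le> 3 * A" using cD[of t] by linarith
    then have "(c * D t ^ N)\<^sup>2 \<le> (3 * A)\<^sup>2" by (rule power_mono) (use c(1) D0 in auto)
    moreover have "A\<^sup>2 \<le> (\<Sum>i<p. (\<delta> i)\<^sup>2) * real p"
      using sum_squared_le_sum_of_squares[of \<delta> "{..<p}"] by (simp add: A_def)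
    moreover obtain q where q: "q \<in> S" "D t = norm (x t - q)" using proj by blast
    have "(D (t + p))\<^sup>2 \<le> (norm (x (t + p) - q))\<^sup>2" by (intro power_mono D_le[OF q(1)] D0)
    then have "(\<Sum>i<p. (\<delta> i)\<^sup>2) \<le> (D t)\<^sup>2 - (D (t + p))\<^sup>2"
      using window[OF q(1), of t p] q(2) by (simp add: \<delta>_def)
    then have "(\<Sum>i<p. (\<delta> i)\<^sup>2) * real p \<le> ((D t)\<^sup>2 - (D (t + p))\<^sup>2) * real p"
      by (intro mult_right_mono) auto
    ultimately have "c\<^sup>2 * (D t)\<^sup>2 ^ N \<le> 9 * (((D t)\<^sup>2 - (D (t + p))\<^sup>2) * real p)"
      by (simp add: power_mult_distrib power_mult[symmetric] mult.commute)
    then show ?thesis using p by (simp add: field_simps)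
  qed
  have anti: "(D (Suc t))\<^sup>2 \<le> (D t)\<^sup>2" for t
  proof -
    obtain q where q: "q \<in> S" "D t = norm (x t - q)" using proj by blast
    have "D (Suc t) \<le> D t" using D_le[OF q(1), of "Suc t"] fejer[OF q(1), of t 1] q(2) by simp
    then show ?thesis using D0 by (rule power_mono)
  qed
  define b where "b = c\<^sup>2 / (9 * real p)"
  have b: "0 < b" using c(1) p by (simp add: b_def)
  \<comment> \<open>The decrease concerns the squared distance, so it is the power
    \<open>2 * N\<close> of \<open>D t\<close> that is bounded by a multiple of
    \<open>1 / t\<close>.\<close>
  define \<rho> where "\<rho> = 1 / real (2 * N)"
  have \<rho>: "0 < \<rho>" using c(2) by (simp add: \<rho>_def)
  define M where "M = (1 / b) powr \<rho> * (real p * (D 0)\<^sup>2) powr \<rho>"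
  have rate: "D t \<le> M * real t powr (- \<rho>)" if t: "1 \<le> t" for t
  proof -
    have "real t * (b * (D t)\<^sup>2 ^ N) \<le> real p * (D 0)\<^sup>2"
      using cyclic_decrease_rate[of "\<lambda>t. (D t)\<^sup>2" b N p t] anti b dec by (simp add: b_def)
    moreover have "(D t)\<^sup>2 ^ N = D t ^ (2 * N)" by (simp add: power_mult)
    ultimately have "b * D t ^ (2 * N) \<le> real p * (D 0)\<^sup>2 / real t"
      using t by (simp add: field_simps)
    then have "D t \<le> (1 / b) powr \<rho> * (real p * (D 0)\<^sup>2 / real t) powr \<rho>"
      unfolding \<rho>_def using le_root_of_power_le[OF b _ D0, of "2 * N" t] c(2) by simp
    also have "(real p * (D 0)\<^sup>2 / real t) powr \<rho> = (real p * (D 0)\<^sup>2) powr \<rho> * real t powr (- \<rho>)"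
      using t by (simp add: powr_divide powr_minus_divide)
    finally show ?thesis by (simp add: M_def mult.assoc)
  qed
  have "(\<lambda>t. M * real t powr (- \<rho>)) \<longlonglongrightarrow> M * 0"
    using \<rho> by (intro tendsto_mult_left tendsto_neg_powr filterlim_real_sequentially) auto
  then have Dlim: "D \<longlonglongrightarrow> 0"
    by (intro tendsto_sandwich[of "\<lambda>_. 0" D sequentially "\<lambda>t. M * real t powr (- \<rho>)" 0])
       (auto simp: D0 intro!: eventually_sequentiallyI[of 1] rate)
  \<comment> \<open>By Fejer monotonicity both points lie within \<open>D t\<close> of the point of
    \<open>S\<close> nearest to \<open>x t\<close>.\<close>
  have close: "norm (x (t + n) - x t) \<le> 2 * D t" for t n
  proof -
    obtain q where q: "q \<in> S" "D t = norm (x t - q)" using proj by blast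
    then show ?thesis
      using fejer[OF q(1), of t n] norm_triangle_ineq4[of "x (t + n) - q" "x t - q"] by simp
  qed
  have "Cauchy x"
  proof (rule metric_CauchyI)
    fix \<epsilon> :: real assume "0 < \<epsilon>"
    then have "eventually (\<lambda>t. D t < \<epsilon> / 4) sequentially" using order_tendstoD(2)[OF Dlim, of "\<epsilon> / 4"] by simp
    then obtain t where t: "D t < \<epsilon> / 4" by (auto simp: eventually_sequentially)
    have "dist (x m) (x n) < \<epsilon>" if "t \<le> m" "t \<le> n" for m n
    proof -
      have "norm (x m - x t) \<le> 2 * D t" "norm (x n - x t) \<le> 2 * D t"
        using close[of t "m - t"] close[of t "n - t"] that by simp_all
      then show ?thesis
        using t norm_triangle_ineq4[of "x m - x t" "x n - x t"] by (simp add: dist_norm)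
    qed
    then show "\<exists>t. \<forall>m\<ge>t. \<forall>n\<ge>t. dist (x m) (x n) < \<epsilon>" by blast
  qed
  then obtain xbar where lim: "x \<longlonglongrightarrow> xbar" using Cauchy_convergent convergent_def by blast
  have "(\<lambda>t. infdist (x t) S) \<longlonglongrightarrow> infdist xbar S" by (intro tendsto_infdist lim)
  then have "infdist xbar S = 0" using Dlim LIMSEQ_unique unfolding D_def by blast
  then have xbar: "xbar \<in> S" using in_closed_iff_infdist_zero[OF S] by simp
  \<comment> \<open>Letting \<open>n\<close> tend to infinity in \<open>close\<close> bounds the
    distance to the limit by \<open>2 * D t\<close>.\<close>
  have "norm (x t - xbar) \<le> (2 * M) * real t powr (- \<rho>)" if "1 \<le> t" for t
  proof -
    have "(\<lambda>n. norm (x (n + t) - x t)) \<longlonglongrightarrow> norm (xbar - x t)"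
      by (intro tendsto_intros LIMSEQ_ignore_initial_segment lim)
    then have "norm (xbar - x t) \<le> 2 * D t"
      using close[of t] by (intro LIMSEQ_le_const2) (auto simp: add.commute)
    then show ?thesis using rate[OF that] by (simp add: norm_minus_commute)
  qed
  then show ?thesis using \<rho> xbar lim unfolding S_def by blast
qed

section \<open>Regularity and convergence for semi-algebraic sets\<close>

lemma DR_firmly_nonexpansive:
  assumes "closed C" "convex C" "closed D" "convex D" "C \<inter> D \<noteq> {}"
  shows "firmly_nonexpansive (DR C D)"
  unfolding firmly_nonexpansive_def using assms by (intro allI DR_firm_inequality) auto

lemma Fix_DR_supset:
  assumes "q \<in> C" "q \<in> D"
  shows "q \<in> Fix (DR C D)"
proof -
  have "2 *\<^sub>R q - q = q" by (simp add: scaleR_2)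
  then show ?thesis using assms by (simp add: Fix_def DR_eq closest_point_self)
qed

theorem proposition4p3:
  fixes C :: "nat \<Rightarrow> (real ^ 'n) set"
    and \<Omega> :: "nat \<Rightarrow> nat \<times> nat"
    and m p d :: nat
  assumes "1 \<le> m"
    and "\<And>i. i \<in> {1..m} \<Longrightarrow> closed (C i)"
    and "\<And>i. i \<in> {1..m} \<Longrightarrow> convex (C i)"
    and "\<And>i. i \<in> {1..m} \<Longrightarrow> semialgebraic_of_degree d (C i)"
    and "(\<Inter>i\<in>{1..m}. C i) \<noteq> {}"
    and "\<And>j. j \<in> {1..p} \<Longrightarrow> \<Omega> j \<in> {(i1, i2). i1 \<in> {1..m} \<and> i2 \<in> {1..m} \<and> i1 \<noteq> i2}"
    and "(\<Union>j\<in>{1..p}. {fst (\<Omega> j), snd (\<Omega> j)}) = {1..m}"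
  shows "(\<forall>j\<in>{1..p}.
            bounded_Hoelder_regular (DR_pair C (\<Omega> j)) \<and>
            (d = 1 \<longrightarrow> bounded_Hoelder_regular_with_uniform_exponent 1 (DR_pair C (\<Omega> j)))) \<and>
         bounded_Hoelder_regular_intersection {1..p} (\<lambda>j. Fix (DR_pair C (\<Omega> j))) \<and>
         (\<forall>x y z. multiple_sets_DR C p \<Omega> x y z \<longrightarrow>
            (\<exists>\<rho>>0. \<exists>xbar\<in>(\<Inter>j\<in>{1..p}. Fix (DR_pair C (\<Omega> j))).
               x \<longlonglongrightarrow> xbar \<and>
               (\<exists>M. \<forall>t\<ge>1. norm (x t - xbar) \<le> M * real t powr (- \<rho>))))"
proof -
  define T where "T j = DR_pair C (\<Omega> j)" for j
  define L where "L \<longleftrightarrow> d = 1"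
  obtain q where q: "\<And>i. i \<in> {1..m} \<Longrightarrow> q \<in> C i" using assms(5) by blast
  have \<Omega>: "fst (\<Omega> j) \<in> {1..m}" "snd (\<Omega> j) \<in> {1..m}" if "j \<in> {1..p}" for j
    using assms(6)[OF that] by auto
  \<comment> \<open>An empty list would cover no index, whereas \<open>1 \<le> m\<close>. Hence
    every \<open>Max\<close> over \<open>{1..p}\<close> below is a genuine maximum.\<close>
  have p: "1 \<le> p"
  proof (rule ccontr)
    assume "\<not> 1 \<le> p"
    then show False using assms(1,7) by auto
  qed
  have C: "closed (C i)" "convex (C i)" "C i \<noteq> {}" "definable L (\<lambda>x. x \<in> C i)" if "i \<in> {1..m}" for i
    using assms(2-4)[OF that] q[OF that] definable_semialgebraic by (auto simp: L_def)
  have T: "T j = DR (C (fst (\<Omega> j))) (C (snd (\<Omega> j)))" for j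
    by (simp add: T_def DR_pair_def)
  have firm: "firmly_nonexpansive (T j)" if "j \<in> {1..p}" for j
  proof -
    have "q \<in> C (fst (\<Omega> j)) \<inter> C (snd (\<Omega> j))" using q \<Omega>[OF that] by blast
    then show ?thesis unfolding T by (intro DR_firmly_nonexpansive C \<Omega>[OF that]) blast
  qed
  have residual: "definable L (\<lambda>z. infnorm (fst z - T j (fst z)) \<le> snd z)" if "j \<in> {1..p}" for j
    unfolding T by (intro definable_DR_residual C \<Omega>[OF that])
  have qFix: "q \<in> Fix (T j)" if "j \<in> {1..p}" for j
    unfolding T by (intro Fix_DR_supset q \<Omega>[OF that])
  define S where "S = (\<Inter>j\<in>{1..p}. Fix (T j))"
  have FixT: "closed (Fix (T j))" "convex (Fix (T j))" "definable L (\<lambda>x. x \<in> Fix (T j))"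
    if "j \<in> {1..p}" for j
    using Fix_closed_convex[OF firm[OF that]] definable_Fix[OF residual[OF that]] by auto
  have S: "S \<noteq> {}" "definable L (\<lambda>x. x \<in> S)"
  proof -
    have "q \<in> S" using qFix unfolding S_def by blast
    then show "S \<noteq> {}" by blast
    have "definable L (\<lambda>x. \<forall>j\<in>{1..p}. x \<in> Fix (T j))"
      by (rule definable_ball) (use FixT in auto)
    then show "definable L (\<lambda>x. x \<in> S)" by (simp add: S_def)
  qed
  have residual_cont: "continuous_on UNIV (\<lambda>x. infnorm (x - T j x))" if "j \<in> {1..p}" for j
    by (intro continuous_intros firmly_nonexpansive_continuous firm that)
  have zero: "x \<in> Fix (T j)" if "infnorm (x - T j x) = 0" for x j
    using that by (auto simp: infnorm_eq_0 Fix_def)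

  have single: "\<exists>c N. 0 < c \<and> 1 \<le> N \<and> (L \<longrightarrow> N = 1) \<and>
      (\<forall>x\<in>K. c * infdist x (Fix (T j)) ^ N \<le> norm (x - T j x))"
    if j: "j \<in> {1..p}" and K: "bounded K" for j K
  proof -
    have "\<exists>c N. 0 < c \<and> 1 \<le> N \<and> (L \<longrightarrow> N = 1) \<and>
      (\<forall>x\<in>K. c * infdist x (Fix (T j)) ^ N \<le> Max ((\<lambda>j. infnorm (x - T j x)) ` {j}))"
      by (rule definable_error_bound[OF _ FixT(3)[OF j]])
         (use K qFix[OF j] residual[OF j] residual_cont[OF j] zero in \<open>auto simp: infnorm_pos_le\<close>)
    then obtain c N where c: "0 < c" "1 \<le> N" "L \<longrightarrow> N = 1"
      "\<And>x. x \<in> K \<Longrightarrow> c * infdist x (Fix (T j)) ^ N \<le> Max ((\<lambda>j. infnorm (x - T j x)) ` {j})"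
      by blast
    have "c * infdist x (Fix (T j)) ^ N \<le> norm (x - T j x)" if "x \<in> K" for x
      using c(4)[OF that] infnorm_le_norm[of "x - T j x"] by simp
    then show ?thesis using c(1-3) by blast
  qed
  have "bounded_Hoelder_regular (T j)" if j: "j \<in> {1..p}" for j
    unfolding bounded_Hoelder_regular_def
  proof (intro conjI allI impI)
    show "Fix (T j) \<noteq> {}" using qFix[OF j] by blast
    fix K :: "(real ^ 'n) set" assume K: "bounded K"
    from single[OF j K] obtain c N where c: "0 < c" "1 \<le> N"
      "\<And>x. x \<in> K \<Longrightarrow> c * infdist x (Fix (T j)) ^ N \<le> norm (x - T j x)" by blast
    have "infdist x (Fix (T j)) \<le> (1 / c) powr (1 / real N) * norm (x - T j x) powr (1 / real N)"
      if "x \<in> K" for x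
      using le_root_of_power_le[OF c(1,2) infdist_nonneg c(3)[OF that]] .
    then show "\<exists>\<gamma> \<mu>. 0 < \<gamma> \<and> \<gamma> \<le> 1 \<and> 0 < \<mu> \<and>
        (\<forall>x\<in>K. infdist x (Fix (T j)) \<le> \<mu> * norm (x - T j x) powr \<gamma>)"
      using c(1,2) by (intro exI[of _ "1 / real N"] exI[of _ "(1 / c) powr (1 / real N)"]) auto
  qed
  moreover have "bounded_Hoelder_regular_with_uniform_exponent 1 (T j)"
    if j: "j \<in> {1..p}" and "d = 1" for j
    unfolding bounded_Hoelder_regular_with_uniform_exponent_def
  proof (intro conjI allI impI)
    show "Fix (T j) \<noteq> {}" using qFix[OF j] by blast
    fix K :: "(real ^ 'n) set" assume K: "bounded K"
    from single[OF j K] obtain c N where c: "0 < c"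
      "\<And>x. x \<in> K \<Longrightarrow> c * infdist x (Fix (T j)) ^ N \<le> norm (x - T j x)" and "N = 1"
      using \<open>d = 1\<close> unfolding L_def by blast
    have "infdist x (Fix (T j)) \<le> 1 / c * norm (x - T j x) powr 1" if "x \<in> K" for x
      using c(2)[OF that] c(1) \<open>N = 1\<close> by (simp add: field_simps)
    then show "\<exists>\<mu>. 0 < \<mu> \<and> (\<forall>x\<in>K. infdist x (Fix (T j)) \<le> \<mu> * norm (x - T j x) powr 1)"
      using c(1) by (intro exI[of _ "1 / c"]) auto
  qed auto
  moreover have "bounded_Hoelder_regular_intersection {1..p} (\<lambda>j. Fix (T j))"
    unfolding bounded_Hoelder_regular_intersection_def S_def[symmetric]
  proof (intro conjI allI impI ballI)
    show "closed (Fix (T j))" "convex (Fix (T j))" if "j \<in> {1..p}" for j using FixT that by auto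
    show "S \<noteq> {}" by (rule S(1))
    fix K :: "(real ^ 'n) set" assume K: "bounded K"
    \<comment> \<open>The functions \<open>g j\<close> are the distances themselves, in the maximum
      norm so that they are definable; the Euclidean distances in the goal are at least as
      large.\<close>
    have "\<exists>c N. 0 < c \<and> 1 \<le> N \<and> (L \<longrightarrow> N = 1) \<and>
      (\<forall>x\<in>K. c * infdist x S ^ N \<le> Max ((\<lambda>j. infnorm_dist (Fix (T j)) x) ` {1..p}))"
    proof (rule definable_error_bound[OF S])
      fix x assume x: "\<And>j. j \<in> {1..p} \<Longrightarrow> infnorm_dist (Fix (T j)) x = 0"
      have "x \<in> Fix (T j)" if j: "j \<in> {1..p}" for j
      proof -
        have ne: "Fix (T j) \<noteq> {}" using qFix[OF j] by blast
        then have "infdist x (Fix (T j)) = 0"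
          using infdist_le_infnorm_dist[OF ne, of x] x[OF j] infdist_nonneg[of x "Fix (T j)"] by simp
        then show ?thesis using in_closed_iff_infdist_zero[OF FixT(1)[OF j] ne] by simp
      qed
      then show "x \<in> S" by (simp add: S_def)
    next
      fix j assume j: "j \<in> {1..p}"
      then have ne: "Fix (T j) \<noteq> {}" using qFix by blast
      show "continuous_on UNIV (infnorm_dist (Fix (T j)))" by (rule continuous_on_infnorm_dist[OF ne])
      show "definable L (\<lambda>z. infnorm_dist (Fix (T j)) (fst z) \<le> snd z)"
        by (intro definable_le_of_less definable_infnorm_dist_less ne FixT j)
      show "0 \<le> infnorm_dist (Fix (T j)) x" for x by (rule infnorm_dist_nonneg[OF ne])
    qed (use p K in auto)
    then obtain c N where c: "0 < c" "1 \<le> N"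
      "\<And>x. x \<in> K \<Longrightarrow> c * infdist x S ^ N \<le> Max ((\<lambda>j. infnorm_dist (Fix (T j)) x) ` {1..p})"
      by blast
    have max: "Max ((\<lambda>j. infnorm_dist (Fix (T j)) x) ` {1..p}) \<le> Max ((\<lambda>j. infdist x (Fix (T j))) ` {1..p})" for x
    proof (rule Max.boundedI)
      fix a assume "a \<in> (\<lambda>j. infnorm_dist (Fix (T j)) x) ` {1..p}"
      then obtain j where j: "j \<in> {1..p}" "a = infnorm_dist (Fix (T j)) x" by blast
      then have "a \<le> infdist x (Fix (T j))" using qFix[OF j(1)] by (auto intro: infnorm_dist_le_infdist)
      also have "\<dots> \<le> Max ((\<lambda>j. infdist x (Fix (T j))) ` {1..p})" using j(1) by (intro Max_ge) auto
      finally show "a \<le> Max ((\<lambda>j. infdist x (Fix (T j))) ` {1..p})" .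
    qed (use p in auto)
    have "infdist x S \<le> (1 / c) powr (1 / real N) * Max ((\<lambda>j. infdist x (Fix (T j))) ` {1..p}) powr (1 / real N)"
      if "x \<in> K" for x
      using le_root_of_power_le[OF c(1,2) infdist_nonneg order_trans[OF c(3)[OF that] max]] .
    then show "\<exists>\<gamma> \<beta>. 0 < \<gamma> \<and> \<gamma> \<le> 1 \<and> 0 < \<beta> \<and>
        (\<forall>x\<in>K. infdist x S \<le> \<beta> * Max ((\<lambda>j. infdist x (Fix (T j))) ` {1..p}) powr \<gamma>)"
      using c(1,2) by (intro exI[of _ "1 / real N"] exI[of _ "(1 / c) powr (1 / real N)"]) auto
  qed
  moreover have "\<exists>\<rho>>0. \<exists>xbar\<in>(\<Inter>j\<in>{1..p}. Fix (T j)). x \<longlonglongrightarrow> xbar \<and>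
      (\<exists>M. \<forall>t\<ge>1. norm (x t - xbar) \<le> M * real t powr (- \<rho>))"
    if alg: "multiple_sets_DR C p \<Omega> x y z" for x y z
  \<comment> \<open>\<open>t mod p + 1\<close> is the representative of \<open>t + 1\<close> modulo
    \<open>p\<close> in \<open>{1..p}\<close>.\<close>
  proof (rule cyclic_iteration_rate[where s = "\<lambda>t. t mod p + 1" and p = p])
    show "finite {1..p}" "{1..p} \<noteq> {}" using p by auto
    show "firmly_nonexpansive (T j)" if "j \<in> {1..p}" for j by (rule firm[OF that])
    show "(\<Inter>j\<in>{1..p}. Fix (T j)) \<noteq> {}" using S(1) by (simp add: S_def)
    show index: "t mod p + 1 \<in> {1..p}" for t using p by (simp add: Suc_leI)
    show "x (Suc t) = T (t mod p + 1) (x t)" for t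
    proof -
      have "[t mod p + 1 = t + 1] (mod p)" by (simp add: cong_def mod_simps)
      then show ?thesis
        using alg index[of t] unfolding multiple_sets_DR_def Let_def T DR_eq
        by (fastforce simp: case_prod_beta)
    qed
    show "\<exists>i<p. (t + i) mod p + 1 = j" if j: "j \<in> {1..p}" for t j
    proof (intro exI conjI)
      \<comment> \<open>The number of steps until the index \<open>j\<close> is due; adding
        \<open>p - t mod p\<close> in place of subtracting \<open>t mod p\<close> stays within the
        naturals.\<close>
      define i where "i = (j - 1 + (p - t mod p)) mod p"
      show "i < p" using p by (simp add: i_def)
      have eq: "t + (j - 1 + (p - t mod p)) = (j - 1) + p * (t div p) + p"
        using p mult_div_mod_eq[of p t] mod_less_divisor[of p t] by linarith
      have "(t + i) mod p = ((j - 1) + p * (t div p) + p) mod p"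
        unfolding i_def mod_add_right_eq eq ..
      also have "\<dots> = (j - 1) mod p" by (simp only: mod_add_self2 mod_mult_self2)
      also have "\<dots> = j - 1" using j by (intro mod_less) auto
      finally show "(t + i) mod p + 1 = j" using j by simp
    qed
    fix K :: "(real ^ 'n) set" assume K: "bounded K"
    have "\<exists>c N. 0 < c \<and> 1 \<le> N \<and> (L \<longrightarrow> N = 1) \<and>
      (\<forall>x\<in>K. c * infdist x S ^ N \<le> Max ((\<lambda>j. infnorm (x - T j x)) ` {1..p}))"
      by (rule definable_error_bound[OF S])
         (use p K residual residual_cont zero in \<open>auto simp: infnorm_pos_le S_def\<close>)
    then obtain c N where c: "0 < c" "1 \<le> N"
      "\<And>x. x \<in> K \<Longrightarrow> c * infdist x S ^ N \<le> Max ((\<lambda>j. infnorm (x - T j x)) ` {1..p})" by blast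
    have max: "Max ((\<lambda>j. infnorm (x - T j x)) ` {1..p}) \<le> Max ((\<lambda>j. norm (x - T j x)) ` {1..p})" for x
    proof (rule Max.boundedI)
      fix a assume "a \<in> (\<lambda>j. infnorm (x - T j x)) ` {1..p}"
      then obtain j where j: "j \<in> {1..p}" "a \<le> norm (x - T j x)" using infnorm_le_norm by blast
      note j(2)
      also have "norm (x - T j x) \<le> Max ((\<lambda>j. norm (x - T j x)) ` {1..p})"
        using j(1) by (intro Max_ge) auto
      finally show "a \<le> Max ((\<lambda>j. norm (x - T j x)) ` {1..p})" .
    qed (use p in auto)
    show "\<exists>c N. 0 < c \<and> 1 \<le> N \<and> (\<forall>x\<in>K. c * infdist x (\<Inter>j\<in>{1..p}. Fix (T j)) ^ N
        \<le> Max ((\<lambda>j. norm (x - T j x)) ` {1..p}))"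
      unfolding S_def[symmetric] using c(1,2) order_trans[OF c(3) max] by blast
  qed
  ultimately show ?thesis unfolding T_def by blast
qed

end
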